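(* Let $k$ and $\ell$ be integers satisfying $0\leq\ell< k/2$, and let $1/2<\alpha\leq 1$. For every $\delta>0$ there exists $\varepsilon>0$ such that the following holds for all sufficiently large $n$. If $(k-\ell)\mid n$, $\mathcal H$ is a $k$-uniform hypergraph on $n$ vertices, $\delta_{k-1}(\mathcal H)\geq \alpha n$ and $\Delta_{k-1}(\mathcal H)\le (\alpha+\varepsilon)n$, then there is a collection of pairwise edge-disjoint Hamilton $\ell$-cycles in $\mathcal H$ whose union covers all but at most $\delta\binom{n}{k}$ edges of $\mathcal H$.
   Context: For a $k$-uniform hypergraph $\mathcal H$ and a $(k-1)$-subset $A\subseteq V(\mathcal H)$, $d_{\mathcal H}(A)$ is the number of edges of $\mathcal H$ containing $A$; $\delta_{k-1}(\mathcal H)$ and $\Delta_{k-1}(\mathcal H)$ are the minimum and maximum of $d_{\mathcal H}(A)$ over all $(k-1)$-subsets $A$ of $V(\mathcal H)$. For $0\leq \ell<k$, a $(k,\ell)$-cycle is a $k$-uniform hypergraph whose vertices can be ordered cyclically such that the edges are segments of $k$ consecutive vertices of that order and every two consecutive edges share exactly $\ell$ vertices. A Hamilton $\ell$-cycle of $\mathcal H$ is a sub-hypergraph of $\mathcal H$ which is a $(k,\ell)$-cycle on all vertices of $\mathcal H$ (for $\ell=0$, a perfect matching).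
   Formalization: The formal statement assumes k ≥ 2; for k = 1, ℓ = 0 the claim is false (e.g. α = 0.6, δ = 0.1, with about 0.6n singletons as edges: the degree conditions hold, but there is no perfect matching and all edges stay uncovered). *)

theory Defs
  imports Complex_Main
begin

text \<open>A hypergraph is given by its vertex set \<open>V\<close> and its edge set \<open>E\<close>.\<close>

definition uniform_hypergraph :: "nat \<Rightarrow> 'a set \<Rightarrow> 'a set set \<Rightarrow> bool" where
  "uniform_hypergraph k V E \<longleftrightarrow> finite V \<and> (\<forall>e\<in>E. e \<subseteq> V \<and> card e = k)"

definition hdegree :: "'a set set \<Rightarrow> 'a set \<Rightarrow> nat" where
  "hdegree E A = card {e \<in> E. A \<subseteq> e}"

text \<open>Minimum and maximum over all \<open>r\<close>-subsets of \<open>V\<close>; meaningful only for \<open>r \<le> card V\<close>.\<close>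

definition min_hdegree :: "nat \<Rightarrow> 'a set \<Rightarrow> 'a set set \<Rightarrow> nat" where
  "min_hdegree r V E = Min (hdegree E ` {A. A \<subseteq> V \<and> card A = r})"

definition max_hdegree :: "nat \<Rightarrow> 'a set \<Rightarrow> 'a set set \<Rightarrow> nat" where
  "max_hdegree r V E = Max (hdegree E ` {A. A \<subseteq> V \<and> card A = r})"

definition cyclic_segment :: "nat \<Rightarrow> 'a list \<Rightarrow> nat \<Rightarrow> 'a set" where
  "cyclic_segment k vs i = {vs ! ((i + j) mod length vs) | j. j < k}"

text \<open>
  The list \<open>vs\<close> is the cyclic order of the vertices, and \<open>ps\<close> lists the positions at which
  the edges start, in increasing order, so that the consecutive edges are those at cyclically
  consecutive entries of \<open>ps\<close>. The condition that every vertex lies in an edge rules out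
  gaps: for \<open>l = 0\<close> the edges form a perfect matching, and for \<open>l > 0\<close> the edges
  close up around the whole cyclic order.
  If there is only one edge, there are no two consecutive edges.
\<close>

definition hypercycle :: "nat \<Rightarrow> nat \<Rightarrow> 'a set \<Rightarrow> 'a set set \<Rightarrow> bool" where
  "hypercycle k l V E \<longleftrightarrow>
     uniform_hypergraph k V E \<and> \<Union>E = V \<and>
     (\<exists>vs ps. distinct vs \<and> set vs = V \<and>
        sorted_wrt (<) ps \<and> (\<forall>p\<in>set ps. p < length vs) \<and>
        E = cyclic_segment k vs ` set ps \<and>
        (length ps \<ge> 2 \<longrightarrow>
          (\<forall>i<length ps.
             card (cyclic_segment k vs (ps ! i) \<inter>
                   cyclic_segment k vs (ps ! (Suc i mod length ps))) = l)))"

text \<open>A Hamilton cycle is spanning, hence determined by its edge set \<open>C\<close>.\<close>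

definition hamilton_cycle :: "nat \<Rightarrow> nat \<Rightarrow> 'a set \<Rightarrow> 'a set set \<Rightarrow> 'a set set \<Rightarrow> bool" where
  "hamilton_cycle k l V E C \<longleftrightarrow> C \<subseteq> E \<and> hypercycle k l V C"

end

theory Submission
  imports Defs
    "HOL-Library.FuncSet"
    "HOL-Library.Transitive_Closure_Table"
    "HOL-Combinatorics.Multiset_Permutations"
    "HOL-Real_Asymp.Real_Asymp"
begin

text \<open>
  Put \<open>q = k - l\<close> and \<open>m = n div q\<close>. List the vertices cyclically and remove one vertex from each of
  the \<open>m\<close> segments of a would-be Hamilton cycle, chosen so that it lies in no other segment. This
  leaves \<open>m\<close> frames of size \<open>k - 1\<close> and \<open>m\<close> free vertices, and every perfect matching of the
  bipartite graph in which a frame is joined to a free vertex if their union is an edge of the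
  hypergraph yields a Hamilton cycle. For a random listing this graph is nearly regular of degree
  \<open>\<alpha> m\<close>, by the codegree assumption and a concentration inequality for permutations.

  Take many independent random listings, so many that every edge of the hypergraph occurs in about
  \<open>d \<approx> \<surd>n\<close> of the bipartite graphs, and assign each edge to one of its occurrences at random. Since
  \<open>\<alpha> > 1/2\<close>, the number of edges between any two sets \<open>S\<close>, \<open>T\<close> of frames and free vertices with
  \<open>card S + card T > m\<close> is large enough for a union bound, so the sparsified graphs satisfy the
  Ore-Ryser condition for an \<open>r\<close>-factor with \<open>r\<close> almost \<open>\<alpha> m / d\<close>. The factor splits into \<open>r\<close>
  perfect matchings, and the resulting edge-disjoint Hamilton cycles use up almost all edges.
\<close>

subsection \<open>Factors of bipartite graphs\<close>

text \<open>The factor condition reads \<open>r * card S \<le> e(S, B - T) + r * card T\<close>;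
  exchanging \<open>T\<close> for its complement gives
  \<open>r * (card S + card T - m) \<le> e(S, T)\<close>, hence the pairs with
  \<open>card S + card T > m\<close>. As these are exponentially many, the union bound needs a
  failure probability that decays exponentially in \<open>min (card S) (card T)\<close>. Here
  \<alpha> > 1/2 enters: the larger set has at least \<open>m / 2\<close> elements, so every vertex
  of the smaller one has about \<open>(\<alpha> - 1/2) * m\<close> or more neighbours in it. The
  multiplicity \<open>d\<close> must lie well above \<open>ln n\<close>, so that no edge occurs too
  often, and well below \<open>n / ln n\<close>, since sparsified degrees are of order
  \<open>m / d\<close> and must dominate \<open>ln n\<close>; \<open>sqrt n\<close> is one such
  choice. It cancels at the end: \<open>N\<close> listings, with
  \<open>N * m^2 / (n choose k)\<close> close to \<open>d\<close>, give \<open>N * r * m\<close>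
  edges, close to \<open>\<alpha> * (n choose k)\<close>. Probability is expressed by counting: a
  good object exists because exponential moments summed over all bad events stay below the number of
  objects. Listings are drawn only from those with a nearly regular graph, which are almost all;
  this costs a factor \<open>1 + \<gamma>\<close>.\<close>

lemma rtrancl_path_mono_on:
  assumes "rtrancl_path r x xs y"
    and "\<And>a b. a \<in> insert x (set xs) \<Longrightarrow> b \<in> set xs \<Longrightarrow> r a b \<Longrightarrow> r' a b"
  shows "rtrancl_path r' x xs y"
  using assms
proof (induction)
  case (base x)
  show ?case by (rule rtrancl_path.base)
next
  case (step x y ys z)
  have "r' x y" using step.hyps(1) step.prems by simp
  moreover have "rtrancl_path r' y ys z"
    by (rule step.IH) (use step.prems in auto)
  ultimately show ?case by (rule rtrancl_path.step)
qed

lemma card_Image_insert: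
  assumes "finite F" "(a, b) \<notin> F"
  shows "card (insert (a, b) F `` {x}) = card (F `` {x}) + (if x = a then 1 else 0)"
proof (cases "x = a")
  case True
  have "insert (a, b) F `` {a} = insert b (F `` {a})" by auto
  then show ?thesis using assms True by (simp add: finite_Image)
next
  case False
  have "insert (a, b) F `` {x} = F `` {x}" using False by auto
  then show ?thesis using False by simp
qed

lemma card_Image_remove:
  assumes "finite F" "(a, b) \<in> F"
  shows "card ((F - {(a, b)}) `` {x}) = card (F `` {x}) - (if x = a then 1 else 0)"
proof (cases "x = a")
  case True
  have "(F - {(a, b)}) `` {a} = F `` {a} - {b}" by auto
  then show ?thesis using assms True by (simp add: finite_Image)
next
  case False
  have "(F - {(a, b)}) `` {x} = F `` {x}" using False by auto
  then show ?thesis using False by simp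
qed

lemma converse_insert_pair: "(insert (a, b) F)\<inverse> = insert (b, a) (F\<inverse>)"
  and converse_remove_pair: "(F - {(a, b)})\<inverse> = F\<inverse> - {(b, a)}"
  by auto

text \<open>Switching the first two edges of the path moves the deficiency from \<open>u\<close> to the next vertex, and
  since the path is simple the rest of it stays alternating.\<close>

lemma alternating_path_augment:
  fixes F G :: "('a \<times> 'b) set"
  assumes "rtrancl_path (\<lambda>a a'. \<exists>b. (a, b) \<in> G - F \<and> (a', b) \<in> F) u xs z"
    and "distinct (u # xs)" and "finite G" and "F \<subseteq> G"
    and "(z, b) \<in> G - F" and "card (F\<inverse> `` {b}) < r" and "card (F `` {u}) < r"
    and "\<And>a. card (F `` {a}) \<le> r" and "\<And>b. card (F\<inverse> `` {b}) \<le> r"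
  shows "\<exists>F'\<subseteq>G. card F' = Suc (card F) \<and> (\<forall>a. card (F' `` {a}) \<le> r) \<and> (\<forall>b. card (F'\<inverse> `` {b}) \<le> r)"
  using assms
proof (induction xs arbitrary: F u)
  case Nil
  have fin: "finite F" using Nil.prems finite_subset by blast
  have "u = z" using Nil.prems(1) by cases auto
  with Nil.prems have *: "(u, b) \<in> G" "(u, b) \<notin> F" by auto
  let ?F = "insert (u, b) F"
  have "card (?F `` {a}) \<le> r" for a
    using card_Image_insert[OF fin *(2), of a] Nil.prems(7) Nil.prems(8)[of a] by (auto split: if_splits)
  moreover have "card (?F\<inverse> `` {a}) \<le> r" for a
    using card_Image_insert[of "F\<inverse>" b u a] fin * Nil.prems(6) Nil.prems(9)[of a]
    unfolding converse_insert_pair by (auto split: if_splits)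
  moreover have "?F \<subseteq> G" "card ?F = Suc (card F)" using fin * Nil.prems(4) by auto
  ultimately show ?case by blast
next
  case (Cons y ys)
  have fin: "finite F" using Cons.prems finite_subset by blast
  from Cons.prems(1) obtain c where c: "(u, c) \<in> G" "(u, c) \<notin> F" "(y, c) \<in> F"
    and path: "rtrancl_path (\<lambda>a a'. \<exists>b. (a, b) \<in> G - F \<and> (a', b) \<in> F) y ys z"
    by cases auto
  have dist: "u \<noteq> y" "u \<notin> set ys" "y \<notin> set ys" "distinct ys" using Cons.prems(2) by auto
  let ?H = "F - {(y, c)}"
  let ?F = "insert (u, c) ?H"
  have fin0: "finite ?H" using fin by simp
  have nin: "(u, c) \<notin> ?H" using c by blast
  have dL: "card (?F `` {a}) = card (F `` {a}) - (if a = y then 1 else 0) + (if a = u then 1 else 0)" for a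
    using card_Image_insert[OF fin0 nin, of a] card_Image_remove[OF fin c(3), of a] by simp
  \<comment> \<open>Column \<open>c\<close> loses \<open>y\<close> and gains \<open>u\<close>; its
    degree must be positive, or the truncated \<open>0 - 1 + 1\<close> would not cancel.\<close>
  have pos: "card (F\<inverse> `` {c}) > 0"
    using c(3) fin by (auto simp: card_gt_0_iff)
  have dR: "card (?F\<inverse> `` {a}) = card (F\<inverse> `` {a})" for a
    unfolding converse_insert_pair converse_remove_pair
    using card_Image_insert[of "F\<inverse> - {(c, y)}" c u a] card_Image_remove[of "F\<inverse>" c y a] fin c pos
    by auto
  have posy: "card (F `` {y}) > 0"
    using c(3) fin by (auto simp: card_gt_0_iff)
  have cardF: "card ?F = card F"
    using card_insert_disjoint[OF fin0 nin] card_Suc_Diff1[OF fin c(3)] by (rule trans)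
  have z: "z \<in> insert y (set ys)"
  proof -
    have "rtrancl_path r' x xs w \<Longrightarrow> w \<in> insert x (set xs)" for r' x and xs :: "'a list" and w
      by (induction rule: rtrancl_path.induct) auto
    then show ?thesis using path by blast
  qed
  have "\<exists>F'\<subseteq>G. card F' = Suc (card ?F) \<and> (\<forall>a. card (F' `` {a}) \<le> r) \<and> (\<forall>b. card (F'\<inverse> `` {b}) \<le> r)"
  proof (rule Cons.IH)
    \<comment> \<open>Steps of the tail never start at \<open>u\<close> and never end at
      \<open>y\<close>, and \<open>?F\<close> differs from \<open>F\<close> only there; this is why
      \<open>rtrancl_path_mono_on\<close> restricts the targets to \<open>set xs\<close>.\<close>
    show "rtrancl_path (\<lambda>a a'. \<exists>b. (a, b) \<in> G - ?F \<and> (a', b) \<in> ?F) y ys z"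
      using path by (rule rtrancl_path_mono_on) (use dist in blast)
    show "distinct (y # ys)" using dist by simp
    show "finite G" by fact
    show "?F \<subseteq> G" using c Cons.prems(4) by auto
    show "(z, b) \<in> G - ?F" using Cons.prems(5) z dist by auto
    show "card (?F\<inverse> `` {b}) < r" unfolding dR by fact
    show "card (?F `` {y}) < r" unfolding dL using dist posy Cons.prems(8)[of y] by simp
    show "card (?F `` {a}) \<le> r" for a unfolding dL using Cons.prems(7) Cons.prems(8)[of a] by auto
    show "card (?F\<inverse> `` {a}) \<le> r" for a unfolding dR by fact
  qed
  then show ?case unfolding cardF .
qed

lemma card_eq_sum_Image:
  assumes "finite S" "finite F"
  shows "(\<Sum>a\<in>S. card (F `` {a})) = card (F \<inter> S \<times> UNIV)"
proof -
  have "F \<inter> S \<times> UNIV = Sigma S (\<lambda>a. F `` {a})" by auto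
  then show ?thesis using assms by (simp add: card_SigmaI finite_Image)
qed

lemma card_eq_sum_converse_Image:
  assumes "finite T" "finite F"
  shows "(\<Sum>b\<in>T. card (F\<inverse> `` {b})) = card (F \<inter> UNIV \<times> T)"
proof -
  have "card (F\<inverse> \<inter> T \<times> UNIV) = card (F \<inter> UNIV \<times> T)"
    by (rule bij_betw_same_card[of prod.swap]) (force simp: bij_betw_def inj_on_def)
  then show ?thesis using card_eq_sum_Image[of T "F\<inverse>"] assms by simp
qed

theorem bipartite_factor:
  fixes G :: "('a \<times> 'b) set"
  assumes fin: "finite A" "finite B" and AB: "card A = card B" and G: "G \<subseteq> A \<times> B"
    and cond: "\<And>S T. S \<subseteq> A \<Longrightarrow> T \<subseteq> B \<Longrightarrow> r * card S \<le> card (G \<inter> S \<times> (B - T)) + r * card T"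
  shows "\<exists>F\<subseteq>G. (\<forall>a\<in>A. card (F `` {a}) = r) \<and> (\<forall>b\<in>B. card (F\<inverse> `` {b}) = r)"
proof -
  have finG: "finite G" using fin G finite_subset by blast
  define P where "P F \<longleftrightarrow> F \<subseteq> G \<and> (\<forall>a. card (F `` {a}) \<le> r) \<and> (\<forall>b. card (F\<inverse> `` {b}) \<le> r)" for F
  have "P {}" by (simp add: P_def)
  moreover have "\<forall>F. P F \<longrightarrow> card F < Suc (card G)"
    unfolding P_def using finG by (auto simp: less_Suc_eq_le card_mono)
  ultimately obtain F where F: "P F" and max: "\<And>F'. P F' \<Longrightarrow> card F' \<le> card F"
    using ex_has_greatest_nat[of P "{}" card "Suc (card G)"] by (metis less_imp_le)
  have FG: "F \<subseteq> G" and dL: "\<And>a. card (F `` {a}) \<le> r" and dR: "\<And>b. card (F\<inverse> `` {b}) \<le> r"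
    using F by (auto simp: P_def)
  have finF: "finite F" using FG finG finite_subset by blast
  have sat: "card (F `` {u}) = r" if u: "u \<in> A" for u
  proof (rule ccontr)
    assume "card (F `` {u}) \<noteq> r"
    then have udef: "card (F `` {u}) < r" using dL[of u] by simp
    \<comment> \<open>One step leaves along an edge outside \<open>F\<close> and returns along an
      edge of \<open>F\<close>, so walks of \<open>R\<close> are alternating.\<close>
    define R where "R = (\<lambda>a a'. \<exists>b. (a, b) \<in> G - F \<and> (a', b) \<in> F)"
    define S where "S = {a. R\<^sup>*\<^sup>* u a}"
    define T where "T = (G - F) `` S"
    have "a \<in> A" if "R\<^sup>*\<^sup>* u a" for a
      using that by (induction) (use u G FG R_def in auto)
    then have SA: "S \<subseteq> A" by (auto simp: S_def)
    have TB: "T \<subseteq> B" using G by (auto simp: T_def)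
    have finS: "finite S" and finT: "finite T" using SA TB fin finite_subset by auto
    have Tsat: "card (F\<inverse> `` {b}) = r" if "b \<in> T" for b
    proof (rule ccontr)
      assume "card (F\<inverse> `` {b}) \<noteq> r"
      then have bdef: "card (F\<inverse> `` {b}) < r" using dR[of b] by simp
      from that obtain z where z: "R\<^sup>*\<^sup>* u z" "(z, b) \<in> G - F" by (auto simp: T_def S_def)
      then obtain xs0 where "rtrancl_path R u xs0 z" by (auto simp: rtranclp_eq_rtrancl_path)
      then obtain xs where xs: "rtrancl_path R u xs z" "distinct (u # xs)"
        by (rule rtrancl_path_distinct)
      have "\<exists>F'\<subseteq>G. card F' = Suc (card F) \<and> (\<forall>a. card (F' `` {a}) \<le> r) \<and> (\<forall>b. card (F'\<inverse> `` {b}) \<le> r)"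
        by (rule alternating_path_augment[OF xs(1)[unfolded R_def] xs(2) finG FG z(2) bdef udef dL dR])
      then obtain F' where "P F'" "card F' = Suc (card F)" unfolding P_def by blast
      then show False using max[of F'] by simp
    qed
    have closed: "a' \<in> S" if "b \<in> T" "(a', b) \<in> F" for a' b
    proof -
      from that obtain a where "R\<^sup>*\<^sup>* u a" "(a, b) \<in> G - F" by (auto simp: T_def S_def)
      then have "R a a'" using that by (auto simp: R_def)
      then show ?thesis using \<open>R\<^sup>*\<^sup>* u a\<close> by (simp add: S_def)
    qed
    have "card (F \<inter> S \<times> UNIV) < r * card S"
    proof -
      have uS: "u \<in> S" by (simp add: S_def)
      have "(\<Sum>a\<in>S. card (F `` {a})) < (\<Sum>a\<in>S. r)"
        by (rule sum_strict_mono_ex1) (use finS dL udef uS in auto)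
      then show ?thesis using card_eq_sum_Image[OF finS finF] by (simp add: mult.commute)
    qed
    \<comment> \<open>Edges of \<open>G\<close> from \<open>S\<close> to outside \<open>T\<close>
      lie in \<open>F\<close> by the choice of \<open>T\<close>, and edges of \<open>F\<close> into
      \<open>T\<close> start in \<open>S\<close> because \<open>S\<close> is closed under
      \<open>R\<close>.\<close>
    moreover have "F \<inter> S \<times> UNIV = (F \<inter> UNIV \<times> T) \<union> (G \<inter> S \<times> (B - T))"
      using closed FG G by (auto simp: T_def)
    moreover have "card ((F \<inter> UNIV \<times> T) \<union> (G \<inter> S \<times> (B - T))) = card (F \<inter> UNIV \<times> T) + card (G \<inter> S \<times> (B - T))"
      by (rule card_Un_disjoint) (use finF finG in auto)
    moreover have "card (F \<inter> UNIV \<times> T) = r * card T"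
      using card_eq_sum_converse_Image[OF finT finF] Tsat by (simp add: mult.commute)
    ultimately show False using cond[OF SA TB] by simp
  qed
  \<comment> \<open>Saturation of \<open>A\<close> gives \<open>r * card A = r * card B\<close>
    edges; no degree in \<open>B\<close> exceeds \<open>r\<close>, so all must attain it.\<close>
  have cardF: "card F = r * card A"
  proof -
    have "F \<inter> A \<times> UNIV = F" using FG G by auto
    then show ?thesis using card_eq_sum_Image[OF fin(1) finF] sat by (simp add: mult.commute)
  qed
  have "(\<Sum>b\<in>B. card (F\<inverse> `` {b})) = (\<Sum>b\<in>B. r)"
  proof -
    have "F \<inter> UNIV \<times> B = F" using FG G by auto
    then show ?thesis using card_eq_sum_converse_Image[OF fin(2) finF] cardF AB by (simp add: mult.commute)
  qed
  then have "card (F\<inverse> `` {b}) = r" if "b \<in> B" for b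
    using sum_mono_inv[of "\<lambda>b. card (F\<inverse> `` {b})" B "\<lambda>_. r"] dR that fin by auto
  then show ?thesis using FG sat by blast
qed


text \<open>By double counting, a regular graph satisfies the criterion for a 1-factor, and removing
  that factor leaves a regular graph. The injectivity clause encodes that the matchings are
  edge-disjoint.\<close>

lemma regular_bipartite_perfect_matchings:
  fixes F :: "('a \<times> 'b) set"
  assumes fin: "finite A" "finite B" and AB: "card A = card B" and "F \<subseteq> A \<times> B"
    and "\<And>a. a \<in> A \<Longrightarrow> card (F `` {a}) = r" and "\<And>b. b \<in> B \<Longrightarrow> card (F\<inverse> `` {b}) = r"
  shows "\<exists>M :: nat \<Rightarrow> 'a \<Rightarrow> 'b. (\<forall>i<r. bij_betw (M i) A B \<and> (\<forall>a\<in>A. (a, M i a) \<in> F)) \<and>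
           (\<forall>a\<in>A. inj_on (\<lambda>i. M i a) {..<r})"
  using assms(4-)
proof (induction r arbitrary: F)
  case 0
  then show ?case by auto
next
  case (Suc r)
  have finF: "finite F" using Suc.prems fin finite_subset by blast
  have "\<exists>F'\<subseteq>F. (\<forall>a\<in>A. card (F' `` {a}) = 1) \<and> (\<forall>b\<in>B. card (F'\<inverse> `` {b}) = 1)"
  proof (rule bipartite_factor[OF fin AB Suc.prems(1)])
    fix S T assume S: "S \<subseteq> A" and T: "T \<subseteq> B"
    have fS: "finite S" and fT: "finite T" using S T fin finite_subset by auto
    have "Suc r * card S = card (F \<inter> S \<times> UNIV)"
    proof -
      have "(\<Sum>a\<in>S. card (F `` {a})) = (\<Sum>a\<in>S. Suc r)"
        by (rule sum.cong) (use S Suc.prems in auto)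
      then show ?thesis using card_eq_sum_Image[OF fS finF] by (simp add: mult.commute)
    qed
    also have "\<dots> \<le> card ((F \<inter> S \<times> (B - T)) \<union> (F \<inter> UNIV \<times> T))"
      by (rule card_mono) (use finF Suc.prems in auto)
    also have "\<dots> \<le> card (F \<inter> S \<times> (B - T)) + card (F \<inter> UNIV \<times> T)" by (rule card_Un_le)
    also have "card (F \<inter> UNIV \<times> T) = Suc r * card T"
    proof -
      have "(\<Sum>a\<in>T. card (F\<inverse> `` {a})) = (\<Sum>a\<in>T. Suc r)"
        by (rule sum.cong) (use T Suc.prems in auto)
      then show ?thesis using card_eq_sum_converse_Image[OF fT finF] by (simp add: mult.commute)
    qed
    finally have *: "Suc r * card S \<le> card (F \<inter> S \<times> (B - T)) + Suc r * card T" .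
    \<comment> \<open>For \<open>card S > card T\<close>, subtracting
      \<open>r * card T \<le> r * card S\<close> from the double count leaves the condition with 1
      in place of \<open>Suc r\<close>.\<close>
    show "1 * card S \<le> card (F \<inter> S \<times> (B - T)) + 1 * card T"
    proof (cases "card S \<le> card T")
      case False
      then have "r * card T \<le> r * card S" by (intro mult_le_mono2) simp
      moreover have "s + a \<le> x + (t + b) \<Longrightarrow> b \<le> a \<Longrightarrow> s \<le> x + t" for s a x t b :: nat by linarith
      ultimately show ?thesis using *[unfolded mult_Suc] unfolding mult_1 by blast
    qed auto
  qed
  then obtain F' where F': "F' \<subseteq> F" "\<And>a. a \<in> A \<Longrightarrow> card (F' `` {a}) = 1" "\<And>b. b \<in> B \<Longrightarrow> card (F'\<inverse> `` {b}) = 1"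
    by blast
  define f where "f a = (THE b. (a, b) \<in> F')" for a
  have f: "(a, b) \<in> F' \<longleftrightarrow> b = f a" if a: "a \<in> A" for a b
  proof -
    obtain c where c: "F' `` {a} = {c}" using F'(2)[OF a] by (meson card_1_singletonE)
    then have "f a = c" unfolding f_def by (intro the_equality) auto
    then show ?thesis using c by auto
  qed
  have FF: "F' \<subseteq> A \<times> B" using F' Suc.prems by blast
  have bij: "bij_betw f A B"
  proof (rule bij_betw_imageI)
    show "inj_on f A"
    proof (rule inj_onI)
      fix x y assume xy: "x \<in> A" "y \<in> A" "f x = f y"
      then have "{x, y} \<subseteq> F'\<inverse> `` {f x}" using f by auto
      moreover have "f x \<in> B" using f xy FF by blast
      ultimately obtain c where "F'\<inverse> `` {f x} = {c}" using F'(3) by (meson card_1_singletonE)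
      then show "x = y" using \<open>{x, y} \<subseteq> F'\<inverse> `` {f x}\<close> by simp
    qed
    show "f ` A = B"
    proof
      show "f ` A \<subseteq> B" using f FF by blast
      show "B \<subseteq> f ` A"
      proof
        fix b assume "b \<in> B"
        then obtain a where "F'\<inverse> `` {b} = {a}" using F'(3) by (meson card_1_singletonE)
        then have "(a, b) \<in> F'" by auto
        then show "b \<in> f ` A" using f FF by blast
      qed
    qed
  qed
  have "\<exists>M :: nat \<Rightarrow> 'a \<Rightarrow> 'b. (\<forall>i<r. bij_betw (M i) A B \<and> (\<forall>a\<in>A. (a, M i a) \<in> F - F')) \<and>
           (\<forall>a\<in>A. inj_on (\<lambda>i. M i a) {..<r})"
  proof (rule Suc.IH)
    show "F - F' \<subseteq> A \<times> B" using Suc.prems by auto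
    show "card ((F - F') `` {a}) = r" if "a \<in> A" for a
    proof -
      have "(F - F') `` {a} = F `` {a} - F' `` {a}" by auto
      moreover have "F' `` {a} \<subseteq> F `` {a}" using F' by auto
      ultimately show ?thesis using F'(2)[OF that] Suc.prems(2)[OF that] finF F'(1)
        by (simp add: card_Diff_subset finite_Image finite_subset[OF F'(1) finF])
    qed
    show "card ((F - F')\<inverse> `` {a}) = r" if "a \<in> B" for a
    proof -
      have "(F - F')\<inverse> `` {a} = F\<inverse> `` {a} - F'\<inverse> `` {a}" by auto
      moreover have "F'\<inverse> `` {a} \<subseteq> F\<inverse> `` {a}" using F' by auto
      ultimately show ?thesis using F'(3)[OF that] Suc.prems(3)[OF that] finF F'(1)
        by (simp add: card_Diff_subset finite_Image finite_subset[OF F'(1) finF])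
    qed
  qed
  then obtain M :: "nat \<Rightarrow> 'a \<Rightarrow> 'b" where
    M0: "(\<forall>i<r. bij_betw (M i) A B \<and> (\<forall>a\<in>A. (a, M i a) \<in> F - F')) \<and> (\<forall>a\<in>A. inj_on (\<lambda>i. M i a) {..<r})" ..
  then have M: "\<And>i. i < r \<Longrightarrow> bij_betw (M i) A B" "\<And>i a. i < r \<Longrightarrow> a \<in> A \<Longrightarrow> (a, M i a) \<in> F - F'"
    "\<And>a. a \<in> A \<Longrightarrow> inj_on (\<lambda>i. M i a) {..<r}" by simp_all
  have "inj_on (\<lambda>i. (M(r := f)) i a) {..<Suc r}" if a: "a \<in> A" for a
  proof -
    have "f a \<noteq> M i a" if "i < r" for i
      using M(2)[OF that a] f[OF a, of "M i a"] by (metis DiffD2)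
    then have "f a \<notin> (\<lambda>i. M i a) ` {..<r}" by force
    moreover have "inj_on (\<lambda>i. (M(r := f)) i a) {..<r}"
      by (rule iffD2[OF inj_on_cong M(3)[OF a]]) simp
    moreover have "(\<lambda>i. (M(r := f)) i a) ` ({..<r} - {r}) = (\<lambda>i. M i a) ` {..<r}"
      by (rule image_cong) auto
    ultimately show ?thesis unfolding lessThan_Suc inj_on_insert by simp
  qed
  moreover have "bij_betw ((M(r := f)) i) A B \<and> (\<forall>a\<in>A. (a, (M(r := f)) i a) \<in> F)" if "i < Suc r" for i
  proof (cases "i = r")
    case True
    then show ?thesis using bij f F'(1) by (simp add: subset_iff)
  next
    case False
    then show ?thesis using that M(1)[of i] M(2)[of i] by simp
  qed
  ultimately show ?case by (intro exI[of _ "M(r := f)"] conjI allI impI ballI) auto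
qed

subsection \<open>Chernoff bounds in finite product spaces\<close>

lemma exp_le_quadratic:
  fixes x :: real
  assumes "x \<le> 1"
  shows "exp x \<le> 1 + x + x\<^sup>2"
proof (cases "0 \<le> x")
  case True
  then show ?thesis using exp_bound assms by blast
next
  case False
  then have neg: "x < 0" by simp
  have "1 - x \<le> exp (- x)" using exp_ge_add_one_self[of "- x"] by simp
  then have "exp x * (1 - x) \<le> 1"
    by (metis exp_ge_zero exp_minus_inverse mult_left_mono)
  also have "1 \<le> (1 + x + x\<^sup>2) * (1 - x)"
  proof -
    have "(1 + x + x\<^sup>2) * (1 - x) = 1 + (- x) * x\<^sup>2" by (simp add: algebra_simps power2_eq_square)
    moreover have "(- x) * x\<^sup>2 \<ge> 0" using neg by (intro mult_nonneg_nonneg) auto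
    ultimately show ?thesis by linarith
  qed
  finally show ?thesis using neg by simp
qed

text \<open>Meant for deviations of mean zero: the linear term averages out and only the exponential
  of the square remains, the one-step estimate of the method of bounded differences.\<close>

lemma exp_le_add_exp_square:
  fixes x :: real
  shows "exp x \<le> x + exp (x\<^sup>2)"
proof (cases "x \<le> 1")
  case True
  then show ?thesis using exp_le_quadratic[of x] exp_ge_add_one_self[of "x\<^sup>2"] by linarith
next
  case False
  then have "x \<le> x\<^sup>2" by (simp add: power2_eq_square)
  then have "exp x \<le> exp (x\<^sup>2)" by simp
  then show ?thesis using False by linarith
qed

text \<open>The moment generating function of a sum of independent indicators, multiplied by the
  number of points of the product space.\<close>

lemma sum_exp_card_PiE:
  fixes c :: real
  assumes "finite I" "\<And>i. i \<in> I \<Longrightarrow> finite (S i)" "\<And>i. i \<in> I \<Longrightarrow> B i \<subseteq> S i"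
  shows "(\<Sum>w\<in>PiE I S. exp (c * card {i\<in>I. w i \<in> B i}))
         = (\<Prod>i\<in>I. card (S i) + card (B i) * (exp c - 1))"
proof -
  have "exp (c * card {i\<in>I. w i \<in> B i}) = (\<Prod>i\<in>I. if w i \<in> B i then exp c else 1)" for w
  proof -
    have "(\<Prod>i\<in>I. if w i \<in> B i then exp c else 1) = (\<Prod>i\<in>{i\<in>I. w i \<in> B i}. exp c)"
      by (rule prod.inter_filter[OF assms(1), symmetric])
    then show ?thesis
      using exp_of_nat_mult[of "card {i\<in>I. w i \<in> B i}" c] by (simp add: mult.commute)
  qed
  then have "(\<Sum>w\<in>PiE I S. exp (c * card {i\<in>I. w i \<in> B i}))
      = (\<Sum>w\<in>PiE I S. \<Prod>i\<in>I. if w i \<in> B i then exp c else 1)" by simp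
  also have "\<dots> = (\<Prod>i\<in>I. \<Sum>x\<in>S i. if x \<in> B i then exp c else 1)"
    by (rule prod_sum_PiE[symmetric]) (use assms in auto)
  also have "\<dots> = (\<Prod>i\<in>I. card (S i) + card (B i) * (exp c - 1))"
  proof (rule prod.cong)
    fix i assume i: "i \<in> I"
    have "(\<Sum>x\<in>S i. if x \<in> B i then exp c else 1) = (\<Sum>x\<in>S i. 1 + (if x \<in> B i then exp c - 1 else 0))"
      by (rule sum.cong) auto
    also have "\<dots> = card (S i) + (\<Sum>x\<in>{x \<in> S i. x \<in> B i}. exp c - 1)"
      by (simp only: sum.distrib sum.inter_filter[OF assms(2)[OF i]]) simp
    also have "{x \<in> S i. x \<in> B i} = B i" using assms(3)[OF i] by auto
    finally show "(\<Sum>x\<in>S i. if x \<in> B i then exp c else 1) = card (S i) + card (B i) * (exp c - 1)" by simp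
  qed simp
  finally show ?thesis .
qed

text \<open>Upper Chernoff tail with a union bound over \<open>E\<close>. If every selection
  overloaded some \<open>e\<close>, the weights \<open>exp (c * (load - d))\<close> summed over
  \<open>e\<close> would be at least 1 for each \<open>f\<close>, yet their total over all
  \<open>f\<close> is below the number of selections. In the application \<Omega> consists of
  listings and \<open>cov e\<close> of those in which \<open>e\<close> occurs.\<close>

lemma exists_selection_bounded_multiplicity:
  fixes \<Omega> :: "'w set" and cov :: "'e \<Rightarrow> 'w set" and \<theta> \<gamma> :: real and N d :: nat
  assumes fin: "finite \<Omega>" "\<Omega> \<noteq> {}" "finite E"
    and cov: "\<And>e. e \<in> E \<Longrightarrow> cov e \<subseteq> \<Omega>" "\<And>e. e \<in> E \<Longrightarrow> card (cov e) \<le> \<theta> * card \<Omega>"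
    and \<gamma>: "0 < \<gamma>" "\<gamma> < 1" and \<theta>: "0 \<le> \<theta>" and N: "N * \<theta> \<le> (1 - \<gamma>) * d"
    and small: "card E * exp (- (\<gamma>\<^sup>2 / 4 * d)) < 1"
  shows "\<exists>f. (\<forall>t<N. f t \<in> \<Omega>) \<and> (\<forall>e\<in>E. card {t. t < N \<and> f t \<in> cov e} \<le> d)"
proof (rule ccontr)
  assume neg: "\<not> ?thesis"
  \<comment> \<open>This minimises \<open>c^2 - \<gamma> * c\<close>, the leading part of the
    exponent per unit of \<open>d\<close>, with value \<open>- \<gamma>^2 / 4\<close>.\<close>
  define c where "c = \<gamma> / 2"
  have c: "0 < c" "c \<le> 1" using \<gamma> by (auto simp: c_def)
  let ?P = "PiE {..<N} (\<lambda>_. \<Omega>)"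
  have ex: "\<exists>e\<in>E. d < card {t\<in>{..<N}. f t \<in> cov e}" if "f \<in> ?P" for f
  proof -
    have "\<forall>t<N. f t \<in> \<Omega>" using that by auto
    then have "\<exists>e\<in>E. \<not> card {t. t < N \<and> f t \<in> cov e} \<le> d" using neg by blast
    then show ?thesis by (simp add: not_le)
  qed
  have one: "1 \<le> (\<Sum>e\<in>E. exp (c * card {t\<in>{..<N}. f t \<in> cov e}) * exp (- c * d))" if f: "f \<in> ?P" for f
  proof -
    obtain e where e: "e \<in> E" "d < card {t\<in>{..<N}. f t \<in> cov e}" using ex[OF f] by blast
    have "c * d \<le> c * card {t\<in>{..<N}. f t \<in> cov e}" using e(2) c by (intro mult_left_mono) auto
    then have "1 \<le> exp (c * card {t\<in>{..<N}. f t \<in> cov e}) * exp (- c * d)"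
      by (simp flip: exp_add)
    also have "\<dots> \<le> (\<Sum>e\<in>E. exp (c * card {t\<in>{..<N}. f t \<in> cov e}) * exp (- c * d))"
      by (rule member_le_sum[OF e(1)]) (use fin in auto)
    finally show ?thesis .
  qed
  have cardP: "card ?P = card \<Omega> ^ N" by (simp add: card_PiE)
  have "real (card \<Omega> ^ N) = (\<Sum>f\<in>?P. 1)" by (simp add: cardP)
  also have "\<dots> \<le> (\<Sum>f\<in>?P. \<Sum>e\<in>E. exp (c * card {t\<in>{..<N}. f t \<in> cov e}) * exp (- c * d))"
    by (rule sum_mono) (rule one)
  also have "\<dots> = (\<Sum>e\<in>E. (\<Sum>f\<in>?P. exp (c * card {t\<in>{..<N}. f t \<in> cov e})) * exp (- c * d))"
    by (subst sum.swap) (simp add: sum_distrib_right)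
  also have "\<dots> \<le> (\<Sum>e\<in>E. real (card \<Omega>) ^ N * exp (- (\<gamma>\<^sup>2 / 4 * d)))"
  proof (rule sum_mono)
    fix e assume e: "e \<in> E"
    have "(\<Sum>f\<in>?P. exp (c * card {t\<in>{..<N}. f t \<in> cov e})) = (card \<Omega> + card (cov e) * (exp c - 1)) ^ N"
      by (subst sum_exp_card_PiE) (use fin cov e in auto)
    also have "\<dots> \<le> (card \<Omega> * exp (\<theta> * (exp c - 1))) ^ N"
    proof (rule power_mono)
      have "card (cov e) * (exp c - 1) \<le> (\<theta> * card \<Omega>) * (exp c - 1)"
        using cov(2)[OF e] c by (intro mult_right_mono) auto
      then have "card \<Omega> + card (cov e) * (exp c - 1) \<le> card \<Omega> * (1 + \<theta> * (exp c - 1))"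
        by (simp add: algebra_simps)
      also have "\<dots> \<le> card \<Omega> * exp (\<theta> * (exp c - 1))"
        by (intro mult_left_mono) auto
      finally show "card \<Omega> + card (cov e) * (exp c - 1) \<le> card \<Omega> * exp (\<theta> * (exp c - 1))" .
      show "0 \<le> card \<Omega> + card (cov e) * (exp c - 1)" using c by simp
    qed
    also have "\<dots> = real (card \<Omega>) ^ N * exp (N * \<theta> * (exp c - 1))"
      by (simp add: power_mult_distrib flip: exp_of_nat_mult)
    finally have "(\<Sum>f\<in>?P. exp (c * card {t\<in>{..<N}. f t \<in> cov e})) * exp (- c * d)
        \<le> real (card \<Omega>) ^ N * exp (N * \<theta> * (exp c - 1)) * exp (- c * d)"
      by (rule mult_right_mono) simp
    also have "\<dots> = real (card \<Omega>) ^ N * exp (N * \<theta> * (exp c - 1) - c * d)"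
      by (simp only: mult.assoc flip: exp_add) simp
    also have "\<dots> \<le> real (card \<Omega>) ^ N * exp (- (\<gamma>\<^sup>2 / 4 * d))"
    proof -
      have "N * \<theta> * (exp c - 1) \<le> N * \<theta> * (c + c\<^sup>2)"
        using exp_le_quadratic[OF c(2)] \<theta> by (intro mult_left_mono) auto
      also have "\<dots> \<le> (1 - \<gamma>) * d * (c + c\<^sup>2)"
        using N c by (intro mult_right_mono) auto
      also have "\<dots> = d * ((1 - \<gamma>) * (c + c\<^sup>2))" by simp
      also have "\<dots> \<le> d * (c - \<gamma>\<^sup>2 / 4)"
      proof (rule mult_left_mono)
        have "(1 - \<gamma>) * (c + c\<^sup>2) = c - \<gamma>\<^sup>2 / 4 - \<gamma> * c\<^sup>2"
          unfolding c_def by (simp add: field_simps power2_eq_square)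
        moreover have "\<gamma> * c\<^sup>2 \<ge> 0" using \<gamma> by simp
        ultimately show "(1 - \<gamma>) * (c + c\<^sup>2) \<le> c - \<gamma>\<^sup>2 / 4" by linarith
      qed simp
      finally have "N * \<theta> * (exp c - 1) - c * d \<le> - (\<gamma>\<^sup>2 / 4 * d)" by (simp add: algebra_simps)
      then show ?thesis by (intro mult_left_mono) auto
    qed
    finally show "(\<Sum>f\<in>?P. exp (c * card {t\<in>{..<N}. f t \<in> cov e})) * exp (- c * d)
        \<le> real (card \<Omega>) ^ N * exp (- (\<gamma>\<^sup>2 / 4 * d))" .
  qed
  also have "\<dots> = real (card \<Omega>) ^ N * (card E * exp (- (\<gamma>\<^sup>2 / 4 * d)))" by simp
  also have "\<dots> < real (card \<Omega>) ^ N * 1"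
    by (rule mult_strict_left_mono[OF small]) (use fin in \<open>simp add: card_gt_0_iff\<close>)
  finally show False by simp
qed

text \<open>Lower Chernoff tail with a union bound over \<open>J\<close>. Every \<open>e\<close>
  draws a rank below \<open>d\<close> even if it has fewer classes, so it enters each of its classes
  with probability exactly \<open>1 / d\<close>. Different \<open>e\<close> draw independently,
  which makes \<open>card (Q j \<inter> H (\<tau> j))\<close> binomial with mean
  \<open>card (Q j) / d\<close>.\<close>

lemma exists_balanced_split:
  fixes T :: "'e \<Rightarrow> 't set" and Q :: "'j \<Rightarrow> 'e set" and \<tau> :: "'j \<Rightarrow> 't" and \<gamma> :: real and d :: nat
  assumes fin: "finite E" "finite J" and d: "0 < d"
    and T: "\<And>e. e \<in> E \<Longrightarrow> finite (T e)" "\<And>e. e \<in> E \<Longrightarrow> card (T e) \<le> d"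
    and Q: "\<And>j. j \<in> J \<Longrightarrow> Q j \<subseteq> {e \<in> E. \<tau> j \<in> T e}"
    and \<gamma>: "0 < \<gamma>" "\<gamma> < 1"
    and small: "(\<Sum>j\<in>J. exp (- (\<gamma>\<^sup>2 / 4 * card (Q j) / d))) < 1"
  shows "\<exists>H. (\<forall>s t. s \<noteq> t \<longrightarrow> H s \<inter> H t = {}) \<and> (\<forall>t. H t \<subseteq> {e \<in> E. t \<in> T e}) \<and>
           (\<forall>j\<in>J. (1 - \<gamma>) * card (Q j) / d \<le> card (Q j \<inter> H (\<tau> j)))"
proof -
  have "\<exists>g. inj_on g (T e) \<and> g ` T e \<subseteq> {..<d}" if "e \<in> E" for e
    using card_le_inj[of "T e" "{..<d}"] T that by auto
  then obtain g where g: "\<And>e. e \<in> E \<Longrightarrow> inj_on (g e) (T e)" "\<And>e. e \<in> E \<Longrightarrow> g e ` T e \<subseteq> {..<d}"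
    by metis
  \<comment> \<open>\<open>g e\<close> ranks the candidate classes of \<open>e\<close>; a random rank \<open>w e\<close> below \<open>d\<close> selects one of them or none\<close>
  define H where "H w t = {e \<in> E. t \<in> T e \<and> g e t = w e}" for w :: "'e \<Rightarrow> nat" and t
  define c where "c = \<gamma> / 2"
  have c: "0 < c" "c \<le> 1" using \<gamma> by (auto simp: c_def)
  let ?P = "PiE E (\<lambda>_. {..<d})"
  have "\<exists>w\<in>?P. \<forall>j\<in>J. (1 - \<gamma>) * card (Q j) / d \<le> card (Q j \<inter> H w (\<tau> j))"
  proof (rule ccontr)
    assume neg: "\<not> ?thesis"
    \<comment> \<open>The ranks, at most one, with which \<open>e\<close> contributes to the test
      \<open>j\<close>; in this form \<open>sum_exp_card_PiE\<close> applies.\<close>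
    define B where "B j e = (if e \<in> Q j then {g e (\<tau> j)} else {})" for j e
    have HB: "Q j \<inter> H w (\<tau> j) = {e\<in>E. w e \<in> B j e}" if "j \<in> J" for w j
      using Q[OF that] by (auto simp: H_def B_def split: if_splits)
    have one: "1 \<le> (\<Sum>j\<in>J. exp (- c * card {e\<in>E. w e \<in> B j e}) * exp (c * ((1 - \<gamma>) * card (Q j) / d)))"
      if w: "w \<in> ?P" for w
    proof -
      obtain j where j: "j \<in> J" "card {e\<in>E. w e \<in> B j e} < (1 - \<gamma>) * card (Q j) / d"
        using neg w HB by (metis not_le)
      have "c * card {e\<in>E. w e \<in> B j e} \<le> c * ((1 - \<gamma>) * card (Q j) / d)"
        using j(2) c by (intro mult_left_mono) auto
      then have "1 \<le> exp (- c * card {e\<in>E. w e \<in> B j e}) * exp (c * ((1 - \<gamma>) * card (Q j) / d))"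
        by (simp flip: exp_add)
      also have "\<dots> \<le> (\<Sum>j\<in>J. exp (- c * card {e\<in>E. w e \<in> B j e}) * exp (c * ((1 - \<gamma>) * card (Q j) / d)))"
        by (rule member_le_sum[OF j(1), where f = "\<lambda>j. exp (- c * card {e\<in>E. w e \<in> B j e}) * exp (c * ((1 - \<gamma>) * card (Q j) / d))"]) (use fin in auto)
      finally show ?thesis .
    qed
    have cardP: "card ?P = d ^ card E" using fin by (simp add: card_PiE)
    have "real (d ^ card E) = (\<Sum>w\<in>?P. 1)" by (simp add: cardP)
    also have "\<dots> \<le> (\<Sum>w\<in>?P. \<Sum>j\<in>J. exp (- c * card {e\<in>E. w e \<in> B j e}) * exp (c * ((1 - \<gamma>) * card (Q j) / d)))"
      by (rule sum_mono) (rule one)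
    also have "\<dots> = (\<Sum>j\<in>J. (\<Sum>w\<in>?P. exp (- c * card {e\<in>E. w e \<in> B j e})) * exp (c * ((1 - \<gamma>) * card (Q j) / d)))"
      by (subst sum.swap) (simp add: sum_distrib_right)
    also have "\<dots> \<le> (\<Sum>j\<in>J. real d ^ card E * exp (- (\<gamma>\<^sup>2 / 4 * card (Q j) / d)))"
    proof (rule sum_mono)
      fix j assume j: "j \<in> J"
      have QE: "Q j \<subseteq> E" using Q[OF j] by auto
      have "(\<Sum>w\<in>?P. exp (- c * card {e\<in>E. w e \<in> B j e}))
          = (\<Prod>e\<in>E. real (card {..<d}) + card (B j e) * (exp (- c) - 1))"
      proof (rule sum_exp_card_PiE)
        show "B j e \<subseteq> {..<d}" if "e \<in> E" for e
          using g(2)[OF that] Q[OF j] by (auto simp: B_def)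
      qed (use fin in auto)
      also have "\<dots> = (\<Prod>e\<in>E. real d * (if e \<in> Q j then 1 + (exp (- c) - 1) / d else 1))"
        by (rule prod.cong) (use d in \<open>auto simp: B_def field_simps\<close>)
      also have "\<dots> = real d ^ card E * (\<Prod>e\<in>E. if e \<in> Q j then 1 + (exp (- c) - 1) / d else 1)"
        unfolding prod.distrib by simp
      also have "(\<Prod>e\<in>E. if e \<in> Q j then 1 + (exp (- c) - 1) / d else 1) = (1 + (exp (- c) - 1) / d) ^ card (Q j)"
      proof -
        have "{e \<in> E. e \<in> Q j} = Q j" using QE by auto
        then show ?thesis using fin by (simp flip: prod.inter_filter)
      qed
      also have "real d ^ card E * \<dots> \<le> real d ^ card E * exp ((exp (- c) - 1) / d) ^ card (Q j)"
      proof (intro mult_left_mono power_mono)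
        have "1 \<le> real d" using d by simp
        moreover have "0 \<le> exp (- c)" by simp
        ultimately have "1 - exp (- c) \<le> real d" by linarith
        then have "(1 - exp (- c)) / d \<le> 1" using d by (simp add: divide_le_eq)
        then show "0 \<le> 1 + (exp (- c) - 1) / d" by (simp add: diff_divide_distrib)
      qed (use exp_ge_add_one_self in auto)
      finally have "(\<Sum>w\<in>?P. exp (- c * card {e\<in>E. w e \<in> B j e})) * exp (c * ((1 - \<gamma>) * card (Q j) / d))
          \<le> real d ^ card E * exp ((exp (- c) - 1) / d) ^ card (Q j) * exp (c * ((1 - \<gamma>) * card (Q j) / d))"
        by (rule mult_right_mono) simp
      also have "\<dots> = real d ^ card E * exp (card (Q j) / d * ((exp (- c) - 1) + c * (1 - \<gamma>)))"
        by (simp add: algebra_simps add_divide_distrib diff_divide_distrib flip: exp_of_nat_mult exp_add)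
      also have "\<dots> \<le> real d ^ card E * exp (card (Q j) / d * (- (\<gamma>\<^sup>2 / 4)))"
      proof -
        have "(exp (- c) - 1) + c * (1 - \<gamma>) \<le> - (\<gamma>\<^sup>2 / 4)"
          using exp_le_quadratic[of "- c"] c unfolding c_def by (simp add: field_simps power2_eq_square)
        then have "card (Q j) / d * ((exp (- c) - 1) + c * (1 - \<gamma>)) \<le> card (Q j) / d * (- (\<gamma>\<^sup>2 / 4))"
          by (rule mult_left_mono) auto
        then show ?thesis by (intro mult_left_mono) auto
      qed
      finally show "(\<Sum>w\<in>?P. exp (- c * card {e\<in>E. w e \<in> B j e})) * exp (c * ((1 - \<gamma>) * card (Q j) / d))
          \<le> real d ^ card E * exp (- (\<gamma>\<^sup>2 / 4 * card (Q j) / d))" by (simp add: mult_ac)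
    qed
    also have "\<dots> = real d ^ card E * (\<Sum>j\<in>J. exp (- (\<gamma>\<^sup>2 / 4 * card (Q j) / d)))" by (simp add: sum_distrib_left)
    also have "\<dots> < real d ^ card E * 1"
      by (rule mult_strict_left_mono[OF small]) (use d in simp)
    finally show False by simp
  qed
  then obtain w where w: "\<forall>j\<in>J. (1 - \<gamma>) * card (Q j) / d \<le> card (Q j \<inter> H w (\<tau> j))" by blast
  have "H w s \<inter> H w t = {}" if "s \<noteq> t" for s t
    using that g(1) by (auto simp: H_def inj_on_def)
  moreover have "H w t \<subseteq> {e \<in> E. t \<in> T e}" for t by (auto simp: H_def)
  ultimately show ?thesis using w by blast
qed

subsection \<open>Concentration for random permutations\<close>

lemma sum_permutations_of_set:
  fixes h :: "'a list \<Rightarrow> real"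
  assumes "finite A" "A \<noteq> {}"
  shows "(\<Sum>xs\<in>permutations_of_set A. h xs) = (\<Sum>x\<in>A. \<Sum>ys\<in>permutations_of_set (A - {x}). h (x # ys))"
proof -
  have "(\<Sum>xs\<in>permutations_of_set A. h xs) = (\<Sum>x\<in>A. \<Sum>xs\<in>(#) x ` permutations_of_set (A - {x}). h xs)"
    unfolding permutations_of_set_nonempty[OF assms(2)]
    by (rule sum.UNION_disjoint) (use assms in auto)
  also have "\<dots> = (\<Sum>x\<in>A. \<Sum>ys\<in>permutations_of_set (A - {x}). h (x # ys))"
    by (rule sum.cong) (simp_all add: sum.reindex)
  finally show ?thesis .
qed

text \<open>Reveal the entries one at a time: by the swap condition the conditional means for two values of
  the first entry differ by at most \<open>c\<close>.\<close>

lemma sum_exp_permutations_le: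
  fixes f :: "'a list \<Rightarrow> real" and c :: real
  assumes "finite A"
    and "\<And>xs i j. xs \<in> permutations_of_set A \<Longrightarrow> i < length xs \<Longrightarrow> j < length xs \<Longrightarrow>
           \<bar>f (xs[i := xs ! j, j := xs ! i]) - f xs\<bar> \<le> c"
  shows "(\<Sum>xs\<in>permutations_of_set A. exp (f xs))
         \<le> fact (card A) * exp ((\<Sum>xs\<in>permutations_of_set A. f xs) / fact (card A) + c\<^sup>2 * card A)"
  using assms
proof (induction "card A" arbitrary: A f)
  case 0
  then show ?case by simp
next
  case (Suc n)
  have ne: "A \<noteq> {}" and cA: "card A = Suc n" using Suc.hyps(2) by auto
  define g where "g x = (\<Sum>ys\<in>permutations_of_set (A - {x}). f (x # ys)) / fact n" for x
  define \<mu> where "\<mu> = (\<Sum>xs\<in>permutations_of_set A. f xs) / fact (card A)"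
  have inner: "(\<Sum>ys\<in>permutations_of_set (A - {x}). exp (f (x # ys))) \<le> fact n * exp (g x + c\<^sup>2 * n)"
    if x: "x \<in> A" for x
  proof -
    have card: "n = card (A - {x})" using cA x Suc.prems(1) by simp
    have "(\<Sum>ys\<in>permutations_of_set (A - {x}). exp (f (x # ys)))
      \<le> fact (card (A - {x})) * exp ((\<Sum>ys\<in>permutations_of_set (A - {x}). f (x # ys)) / fact (card (A - {x})) + c\<^sup>2 * card (A - {x}))"
    proof (rule Suc.hyps(1)[OF card])
      show "finite (A - {x})" using Suc.prems by simp
      fix ys i j assume ys: "ys \<in> permutations_of_set (A - {x})" "i < length ys" "j < length ys"
      have "x # ys \<in> permutations_of_set A"
        using ys x permutations_of_setD[OF ys(1)] by (intro permutations_of_setI) auto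
      from Suc.prems(2)[OF this, of "Suc i" "Suc j"] ys
      show "\<bar>f (x # ys[i := ys ! j, j := ys ! i]) - f (x # ys)\<bar> \<le> c" by simp
    qed
    then show ?thesis by (simp add: g_def flip: card)
  qed
  have gdiff: "\<bar>g x - g y\<bar> \<le> c" if xy: "x \<in> A" "y \<in> A" for x y
  proof (cases "x = y")
    case True
    obtain xs where "xs \<in> permutations_of_set A" using Suc.prems(1)
      by (metis all_not_in_conv permutations_of_set_empty_iff)
    moreover then have "0 < length xs" using ne by (auto dest: permutations_of_setD)
    ultimately have "0 \<le> c" using Suc.prems(2)[of xs 0 0] by simp
    then show ?thesis using True by simp
  next
    case False
    \<comment> \<open>Listings starting with \<open>x\<close> are matched with listings starting
      with \<open>y\<close> by exchanging \<open>x\<close> and \<open>y\<close>; on the tails this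
      is \<open>map \<tau>\<close>, and the full lists differ by one swap.\<close>
    define \<tau> where "\<tau> = (\<lambda>z. if z = y then x else z)"
    have inj: "inj_on \<tau> (A - {x})" by (auto simp: inj_on_def \<tau>_def)
    have im: "\<tau> ` (A - {x}) = A - {y}"
    proof
      show "\<tau> ` (A - {x}) \<subseteq> A - {y}" using xy False by (auto simp: \<tau>_def)
      show "A - {y} \<subseteq> \<tau> ` (A - {x})"
      proof
        fix z assume z: "z \<in> A - {y}"
        show "z \<in> \<tau> ` (A - {x})"
        proof (cases "z = x")
          case True
          then have "z = \<tau> y" by (simp add: \<tau>_def)
          then show ?thesis using xy False by auto
        next
          case False
          then have "z = \<tau> z" using z by (simp add: \<tau>_def)
          then show ?thesis using z False by auto
        qed
      qed
    qed
    have "permutations_of_set (A - {y}) = map \<tau> ` permutations_of_set (A - {x})"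
      using permutations_of_set_image_inj[OF inj] im by simp
    moreover have "inj_on (map \<tau>) (permutations_of_set (A - {x}))"
      using inj by (intro inj_on_mapI) (auto simp: inj_on_def dest: permutations_of_setD)
    ultimately have gy: "g y = (\<Sum>ys\<in>permutations_of_set (A - {x}). f (y # map \<tau> ys)) / fact n"
      by (simp add: g_def sum.reindex)
    have diff: "\<bar>f (y # map \<tau> ys) - f (x # ys)\<bar> \<le> c" if ys: "ys \<in> permutations_of_set (A - {x})" for ys
    proof -
      have dy: "distinct ys" "set ys = A - {x}" using permutations_of_setD[OF ys] by auto
      then obtain j where j: "j < length ys" "ys ! j = y" using xy False by (metis DiffI in_set_conv_nth singletonD)
      have "map \<tau> ys = ys[j := x]"
      proof (rule nth_equalityI)
        fix i assume "i < length (map \<tau> ys)"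
        then have i: "i < length ys" by simp
        have "ys ! i = y \<longleftrightarrow> i = j"
          using nth_eq_iff_index_eq[OF dy(1) i j(1)] j(2) by metis
        then show "map \<tau> ys ! i = ys[j := x] ! i"
          using i j(1) by (simp add: \<tau>_def nth_list_update)
      qed simp
      moreover have "x # ys \<in> permutations_of_set A"
        using xy dy by (intro permutations_of_setI) auto
      ultimately show ?thesis using Suc.prems(2)[of "x # ys" 0 "Suc j"] j by simp
    qed
    have cn: "card (permutations_of_set (A - {x})) = fact n" using xy Suc.prems(1) cA by simp
    have "\<bar>g x - g y\<bar> = \<bar>\<Sum>ys\<in>permutations_of_set (A - {x}). f (y # map \<tau> ys) - f (x # ys)\<bar> / fact n"
      unfolding gy by (subst abs_minus_commute) (simp add: g_def sum_subtractf flip: diff_divide_distrib)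
    also have "\<dots> \<le> (\<Sum>ys\<in>permutations_of_set (A - {x}). c) / fact n"
      by (intro divide_right_mono order_trans[OF sum_abs] sum_mono diff) auto
    also have "\<dots> = c" using cn by simp
    finally show ?thesis .
  qed
  have sum_g: "(\<Sum>x\<in>A. g x) = card A * \<mu>"
  proof -
    have "(\<Sum>x\<in>A. g x) = (\<Sum>xs\<in>permutations_of_set A. f xs) / fact n"
      unfolding sum_permutations_of_set[OF Suc.prems(1) ne] g_def by (simp add: sum_divide_distrib)
    then show ?thesis unfolding \<mu>_def cA by (simp add: fact_Suc del: of_nat_Suc)
  qed
  \<comment> \<open>\<mu> is the average of \<open>g\<close> over \<open>A\<close>, hence within
    \<open>c\<close> of every value of \<open>g\<close>.\<close>
  have dev: "(g x - \<mu>)\<^sup>2 \<le> c\<^sup>2" if x: "x \<in> A" for x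
  proof -
    have "card A * \<bar>g x - \<mu>\<bar> = \<bar>\<Sum>y\<in>A. g x - g y\<bar>"
      by (simp add: sum_subtractf sum_g abs_mult flip: right_diff_distrib)
    also have "\<dots> \<le> (\<Sum>y\<in>A. c)" by (intro order_trans[OF sum_abs] sum_mono gdiff x)
    finally have "card A * \<bar>g x - \<mu>\<bar> \<le> card A * c" by simp
    then have "\<bar>g x - \<mu>\<bar> \<le> c" using cA by (simp add: mult_le_cancel_left_pos del: of_nat_Suc)
    then show ?thesis using power_mono[of "\<bar>g x - \<mu>\<bar>" c 2] by simp
  qed
  \<comment> \<open>The deviations \<open>g x - \<mu>\<close> sum to zero, so
    \<open>exp_le_add_exp_square\<close> charges the first entry a factor \<open>exp (c^2)\<close>;
    by induction each further entry costs the same.\<close>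
  have "(\<Sum>x\<in>A. exp (g x)) = exp \<mu> * (\<Sum>x\<in>A. exp (g x - \<mu>))"
    by (simp add: sum_distrib_left exp_diff)
  also have "\<dots> \<le> exp \<mu> * (\<Sum>x\<in>A. (g x - \<mu>) + exp (c\<^sup>2))"
  proof (intro mult_left_mono sum_mono)
    fix x assume "x \<in> A"
    then show "exp (g x - \<mu>) \<le> (g x - \<mu>) + exp (c\<^sup>2)"
      using exp_le_add_exp_square[of "g x - \<mu>"] dev[of x] by (smt (verit) exp_le_cancel_iff)
  qed simp
  also have "\<dots> = card A * exp (\<mu> + c\<^sup>2)"
    by (simp add: sum.distrib sum_subtractf sum_g exp_add)
  finally have gsum: "(\<Sum>x\<in>A. exp (g x)) \<le> card A * exp (\<mu> + c\<^sup>2)" .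
  have "(\<Sum>xs\<in>permutations_of_set A. exp (f xs)) = (\<Sum>x\<in>A. \<Sum>ys\<in>permutations_of_set (A - {x}). exp (f (x # ys)))"
    by (rule sum_permutations_of_set[OF Suc.prems(1) ne])
  also have "\<dots> \<le> (\<Sum>x\<in>A. fact n * exp (g x + c\<^sup>2 * n))" by (rule sum_mono) (rule inner)
  also have "\<dots> = fact n * exp (c\<^sup>2 * n) * (\<Sum>x\<in>A. exp (g x))"
    by (simp add: sum_distrib_left sum_distrib_right exp_add mult_ac)
  also have "\<dots> \<le> fact n * exp (c\<^sup>2 * n) * (card A * exp (\<mu> + c\<^sup>2))"
    by (rule mult_left_mono[OF gsum]) simp
  also have "\<dots> = fact (card A) * exp (\<mu> + c\<^sup>2 * card A)"
    unfolding cA by (simp add: algebra_simps exp_add)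
  finally show ?case unfolding \<mu>_def .
qed

lemma card_permutations_deviation:
  fixes f :: "'a list \<Rightarrow> real" and c s \<mu> :: real
  assumes A: "finite A" "A \<noteq> {}" and c: "0 < c" and s: "0 \<le> s"
    and lip: "\<And>xs i j. xs \<in> permutations_of_set A \<Longrightarrow> i < length xs \<Longrightarrow> j < length xs \<Longrightarrow>
           \<bar>f (xs[i := xs ! j, j := xs ! i]) - f xs\<bar> \<le> c"
    and \<mu>: "(\<Sum>xs\<in>permutations_of_set A. f xs) = fact (card A) * \<mu>"
  shows "card {xs \<in> permutations_of_set A. s < \<bar>f xs - \<mu>\<bar>} \<le> 2 * fact (card A) * exp (- (s\<^sup>2 / (4 * c\<^sup>2 * card A)))"
proof -
  define n where "n = card A"
  have n: "0 < n" using A by (simp add: n_def card_gt_0_iff)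
  \<comment> \<open>The minimiser of \<open>b^2 * c^2 * n - b * s\<close>, with value
    \<open>- s^2 / (4 * c^2 * n)\<close>.\<close>
  define b where "b = s / (2 * c\<^sup>2 * n)"
  have b: "0 \<le> b" using s c by (simp add: b_def)
  have tail: "card {xs \<in> permutations_of_set A. s < \<sigma> * (f xs - \<mu>)} \<le> fact n * exp (- (s\<^sup>2 / (4 * c\<^sup>2 * n)))"
    if \<sigma>: "\<bar>\<sigma>\<bar> = 1" for \<sigma> :: real
  proof -
    have "real (card {xs \<in> permutations_of_set A. s < \<sigma> * (f xs - \<mu>)})
        = (\<Sum>xs\<in>permutations_of_set A. if s < \<sigma> * (f xs - \<mu>) then 1 else 0)"
      by (simp flip: sum.inter_filter)
    also have "\<dots> \<le> (\<Sum>xs\<in>permutations_of_set A. exp (b * \<sigma> * f xs) * exp (- b * (\<sigma> * \<mu> + s)))"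
    proof (rule sum_mono)
      fix xs
      have "1 \<le> exp (b * \<sigma> * f xs) * exp (- b * (\<sigma> * \<mu> + s))" if "s < \<sigma> * (f xs - \<mu>)"
      proof -
        have "b * s \<le> b * (\<sigma> * (f xs - \<mu>))" using that b by (intro mult_left_mono) auto
        then show ?thesis by (simp add: algebra_simps flip: exp_add)
      qed
      then show "(if s < \<sigma> * (f xs - \<mu>) then 1 else 0) \<le> exp (b * \<sigma> * f xs) * exp (- b * (\<sigma> * \<mu> + s))"
        by simp
    qed
    also have "\<dots> = (\<Sum>xs\<in>permutations_of_set A. exp (b * \<sigma> * f xs)) * exp (- b * (\<sigma> * \<mu> + s))"
      by (simp add: sum_distrib_right)
    also have "\<dots> \<le> (fact n * exp ((\<Sum>xs\<in>permutations_of_set A. b * \<sigma> * f xs) / fact n + (b * c)\<^sup>2 * n)) * exp (- b * (\<sigma> * \<mu> + s))"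
    proof (rule mult_right_mono)
      show "(\<Sum>xs\<in>permutations_of_set A. exp (b * \<sigma> * f xs))
        \<le> fact n * exp ((\<Sum>xs\<in>permutations_of_set A. b * \<sigma> * f xs) / fact n + (b * c)\<^sup>2 * n)"
        unfolding n_def
      proof (rule sum_exp_permutations_le[OF A(1)])
        fix xs i j assume "xs \<in> permutations_of_set A" "i < length xs" "j < length xs"
        from lip[OF this] have "b * \<bar>\<sigma>\<bar> * \<bar>f (xs[i := xs ! j, j := xs ! i]) - f xs\<bar> \<le> b * 1 * c"
          using b \<sigma> by (intro mult_mono) auto
        then show "\<bar>b * \<sigma> * f (xs[i := xs ! j, j := xs ! i]) - b * \<sigma> * f xs\<bar> \<le> b * c"
          using b by (simp add: abs_mult flip: right_diff_distrib)
      qed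
    qed simp
    also have "(\<Sum>xs\<in>permutations_of_set A. b * \<sigma> * f xs) / fact n = b * \<sigma> * \<mu>"
      using \<mu> by (simp add: n_def flip: sum_distrib_left)
    also have "(fact n * exp (b * \<sigma> * \<mu> + (b * c)\<^sup>2 * n)) * exp (- b * (\<sigma> * \<mu> + s)) = fact n * exp (b\<^sup>2 * c\<^sup>2 * n - b * s)"
      by (simp add: algebra_simps power_mult_distrib flip: exp_add)
    also have "b\<^sup>2 * c\<^sup>2 * n - b * s = - (s\<^sup>2 / (4 * c\<^sup>2 * n))"
      using c n by (simp add: b_def field_simps power2_eq_square)
    finally show ?thesis .
  qed
  have split: "{xs \<in> permutations_of_set A. s < \<bar>f xs - \<mu>\<bar>}
      = {xs \<in> permutations_of_set A. s < 1 * (f xs - \<mu>)} \<union> {xs \<in> permutations_of_set A. s < - 1 * (f xs - \<mu>)}"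
    by auto
  have "card {xs \<in> permutations_of_set A. s < \<bar>f xs - \<mu>\<bar>}
    \<le> card {xs \<in> permutations_of_set A. s < 1 * (f xs - \<mu>)} + card {xs \<in> permutations_of_set A. s < - 1 * (f xs - \<mu>)}"
    unfolding split by (rule card_Un_le)
  then show ?thesis using tail[of 1] tail[of "- 1"] by (simp add: n_def)
qed

section \<open>Entries of a random listing at fixed positions\<close>

lemma ex_bij_betw_mapping_subset:
  assumes "finite V" "S \<subseteq> V" "S' \<subseteq> V" "card S = card S'"
  shows "\<exists>p. bij_betw p V V \<and> p ` S = S'"
proof -
  have fin: "finite S" "finite S'" using assms finite_subset by auto
  obtain g where g: "bij_betw g S S'" using fin assms(4) finite_same_card_bij by blast
  obtain h where h: "bij_betw h (V - S) (V - S')"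
    using assms fin finite_same_card_bij[of "V - S" "V - S'"] by (auto simp: card_Diff_subset)
  let ?p = "\<lambda>x. if x \<in> S then g x else h x"
  have "bij_betw ?p (S \<union> (V - S)) (S' \<union> (V - S'))"
    by (rule bij_betw_disjoint_Un) (use g h in auto)
  moreover have "S \<union> (V - S) = V" "S' \<union> (V - S') = V" using assms by auto
  moreover have "?p ` S = S'" using g by (auto simp: bij_betw_def)
  ultimately show ?thesis by metis
qed

text \<open>Relabelling the entries by a permutation of \<open>V\<close> that carries one set to
  another shows that all sets of this size are hit equally often: the entries at the positions
  \<open>Q\<close> form a uniformly random subset.\<close>

lemma card_permutations_image_eq:
  assumes V: "finite V" and Q: "Q \<subseteq> {..<card V}" and S: "S \<subseteq> V" "card S = card Q"
  shows "card {xs \<in> permutations_of_set V. (!) xs ` Q = S} * (card V choose card Q) = fact (card V)"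
proof -
  define N where "N S = {xs \<in> permutations_of_set V. (!) xs ` Q = S}" for S
  have le: "card (N S1) \<le> card (N S2)"
    if S12: "S1 \<subseteq> V" "card S1 = card Q" "S2 \<subseteq> V" "card S2 = card Q" for S1 S2
  proof -
    obtain p where p: "bij_betw p V V" "p ` S1 = S2"
      using ex_bij_betw_mapping_subset[OF V S12(1,3)] S12 by auto
    have inj: "inj_on p V" and im: "p ` V = V" using p by (auto simp: bij_betw_def)
    show ?thesis
    proof (rule card_inj_on_le)
      show "inj_on (map p) (N S1)"
        by (intro inj_on_mapI inj_on_subset[OF inj]) (auto simp: N_def dest: permutations_of_setD)
      show "map p ` N S1 \<subseteq> N S2"
      proof
        fix ys assume "ys \<in> map p ` N S1"
        then obtain xs where "xs \<in> N S1" and ys: "ys = map p xs" by (rule imageE)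
        then have xs: "xs \<in> permutations_of_set V" "(!) xs ` Q = S1" by (simp_all add: N_def)
        have "ys \<in> permutations_of_set V"
          using permutations_of_set_image_inj[OF inj] imageI[OF xs(1), of "map p"] ys im by metis
        moreover have "(!) ys ` Q = p ` ((!) xs ` Q)"
        proof -
          have "(!) ys ` Q = (\<lambda>i. p (xs ! i)) ` Q"
            using Q length_finite_permutations_of_set[OF xs(1)] ys by (intro image_cong) auto
          then show ?thesis by (simp add: image_image)
        qed
        ultimately show "ys \<in> N S2" using p(2) xs(2) by (simp add: N_def)
      qed
      show "finite (N S2)" by (simp add: N_def)
    qed
  qed
  have eq: "card (N S') = card (N S)" if "S' \<subseteq> V" "card S' = card Q" for S'
    using le[of S S'] le[of S' S] that S by simp
  have "permutations_of_set V = (\<Union>S'\<in>{S'. S' \<subseteq> V \<and> card S' = card Q}. N S')"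
  proof -
    have "(!) xs ` Q \<subseteq> V \<and> card ((!) xs ` Q) = card Q" if "xs \<in> permutations_of_set V" for xs
    proof -
      have l: "length xs = card V" "distinct xs" "set xs = V"
        using permutations_of_setD[OF that] length_finite_permutations_of_set[OF that] by auto
      have "inj_on ((!) xs) Q" using l Q by (auto simp: inj_on_def nth_eq_iff_index_eq subset_iff)
      then show ?thesis using l Q by (auto simp: card_image)
    qed
    then show ?thesis by (auto simp: N_def)
  qed
  then have "fact (card V) = card (\<Union>S'\<in>{S'. S' \<subseteq> V \<and> card S' = card Q}. N S')"
    using card_permutations_of_set[OF V] by simp
  also have "\<dots> = (\<Sum>S'\<in>{S'. S' \<subseteq> V \<and> card S' = card Q}. card (N S'))"
    by (rule card_UN_disjoint) (use V in \<open>auto simp: N_def\<close>)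
  also have "\<dots> = (\<Sum>S'\<in>{S'. S' \<subseteq> V \<and> card S' = card Q}. card (N S))"
    by (rule sum.cong) (use eq in auto)
  also have "\<dots> = card (N S) * (card V choose card Q)"
    using n_subsets[OF V] by simp
  finally show ?thesis by (simp add: N_def)
qed

subsection \<open>Edge counts in dense bipartite graphs\<close>

lemma sum_Pow_power:
  fixes x :: real
  assumes "finite A"
  shows "(\<Sum>S\<in>Pow A. x ^ card S) = (1 + x) ^ card A"
  using assms
proof (induction A)
  case empty
  then show ?case by simp
next
  case (insert a A)
  have "(\<Sum>S\<in>Pow (insert a A). x ^ card S)
      = (\<Sum>S\<in>Pow A. x ^ card S) + (\<Sum>S\<in>insert a ` Pow A. x ^ card S)"
    unfolding Pow_insert by (rule sum.union_disjoint) (use insert in auto)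
  also have "(\<Sum>S\<in>insert a ` Pow A. x ^ card S) = (\<Sum>S\<in>Pow A. x ^ card (insert a S))"
    by (rule sum.reindex_cong[of "insert a"]) (use insert in \<open>auto simp: inj_on_def\<close>)
  also have "\<dots> = (\<Sum>S\<in>Pow A. x * x ^ card S)"
  proof (rule sum.cong)
    fix S assume "S \<in> Pow A"
    then have "finite S" "a \<notin> S" using insert finite_subset by auto
    then show "x ^ card (insert a S) = x * x ^ card S" by simp
  qed simp
  finally show ?case using insert by (simp add: algebra_simps flip: sum_distrib_left)
qed

text \<open>If \<open>card S \<le> card T\<close>, then \<open>card (B - T) < card S\<close>, so the term is at most
  \<open>x ^ card S * x ^ card (B - T)\<close> with \<open>x = exp (- (K / 2))\<close>; such terms sum to powers of \<open>1 + x\<close>.\<close>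

lemma sum_exp_min_card_le:
  fixes K :: real and A :: "'a set" and B :: "'b set"
  assumes fin: "finite A" "finite B" and card: "card A = m" "card B = m" and K: "0 \<le> K"
    and small: "m * exp (- (K / 2)) \<le> 1"
  shows "(\<Sum>(S, T) | S \<subseteq> A \<and> T \<subseteq> B \<and> m < card S + card T. exp (- (K * min (card S) (card T))))
         \<le> 12 * m * exp (- (K / 2))"
proof -
  define x where "x = exp (- (K / 2))"
  have x: "0 < x" by (simp add: x_def)
  have exp_x: "exp (- (K * s)) = x ^ (2 * s)" for s :: nat
    by (simp add: x_def mult.commute flip: exp_of_nat_mult)
  have x1: "x \<le> 1" using K by (simp add: x_def)
  let ?J = "{(S, T). S \<subseteq> A \<and> T \<subseteq> B \<and> m < card S + card T}"
  have fJ: "?J \<subseteq> Pow A \<times> Pow B" by auto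
  have finJ: "finite (Pow A \<times> Pow B)" using fin by simp
  \<comment> \<open>Leaving out the empty set turns one factor into
    \<open>(1 + x)^m - 1 \<le> 2 * m * x\<close>, which is small, while the other is merely at most
    3. Generic sets and types allow both orders of \<open>A\<close> and \<open>B\<close>.\<close>
  have one_side: "(\<Sum>(S, T)\<in>Pow X \<times> Pow Y. if S = {} then 0 else x ^ card S * x ^ card (Y - T)) \<le> 6 * m * x"
    if X: "finite X" "card X = m" and Y: "finite Y" "card Y = m" for X :: "'c set" and Y :: "'d set"
  proof -
    have "(\<Sum>(S, T)\<in>Pow X \<times> Pow Y. if S = {} then 0 else x ^ card S * x ^ card (Y - T))
        = (\<Sum>S\<in>Pow X. if S = {} then 0 else x ^ card S) * (\<Sum>T\<in>Pow Y. x ^ card (Y - T))"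
      unfolding sum_product by (subst sum.cartesian_product[symmetric]) (intro sum.cong, auto)
    also have "(\<Sum>T\<in>Pow Y. x ^ card (Y - T)) = (\<Sum>T\<in>Pow Y. x ^ card T)"
      by (rule sum.reindex_bij_witness[of _ "\<lambda>T. Y - T" "\<lambda>T. Y - T"]) auto
    also have "\<dots> = (1 + x) ^ m" using sum_Pow_power[OF Y(1)] Y by simp
    also have "(\<Sum>S\<in>Pow X. if S = {} then 0 else x ^ card S) = (1 + x) ^ m - 1"
    proof -
      have "(\<Sum>S\<in>Pow X. if S = {} then 0 else x ^ card S) = (\<Sum>S\<in>Pow X. x ^ card S - (if S = {} then 1 else 0))"
        by (rule sum.cong) auto
      also have "\<dots> = (1 + x) ^ m - 1"
        using sum_Pow_power[OF X(1)] X by (simp add: sum_subtractf)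
      finally show ?thesis .
    qed
    also have "((1 + x) ^ m - 1) * (1 + x) ^ m \<le> (2 * (m * x)) * 3"
    proof (rule mult_mono)
      have mx: "m * x \<le> 1" using small by (simp add: x_def)
      have "(1 + x) ^ m \<le> exp x ^ m" using x by (intro power_mono) auto
      also have "\<dots> = exp (m * x)" by (simp flip: exp_of_nat_mult)
      finally have e: "(1 + x) ^ m \<le> exp (m * x)" .
      also have "\<dots> \<le> 1 + m * x + (m * x)\<^sup>2" using exp_le_quadratic[OF mx] .
      also have "(m * x)\<^sup>2 \<le> m * x" using mx x by (simp add: power2_eq_square mult_left_le)
      finally show *: "(1 + x) ^ m - 1 \<le> 2 * (m * x)" by linarith
      show "(1 + x) ^ m \<le> 3" using * mx by simp
    qed (use x in auto)
    finally show ?thesis by simp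
  qed
  have "(\<Sum>(S, T)\<in>?J. exp (- (K * min (card S) (card T))))
      \<le> (\<Sum>(S, T)\<in>?J. (if S = {} then 0 else x ^ card S * x ^ card (B - T)) + (if T = {} then 0 else x ^ card T * x ^ card (A - S)))"
  proof (rule sum_mono, clarify)
    fix S T assume S: "S \<subseteq> A" and T: "T \<subseteq> B" and lt: "m < card S + card T"
    have cS: "card (A - S) = m - card S" and cT: "card (B - T) = m - card T"
      and sm: "card S \<le> m" "card T \<le> m"
      using card_mono[OF fin(1) S] card_mono[OF fin(2) T] S T fin card by (auto simp: card_Diff_subset finite_subset)
    have ne: "S \<noteq> {}" "T \<noteq> {}" using lt sm by auto
    have "exp (- (K * min (card S) (card T))) \<le> x ^ card S * x ^ card (B - T) + x ^ card T * x ^ card (A - S)"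
    proof (cases "card S \<le> card T")
      case True
      have "exp (- (K * min (card S) (card T))) = x ^ (2 * card S)" using True exp_x by (simp add: min_def)
      also have "\<dots> \<le> x ^ (card S + card (B - T))"
        by (rule power_decreasing) (use x x1 lt cT in auto)
      also have "\<dots> \<le> x ^ card S * x ^ card (B - T) + x ^ card T * x ^ card (A - S)" using x by (simp add: power_add)
      finally show ?thesis .
    next
      case False
      have "exp (- (K * min (card S) (card T))) = x ^ (2 * card T)" using False exp_x by (simp add: min_def)
      also have "\<dots> \<le> x ^ (card T + card (A - S))"
        by (rule power_decreasing) (use x x1 lt cS in auto)
      also have "\<dots> \<le> x ^ card S * x ^ card (B - T) + x ^ card T * x ^ card (A - S)" using x by (simp add: power_add)
      finally show ?thesis .
    qed
    then show "exp (- (K * min (card S) (card T)))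
      \<le> (if S = {} then 0 else x ^ card S * x ^ card (B - T)) + (if T = {} then 0 else x ^ card T * x ^ card (A - S))"
      using ne by simp
  qed
  also have "\<dots> \<le> (\<Sum>(S, T)\<in>Pow A \<times> Pow B. (if S = {} then 0 else x ^ card S * x ^ card (B - T)) + (if T = {} then 0 else x ^ card T * x ^ card (A - S)))"
    by (rule sum_mono2[OF finJ fJ]) (use x in auto)
  also have "\<dots> = (\<Sum>(S, T)\<in>Pow A \<times> Pow B. if S = {} then 0 else x ^ card S * x ^ card (B - T))
      + (\<Sum>(S, T)\<in>Pow A \<times> Pow B. if T = {} then 0 else x ^ card T * x ^ card (A - S))"
    unfolding sum.distrib[symmetric] by (rule sum.cong) auto
  also have "(\<Sum>(S, T)\<in>Pow A \<times> Pow B. if T = {} then 0 else x ^ card T * x ^ card (A - S))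
      = (\<Sum>(T, S)\<in>Pow B \<times> Pow A. if T = {} then 0 else x ^ card T * x ^ card (A - S))"
    by (rule sum.reindex_bij_witness[of _ prod.swap prod.swap]) auto
  also have "(\<Sum>(S, T)\<in>Pow A \<times> Pow B. if S = {} then 0 else x ^ card S * x ^ card (B - T))
      + (\<Sum>(T, S)\<in>Pow B \<times> Pow A. if T = {} then 0 else x ^ card T * x ^ card (A - S)) \<le> 6 * m * x + 6 * m * x"
    by (intro add_mono one_side) (use fin card in auto)
  finally show ?thesis by (simp add: x_def)
qed

text \<open>From the edges at \<open>S\<close>, at least \<open>x * m * card S\<close>, those into
  \<open>B - T\<close> are discarded. At most half of \<open>B\<close> lies outside
  \<open>T\<close>, as \<open>card S \<le> card T\<close>; this gives the second bound and the
  threshold 1/2. For the first, put \<open>s = card S\<close> and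
  \<open>\<tau> = m - card T\<close>. When \<open>s\<close> is large,
  \<open>s - \<tau> \<ge> \<kappa> * m\<close>, so that the slack \<eta> below \<open>x\<close>
  absorbs the irregularity \<open>y - x\<close> of the degrees; this is the source of
  \<open>(y - x) / 2 \<le> \<eta> * \<kappa>\<close>.\<close>

lemma dense_bipartite_edge_count:
  fixes G :: "('a \<times> 'b) set" and x y \<rho> \<kappa> \<eta> :: real
  assumes fin: "finite A" "finite B" and card: "card A = m" "card B = m" and G: "G \<subseteq> A \<times> B"
    and lo: "\<And>a. a \<in> A \<Longrightarrow> x * m \<le> card (G `` {a})"
    and hi: "\<And>b. b \<in> B \<Longrightarrow> card (G\<inverse> `` {b}) \<le> y * m"
    and S: "S \<subseteq> A" and T: "T \<subseteq> B" and le: "card S \<le> card T" "m \<le> card S + card T"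
    and xy: "x \<le> y" and \<eta>: "0 \<le> \<eta>" "(y - x) / 2 \<le> \<eta> * \<kappa>" and \<rho>: "\<rho> \<le> x - \<eta>" and \<kappa>: "0 \<le> \<kappa>" "\<kappa> \<le> \<rho> - 1/2"
  shows "\<rho> * m * (card S + card T - real m) \<le> card (G \<inter> S \<times> T)"
    and "\<kappa> * m * card S \<le> card (G \<inter> S \<times> T)"
proof -
  have finG: "finite G" using G fin finite_subset by blast
  have finS: "finite S" and finT: "finite T" using S T fin finite_subset by auto
  define s where "s = real (card S)"
  define \<tau> where "\<tau> = real m - card T"
  have Tm: "card T \<le> m" using card_mono[OF fin(2) T] card by simp
  have cBT: "real (card (B - T)) = \<tau>"
    using T finT card Tm by (simp add: card_Diff_subset \<tau>_def of_nat_diff)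
  have \<tau>: "0 \<le> \<tau>" "\<tau> \<le> s" "\<tau> \<le> m / 2" and s: "0 \<le> s"
  proof -
    have r: "real (card S) \<le> card T" "real m \<le> real (card S) + card T" "real (card T) \<le> m"
      using le Tm by linarith+
    then show "0 \<le> \<tau>" "\<tau> \<le> s" "\<tau> \<le> m / 2" "0 \<le> s" by (auto simp: \<tau>_def s_def)
  qed
  have split: "(\<Sum>a\<in>S. card (G `` {a})) = card (G \<inter> S \<times> T) + card (G \<inter> S \<times> (B - T))"
  proof -
    have "G \<inter> S \<times> UNIV = (G \<inter> S \<times> T) \<union> (G \<inter> S \<times> (B - T))" using G by auto
    moreover have "card \<dots> = card (G \<inter> S \<times> T) + card (G \<inter> S \<times> (B - T))"
      by (rule card_Un_disjoint) (use finG in auto)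
    ultimately show ?thesis using card_eq_sum_Image[OF finS finG] by simp
  qed
  have "x * m * s = (\<Sum>a\<in>S. x * m)" by (simp add: s_def)
  also have "\<dots> \<le> (\<Sum>a\<in>S. real (card (G `` {a})))" by (rule sum_mono) (use lo S in auto)
  also have "\<dots> = card (G \<inter> S \<times> T) + real (card (G \<inter> S \<times> (B - T)))"
    using split by (simp flip: of_nat_sum)
  finally have main: "x * m * s \<le> card (G \<inter> S \<times> T) + real (card (G \<inter> S \<times> (B - T)))" .
  have out1: "real (card (G \<inter> S \<times> (B - T))) \<le> s * \<tau>"
  proof -
    have "card (G \<inter> S \<times> (B - T)) \<le> card (S \<times> (B - T))"
      by (rule card_mono) (use finS fin in auto)
    then have "real (card (G \<inter> S \<times> (B - T))) \<le> real (card (S \<times> (B - T)))" by (rule of_nat_mono)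
    then show ?thesis using cBT by (simp add: s_def card_cartesian_product)
  qed
  have out2: "real (card (G \<inter> S \<times> (B - T))) \<le> y * m * \<tau>"
  proof -
    have "card (G \<inter> S \<times> (B - T)) \<le> card (G \<inter> UNIV \<times> (B - T))"
      by (rule card_mono) (use finG in auto)
    also have "\<dots> = (\<Sum>b\<in>B - T. card (G\<inverse> `` {b}))"
      using card_eq_sum_converse_Image[of "B - T" G] fin finG by simp
    finally have "real (card (G \<inter> S \<times> (B - T))) \<le> (\<Sum>b\<in>B - T. real (card (G\<inverse> `` {b})))"
      by (simp flip: of_nat_sum)
    also have "\<dots> \<le> (\<Sum>b\<in>B - T. y * m)" by (rule sum_mono) (use hi in auto)
    also have "\<dots> = y * m * \<tau>" using cBT by simp
    finally show ?thesis .
  qed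
  have "s * (m / 2) \<ge> s * \<tau>" using \<tau> s by (intro mult_left_mono)
  moreover have "\<kappa> * m * s \<le> (x - 1/2) * m * s"
    using \<kappa> \<rho> \<eta> s by (intro mult_right_mono) auto
  moreover have "(x - 1/2) * m * s = x * m * s - s * (m / 2)" by (simp add: algebra_simps)
  ultimately show "\<kappa> * m * card S \<le> card (G \<inter> S \<times> T)" using main out1 by (simp add: s_def)
  have "\<rho> * m * (s - \<tau>) \<le> card (G \<inter> S \<times> T)"
  \<comment> \<open>small \<open>S\<close>: bound the edges into \<open>B - T\<close> trivially; large \<open>S\<close>: bound them by the degrees\<close>
  proof (cases "s \<le> \<rho> * m")
    case True
    have "(x - \<rho>) * m * s \<ge> 0" using \<rho> \<eta> s by simp
    moreover have "(\<rho> * m - s) * \<tau> \<ge> 0" using True \<tau> by simp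
    moreover have "x * m * s - s * \<tau> - \<rho> * m * (s - \<tau>) = (x - \<rho>) * m * s + (\<rho> * m - s) * \<tau>"
      by (simp add: algebra_simps)
    ultimately show ?thesis using main out1 by linarith
  next
    case False
    have "\<kappa> * m \<le> (\<rho> - 1/2) * m" using \<kappa> by (intro mult_right_mono) auto
    also have "\<dots> \<le> s - \<tau>" using False \<tau> by (simp add: algebra_simps)
    finally have st: "\<kappa> * m \<le> s - \<tau>" .
    have "(y - x) * m * \<tau> \<le> (y - x) * m * (m / 2)"
      using xy \<tau> by (intro mult_left_mono) auto
    also have "\<dots> = (y - x) / 2 * m * m" by simp
    also have "\<dots> \<le> (\<eta> * \<kappa>) * m * m" using \<eta> by (intro mult_right_mono) auto
    also have "\<dots> = \<eta> * m * (\<kappa> * m)" by simp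
    also have "\<dots> \<le> \<eta> * m * (s - \<tau>)" using st \<eta> by (intro mult_left_mono) auto
    also have "\<dots> \<le> (x - \<rho>) * m * (s - \<tau>)" using \<rho> \<tau> by (intro mult_right_mono) auto
    finally have "(y - x) * m * \<tau> \<le> (x - \<rho>) * m * (s - \<tau>)" .
    then show ?thesis using main out2 by (simp add: algebra_simps)
  qed
  moreover have "s - \<tau> = card S + card T - real m" by (simp add: s_def \<tau>_def)
  ultimately show "\<rho> * m * (card S + card T - real m) \<le> card (G \<inter> S \<times> T)" by simp
qed

subsection \<open>Templates for Hamilton cycles\<close>

lemma card_supersets_of_card:
  assumes "finite V" "S \<subseteq> V" "card S \<le> r"
  shows "card {B. B \<subseteq> V \<and> card B = r \<and> S \<subseteq> B} = (card V - card S) choose (r - card S)"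
proof -
  have finS: "finite S" using assms finite_subset by blast
  have "bij_betw (\<lambda>B. B - S) {B. B \<subseteq> V \<and> card B = r \<and> S \<subseteq> B} {C. C \<subseteq> V - S \<and> card C = r - card S}"
  proof (rule bij_betw_byWitness[where f' = "\<lambda>C. C \<union> S"])
    show "(\<lambda>B. B - S) ` {B. B \<subseteq> V \<and> card B = r \<and> S \<subseteq> B} \<subseteq> {C. C \<subseteq> V - S \<and> card C = r - card S}"
      using finS by (auto simp: card_Diff_subset)
    show "(\<lambda>C. C \<union> S) ` {C. C \<subseteq> V - S \<and> card C = r - card S} \<subseteq> {B. B \<subseteq> V \<and> card B = r \<and> S \<subseteq> B}"
    proof
      fix B assume "B \<in> (\<lambda>C. C \<union> S) ` {C. C \<subseteq> V - S \<and> card C = r - card S}"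
      then obtain C where C: "C \<subseteq> V - S" "card C = r - card S" "B = C \<union> S" by auto
      have "finite C" using C assms finite_subset by blast
      then have "card B = card C + card S" using C finS by (simp add: card_Un_disjoint Int_Diff disjoint_iff subset_iff)
      then show "B \<in> {B. B \<subseteq> V \<and> card B = r \<and> S \<subseteq> B}" using C assms by auto
    qed
  qed auto
  then have "card {B. B \<subseteq> V \<and> card B = r \<and> S \<subseteq> B} = card {C. C \<subseteq> V - S \<and> card C = r - card S}"
    by (rule bij_betw_same_card)
  also have "\<dots> = card (V - S) choose (r - card S)" by (rule n_subsets) (use assms in simp)
  finally show ?thesis using assms finS by (simp add: card_Diff_subset)
qed

text \<open>Double counting of \<open>S \<subseteq> B \<subseteq> e\<close>: for an edge
  \<open>e\<close> above \<open>S\<close>, such a \<open>B\<close> arises by deleting one vertex of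
  \<open>e - S\<close>. A singleton \<open>S\<close> yields vertex degrees, an empty
  \<open>S\<close> the number of edges.\<close>

lemma sum_hdegree_supersets:
  assumes unif: "uniform_hypergraph k V E" and k: "1 \<le> k" and S: "S \<subseteq> V"
  shows "(\<Sum>B | B \<subseteq> V \<and> card B = k - 1 \<and> S \<subseteq> B. hdegree E B) = (k - card S) * hdegree E S"
proof -
  have finV: "finite V" and E: "\<And>e. e \<in> E \<Longrightarrow> e \<subseteq> V \<and> card e = k"
    using unif by (auto simp: uniform_hypergraph_def)
  have finE: "finite E" using E finV by (metis PowI finite_Pow_iff finite_subset subsetI)
  let ?X = "{B. B \<subseteq> V \<and> card B = k - 1 \<and> S \<subseteq> B}"
  have finX: "finite ?X" using finV by simp
  have ind: "hdegree E B = (\<Sum>e\<in>E. if B \<subseteq> e then 1 else 0)" for B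
    unfolding hdegree_def using finE by (simp flip: sum.inter_filter)
  have inner: "(\<Sum>B\<in>?X. if B \<subseteq> e then 1 else 0) = (if S \<subseteq> e then k - card S else 0)" if e: "e \<in> E" for e
  proof (cases "S \<subseteq> e")
    case True
    have fe: "finite e" using E[OF e] finV finite_subset by blast
    have "{B \<in> ?X. B \<subseteq> e} = (\<lambda>v. e - {v}) ` (e - S)"
    proof
      show "(\<lambda>v. e - {v}) ` (e - S) \<subseteq> {B \<in> ?X. B \<subseteq> e}"
        using E[OF e] True fe by auto
      show "{B \<in> ?X. B \<subseteq> e} \<subseteq> (\<lambda>v. e - {v}) ` (e - S)"
      proof
        fix B assume "B \<in> {B \<in> ?X. B \<subseteq> e}"
        then have B: "card B = k - 1" "S \<subseteq> B" "B \<subseteq> e" by auto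
        have "card (e - B) = 1"
          using B fe E[OF e] k finite_subset[OF B(3) fe] by (simp add: card_Diff_subset)
        then obtain v where v: "e - B = {v}" by (rule card_1_singletonE)
        then have "v \<in> e - S" "B = e - {v}" using B by auto
        then show "B \<in> (\<lambda>v. e - {v}) ` (e - S)" by blast
      qed
    qed
    moreover have "card ((\<lambda>v. e - {v}) ` (e - S)) = card (e - S)"
      by (rule card_image) (auto simp: inj_on_def)
    moreover have "card (e - S) = k - card S"
      using E[OF e] True fe by (simp add: card_Diff_subset finite_subset)
    moreover have "(\<Sum>B\<in>?X. if B \<subseteq> e then 1 else 0) = card {B \<in> ?X. B \<subseteq> e}"
      using sum.inter_filter[OF finX, of "\<lambda>_. 1::nat" "\<lambda>B. B \<subseteq> e"] by simp
    ultimately show ?thesis using True by simp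
  next
    case False
    then have "\<not> B \<subseteq> e" if "B \<in> ?X" for B using that by blast
    then show ?thesis using False by simp
  qed
  have "(\<Sum>B\<in>?X. hdegree E B) = (\<Sum>e\<in>E. \<Sum>B\<in>?X. if B \<subseteq> e then 1 else 0)"
    unfolding ind by (rule sum.swap)
  also have "\<dots> = (\<Sum>e\<in>E. (k - card S) * (if S \<subseteq> e then 1 else 0))"
    by (rule sum.cong) (use inner in auto)
  also have "\<dots> = (k - card S) * hdegree E S" unfolding ind by (simp add: sum_distrib_left)
  finally show ?thesis .
qed

text \<open>Positions are counted modulo \<open>n\<close>. The segment starting at \<open>i * q\<close> overlaps its neighbours in its
  first and last \<open>l\<close> positions; as \<open>l < q\<close>, its position \<open>slot i\<close> belongs to no other segment.\<close>

locale cyclic_template =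
  fixes k l m q n :: nat
  assumes l_less: "2 * l < k" and m_ge: "3 \<le> m" and q_def: "q = k - l" and n_def: "n = m * q"
begin

text \<open>Offset \<open>q - 1\<close> is the last one before the next segment starts, and the only
  offset below \<open>k = q + l\<close> with residue \<open>q - 1\<close> modulo \<open>q\<close>,
  as \<open>l < q\<close>. Slots are exactly the positions of that residue, which keeps them apart
  from all frames.\<close>

definition frame :: "nat \<Rightarrow> nat set" where
  "frame i = (\<lambda>j. (i * q + j) mod n) ` ({..<k} - {q - 1})"

definition slot :: "nat \<Rightarrow> nat" where
  "slot i = i * q + (q - 1)"

definition template_edge :: "'a list \<Rightarrow> nat \<Rightarrow> nat \<Rightarrow> 'a set" where
  "template_edge xs i j = insert (xs ! slot j) ((!) xs ` frame i)"

text \<open>The bound \<open>k + q \<le> n\<close> lets a segment and its successor fit into one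
  turn, so that \<open>inj_on_shift_mod\<close> applies to both together.\<close>

lemma q_pos: "0 < q" and k_eq: "k = q + l" and l_less_q: "l < q" and n_pos: "0 < n" and k_less_n: "k + q \<le> n"
proof -
  show q: "0 < q" and k: "k = q + l" and l: "l < q" using l_less q_def by auto
  show "0 < n" using q m_ge n_def by simp
  have "k + q \<le> 3 * q" using k l by simp
  also have "\<dots> \<le> n" unfolding n_def by (rule mult_le_mono1[OF m_ge])
  finally show "k + q \<le> n" .
qed

lemma inj_on_shift_mod: "inj_on (\<lambda>j. (a + j) mod n) {..<n}"
proof (rule inj_onI)
  have le: "x = y" if "x \<le> y" "y < n" "(a + x) mod n = (a + y) mod n" for x y
  proof -
    have "n dvd (a + y) - (a + x)" using that by (subst mod_eq_dvd_iff_nat[symmetric]) auto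
    then have "n dvd y - x" by simp
    then show ?thesis using that by (metis diff_is_0_eq diff_le_self dvd_imp_le le_antisym le_less_trans not_le zero_less_diff)
  qed
  fix x y assume "x \<in> {..<n}" "y \<in> {..<n}" "(a + x) mod n = (a + y) mod n"
  then show "x = y" using le[of x y] le[of y x] by (cases "x \<le> y") auto
qed

lemma frame_subset: "frame i \<subseteq> {..<n}"
  using n_pos by (auto simp: frame_def)

lemma slot_less: "i < m \<Longrightarrow> slot i < n"
proof -
  assume "i < m"
  then have "Suc i * q \<le> m * q" by (intro mult_le_mono1) simp
  then show ?thesis using q_pos by (simp add: slot_def n_def)
qed

lemma inj_slot: "inj slot"
  unfolding inj_def slot_def add_right_cancel using q_pos by simp

lemma card_frame: "card (frame i) = k - 1"
proof -
  have "card (frame i) = card ({..<k} - {q - 1})"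
    unfolding frame_def
    by (rule card_image, rule inj_on_subset[OF inj_on_shift_mod]) (use k_less_n in auto)
  then show ?thesis using k_eq q_pos by simp
qed

lemma mod_n_mod_q: "(x mod n) mod q = x mod q"
  by (rule mod_mod_cancel) (simp add: n_def)

lemma slot_mod: "slot i mod q = q - 1"
proof -
  have "(i * q + (q - 1)) mod q = (q - 1) mod q" by (rule mod_mult_self3)
  then show ?thesis using q_pos by (simp add: slot_def)
qed

lemma frame_mod: "p \<in> frame i \<Longrightarrow> p mod q \<noteq> q - 1"
proof -
  assume "p \<in> frame i"
  then obtain j where j: "j < k" "j \<noteq> q - 1" "p = (i * q + j) mod n" by (auto simp: frame_def)
  then have *: "p mod q = j mod q" by (simp add: mod_n_mod_q)
  show ?thesis
  proof (cases "j < q")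
    case True
    then show ?thesis using * j by simp
  next
    case False
    then have "j mod q = j - q" using j k_eq l_less_q by (simp add: mod_if)
    then show ?thesis using * j k_eq l_less_q False by simp
  qed
qed

lemma slot_notin_frame: "slot j \<notin> frame i"
  using frame_mod slot_mod by blast

text \<open>For each of the \<open>k\<close> offsets at most one \<open>i\<close> puts
  \<open>p\<close> there. Consequently a swap of two entries disturbs at most \<open>2 * k\<close>
  frames.\<close>

lemma card_frames_through: "card {i. i < m \<and> p \<in> frame i} \<le> k"
proof -
  have inj: "i = i'" if "i < m" "i' < m" "(i * q + j) mod n = (i' * q + j) mod n" for i i' j
  proof -
    have "i * q < n" "i' * q < n" using that q_pos by (auto simp: n_def)
    then have "i * q = i' * q"
      using inj_onD[OF inj_on_shift_mod[of j], of "i * q" "i' * q"] that(3) by (simp add: add.commute)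
    then show ?thesis using q_pos by simp
  qed
  have "{i. i < m \<and> p \<in> frame i} \<subseteq> (\<Union>j<k. {i. i < m \<and> (i * q + j) mod n = p})"
    by (auto simp: frame_def)
  then have "card {i. i < m \<and> p \<in> frame i} \<le> card (\<Union>j<k. {i. i < m \<and> (i * q + j) mod n = p})"
    by (rule card_mono[rotated]) auto
  also have "\<dots> \<le> (\<Sum>j<k. card {i. i < m \<and> (i * q + j) mod n = p})" by (rule card_UN_le) simp
  also have "\<dots> \<le> (\<Sum>j<k. 1)"
  proof (rule sum_mono)
    fix j
    let ?I = "{i. i < m \<and> (i * q + j) mod n = p}"
    have "\<forall>x\<in>?I. \<forall>y\<in>?I. x = y" using inj[of _ _ j] by simp
    moreover have "finite ?I" by simp
    ultimately have "card ?I \<le> Suc 0" using card_le_Suc0_iff_eq by blast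
    then show "card ?I \<le> 1" by simp
  qed
  finally show ?thesis by simp
qed

text \<open>The slot is the only position of residue \<open>q - 1\<close>, so it can be read off the
  edge. That equal frames have equal indices is left to \<open>inj_on_frame\<close>, for
  \<open>2 \<le> k\<close>.\<close>

lemma inj_template_edge:
  assumes xs: "distinct xs" "length xs = n"
    and eq: "template_edge xs i j = template_edge xs i' j'" and lt: "i < m" "j < m" "i' < m" "j' < m"
  shows "j = j' \<and> frame i = frame i'"
proof -
  have inj: "inj_on ((!) xs) {..<n}" using xs by (auto simp: inj_on_def nth_eq_iff_index_eq)
  have img: "template_edge xs i j = (!) xs ` insert (slot j) (frame i)" for i j by (simp add: template_edge_def)
  have "insert (slot j) (frame i) = insert (slot j') (frame i')"
    using eq unfolding img by (rule inj_on_image_eq_iff[OF inj, THEN iffD1, rotated 2])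
      (use frame_subset slot_less lt in auto)
  note ins = this
  then have s: "slot j = slot j'" using slot_notin_frame by blast
  moreover have "frame i = frame i'"
    using ins unfolding s by (rule insert_ident[THEN iffD1, rotated 2]) (rule slot_notin_frame)+
  ultimately show ?thesis using inj_slot by (simp add: inj_eq)
qed

end

context cyclic_template
begin

lemma slot_div: "slot i div q = i"
proof -
  have "(i * q + (q - 1)) div q = i + (q - 1) div q" using q_pos by (intro div_mult_self3) simp
  then show ?thesis using q_pos by (simp add: slot_def)
qed

lemma div_less_m: "p < n \<Longrightarrow> p div q < m"
  by (simp add: n_def less_mult_imp_div_less)

text \<open>The multiples of \<open>q\<close> in \<open>frame i\<close> are its start
  \<open>i * q\<close>, which survives because \<open>q > 1\<close>, and possibly the next start.
  Two indices with the same frame would each follow the other cyclically, forcing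
  \<open>2 * q\<close> to vanish modulo \<open>n\<close>, against \<open>m \<ge> 3\<close>.\<close>

lemma inj_on_frame:
  assumes "2 \<le> k"
  shows "inj_on frame {..<m}"
proof (rule inj_onI)
  have q2: "q - 1 \<noteq> 0" using assms k_eq l_less_q by auto
  have lt: "i * q < n" if "i < m" for i using that q_pos by (simp add: n_def)
  have start: "i * q \<in> frame i" if "i < m" for i
  proof -
    have "i * q = (i * q + 0) mod n" using lt[OF that] by simp
    then show ?thesis unfolding frame_def using assms q2 by (intro image_eqI[of _ _ 0]) auto
  qed
  have zero: "p = i * q \<or> p = (i * q + q) mod n" if p: "p \<in> frame i" "p mod q = 0" and i: "i < m" for p i
  proof -
    obtain j where j: "j < k" "p = (i * q + j) mod n" using p by (auto simp: frame_def)
    have "j mod q = 0" using p(2) j(2) by (simp add: mod_n_mod_q)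
    then obtain d where "j = q * d" by auto
    moreover have "j < q * 2" using j(1) k_eq l_less_q by simp
    ultimately have "j = 0 \<or> j = q" using q_pos by (cases d) (auto simp: less_Suc_eq)
    then show ?thesis using j(2) lt[OF i] by auto
  qed
  fix i i' assume i: "i \<in> {..<m}" "i' \<in> {..<m}" and eq: "frame i = frame i'"
  show "i = i'"
  proof (rule ccontr)
    assume "i \<noteq> i'"
    then have ne: "i * q \<noteq> i' * q" using q_pos by simp
    have 1: "i * q = (i' * q + q) mod n" using zero[of "i * q" i'] start[of i] i eq ne by auto
    have 2: "i' * q = (i * q + q) mod n" using zero[of "i' * q" i] start[of i'] i eq ne by auto
    have "(i * q + 0) mod n = i * q" using lt i by simp
    also have "\<dots> = ((i * q + q) mod n + q) mod n" using 1 2 by simp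
    also have "\<dots> = (i * q + 2 * q) mod n" by (simp add: mod_add_left_eq add.assoc mult_2)
    finally have 3: "(i * q + 0) mod n = (i * q + 2 * q) mod n" .
    have 4: "2 * q < n"
    proof -
      have "2 * q < 3 * q" using q_pos by simp
      also have "\<dots> \<le> n" unfolding n_def by (rule mult_le_mono1[OF m_ge])
      finally show ?thesis .
    qed
    have "0 = 2 * q" by (rule inj_onD[OF inj_on_shift_mod 3]) (use n_pos 4 in simp_all)
    then show False using q_pos by simp
  qed
qed

text \<open>Permuting only the slot entries according to \<pi> gives a cyclic order whose segment at
  \<open>i * q\<close> consists of frame \<open>i\<close> and slot \<open>\<pi> i\<close>. The
  position map \<rho> preserves residues modulo \<open>q\<close> and is the identity on
  frames.\<close>

lemma hamilton_cycle_template: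
  assumes unif: "uniform_hypergraph k V E"
    and xs: "distinct xs" "set xs = V" "length xs = n"
    and \<pi>: "bij_betw \<pi> {..<m} {..<m}"
    and E: "\<And>i. i < m \<Longrightarrow> template_edge xs i (\<pi> i) \<in> E"
  shows "hamilton_cycle k l V E ((\<lambda>i. template_edge xs i (\<pi> i)) ` {..<m})"
proof -
  let ?C = "(\<lambda>i. template_edge xs i (\<pi> i)) ` {..<m}"
  define \<rho> where "\<rho> p = (if p mod q = q - 1 then slot (\<pi> (p div q)) else p)" for p
  have \<pi>m: "\<pi> i < m" if "i < m" for i using \<pi> that by (auto simp: bij_betw_def)
  have \<rho>_less: "\<rho> p < n" if "p < n" for p
    using that slot_less[OF \<pi>m[OF div_less_m[OF that]]] by (simp add: \<rho>_def)
  have \<rho>_mod: "\<rho> p mod q = p mod q" for p by (simp add: \<rho>_def slot_mod)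
  have inj\<rho>: "inj_on \<rho> {..<n}"
  proof (rule inj_onI)
    fix p p' assume p: "p \<in> {..<n}" "p' \<in> {..<n}" and eq: "\<rho> p = \<rho> p'"
    have md: "p mod q = p' mod q" using \<rho>_mod eq by metis
    show "p = p'"
    proof (cases "p mod q = q - 1")
      case True
      then have "slot (\<pi> (p div q)) = slot (\<pi> (p' div q))" using eq md by (simp add: \<rho>_def)
      then have "\<pi> (p div q) = \<pi> (p' div q)" using inj_slot by (simp add: inj_eq)
      then have "p div q = p' div q"
        using \<pi> div_less_m p by (auto simp: bij_betw_def dest: inj_onD)
      then show ?thesis using md by (metis div_mult_mod_eq)
    next
      case False
      then show ?thesis using eq md by (simp add: \<rho>_def)
    qed
  qed
  have im\<rho>: "\<rho> ` {..<n} = {..<n}"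
    by (rule endo_inj_surj) (use \<rho>_less inj\<rho> in auto)
  define vs where "vs = map (\<lambda>p. xs ! \<rho> p) [0..<n]"
  have len: "length vs = n" and nth: "\<And>p. p < n \<Longrightarrow> vs ! p = xs ! \<rho> p" by (simp_all add: vs_def)
  have inj_xs: "inj_on ((!) xs) {..<n}" using xs by (auto simp: inj_on_def nth_eq_iff_index_eq)
  have injg: "inj_on (\<lambda>p. xs ! \<rho> p) {..<n}"
    using comp_inj_on[OF inj\<rho>, of "(!) xs"] inj_xs im\<rho> by (simp add: comp_def)
  have dvs: "distinct vs" using injg by (simp add: vs_def distinct_map lessThan_atLeast0)
  have set_vs: "set vs = V"
  proof -
    have "set vs = (!) xs ` (\<rho> ` {..<n})" by (auto simp: vs_def image_image)
    also have "\<dots> = set xs" unfolding im\<rho> using xs(3) by (auto simp: set_conv_nth)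
    finally show ?thesis using xs by simp
  qed
  define W where "W a = (\<lambda>j. (a + j) mod n) ` {..<k}" for a
  have seg: "cyclic_segment k vs a = (\<lambda>p. xs ! \<rho> p) ` W a" for a
  proof -
    have "cyclic_segment k vs a = (\<lambda>j. vs ! ((a + j) mod n)) ` {..<k}"
      by (auto simp: cyclic_segment_def len)
    also have "\<dots> = (\<lambda>j. xs ! \<rho> ((a + j) mod n)) ` {..<k}"
      by (rule image_cong) (use nth n_pos in auto)
    finally show ?thesis by (simp add: W_def image_image)
  qed
  have W_less: "W a \<subseteq> {..<n}" for a using n_pos by (auto simp: W_def)
  have seg_edge: "cyclic_segment k vs (i * q) = template_edge xs i (\<pi> i)" if i: "i < m" for i
  proof -
    have qk: "q - 1 < k" using k_eq q_pos by simp
    have "W (i * q) = insert ((i * q + (q - 1)) mod n) (frame i)"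
      unfolding W_def frame_def using qk by (subst insert_Diff[symmetric, of "q - 1"]) auto
    also have "(i * q + (q - 1)) mod n = slot i" using slot_less[OF i] by (simp add: slot_def)
    finally have W: "W (i * q) = insert (slot i) (frame i)" .
    have "(\<lambda>p. xs ! \<rho> p) ` frame i = (!) xs ` frame i"
      by (rule image_cong) (use frame_mod in \<open>auto simp: \<rho>_def\<close>)
    moreover have "\<rho> (slot i) = slot (\<pi> i)" by (simp add: \<rho>_def slot_mod slot_div)
    ultimately show ?thesis unfolding seg W template_edge_def by simp
  qed
  define ps where "ps = map (\<lambda>i. i * q) [0..<m]"
  have len_ps: "length ps = m" and nth_ps: "\<And>i. i < m \<Longrightarrow> ps ! i = i * q" by (simp_all add: ps_def)
  have inter: "card (cyclic_segment k vs (ps ! i) \<inter> cyclic_segment k vs (ps ! (Suc i mod length ps))) = l"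
    if i: "i < length ps" for i
  proof -
    have p1: "ps ! i = i * q" using i len_ps nth_ps by simp
    have "ps ! (Suc i mod length ps) = (Suc i mod m) * q" using nth_ps m_ge by (simp add: len_ps)
    also have "\<dots> = (i * q + q) mod n" by (simp add: n_def mult_mod_left add.commute)
    finally have p2: "ps ! (Suc i mod length ps) = (i * q + q) mod n" .
    \<comment> \<open>Both segments become shifts of offsets counted from \<open>i * q\<close>. All
      these offsets lie below \<open>n\<close>, so the intersection can be taken among offsets,
      where it is \<open>{q..<k}\<close>.\<close>
    have W2: "W ((i * q + q) mod n) = (\<lambda>j. (i * q + j) mod n) ` {q..<q + k}"
    proof -
      have "{q..<q + k} = (+) q ` {..<k}" by (simp add: lessThan_atLeast0 add.commute)
      then have "(\<lambda>j. (i * q + j) mod n) ` {q..<q + k} = (\<lambda>j. (i * q + (q + j)) mod n) ` {..<k}"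
        by (simp add: image_image)
      then show ?thesis by (simp add: W_def mod_add_left_eq add.assoc)
    qed
    have "card (cyclic_segment k vs (ps ! i) \<inter> cyclic_segment k vs (ps ! (Suc i mod length ps)))
        = card ((\<lambda>p. xs ! \<rho> p) ` (W (i * q) \<inter> W ((i * q + q) mod n)))"
      unfolding p1 p2 seg using inj_on_image_Int[OF injg W_less W_less] by simp
    also have "\<dots> = card (W (i * q) \<inter> W ((i * q + q) mod n))"
      by (rule card_image, rule inj_on_subset[OF injg]) (use W_less in auto)
    also have "W (i * q) \<inter> W ((i * q + q) mod n) = (\<lambda>j. (i * q + j) mod n) ` ({..<k} \<inter> {q..<q + k})"
      unfolding W2 unfolding W_def
      by (rule inj_on_image_Int[OF inj_on_shift_mod, symmetric]) (use k_less_n in auto)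
    also have "card \<dots> = card ({..<k} \<inter> {q..<q + k})"
      by (rule card_image, rule inj_on_subset[OF inj_on_shift_mod]) (use k_less_n in auto)
    also have "{..<k} \<inter> {q..<q + k} = {q..<k}" by auto
    finally show ?thesis using k_eq by simp
  qed
  have CE: "?C \<subseteq> E" using E by auto
  have C_seg: "?C = cyclic_segment k vs ` set ps"
  proof -
    have "cyclic_segment k vs ` set ps = (\<lambda>i. cyclic_segment k vs (i * q)) ` {..<m}"
      by (simp add: ps_def image_image lessThan_atLeast0)
    also have "\<dots> = ?C" by (rule image_cong) (use seg_edge in auto)
    finally show ?thesis by simp
  qed
  have sorted: "sorted_wrt (<) ps"
    using q_pos by (simp add: ps_def sorted_wrt_iff_nth_less)
  have ps_less: "\<forall>p\<in>set ps. p < length vs"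
    using q_pos by (auto simp: ps_def len n_def)
  have unifC: "uniform_hypergraph k V ?C"
    using unif CE by (auto simp: uniform_hypergraph_def)
  have "\<Union>?C = V"
  proof
    show "\<Union>?C \<subseteq> V" using unifC by (auto simp: uniform_hypergraph_def)
    show "V \<subseteq> \<Union>?C"
    proof
      fix v assume "v \<in> V"
      then obtain p where p: "p < n" "v = vs ! p" using set_vs len by (metis in_set_conv_nth)
      let ?i = "p div q"
      have i: "?i < m" using div_less_m p(1) by blast
      have "(?i * q + p mod q) mod n = p" using p(1) by simp
      moreover have "p mod q < k" using k_eq q_pos by (simp add: trans_less_add1)
      ultimately have "v \<in> cyclic_segment k vs (?i * q)"
        unfolding cyclic_segment_def len mem_Collect_eq p(2) by (intro exI[of _ "p mod q"]) simp
      then show "v \<in> \<Union>?C" using i seg_edge[OF i] by blast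
    qed
  qed
  then show ?thesis
    unfolding hamilton_cycle_def hypercycle_def
    by (intro conjI exI[of _ vs] exI[of _ ps] impI allI)
      (assumption | rule CE unifC dvs set_vs sorted ps_less C_seg inter)+
qed

end

subsection \<open>Random templates\<close>

lemma abs_card_filter_diff_le:
  assumes "finite I" "finite Z" "\<And>i. i \<in> I \<Longrightarrow> i \<notin> Z \<Longrightarrow> P i \<longleftrightarrow> Q i"
  shows "\<bar>real (card {i \<in> I. P i}) - real (card {i \<in> I. Q i})\<bar> \<le> card Z"
proof -
  have "{i \<in> I. P i} \<subseteq> {i \<in> I. Q i} \<union> Z" "{i \<in> I. Q i} \<subseteq> {i \<in> I. P i} \<union> Z" using assms(3) by auto
  then have "card {i \<in> I. P i} \<le> card ({i \<in> I. Q i} \<union> Z)" "card {i \<in> I. Q i} \<le> card ({i \<in> I. P i} \<union> Z)"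
    using assms(1,2) by (auto intro!: card_mono)
  moreover have "card ({i \<in> I. Q i} \<union> Z) \<le> card {i \<in> I. Q i} + card Z"
    "card ({i \<in> I. P i} \<union> Z) \<le> card {i \<in> I. P i} + card Z" by (rule card_Un_le)+
  ultimately show ?thesis by linarith
qed

lemma card_complements_in_edges:
  assumes unif: "uniform_hypergraph k V E" and U: "U \<subseteq> V" and s: "card U + s = k"
  shows "card {B. B \<subseteq> V \<and> card B = s \<and> U \<union> B \<in> E} = hdegree E U"
proof -
  have finV: "finite V" and E: "\<And>e. e \<in> E \<Longrightarrow> e \<subseteq> V \<and> card e = k"
    using unif by (auto simp: uniform_hypergraph_def)
  have fin: "finite X" if "X \<subseteq> V" for X using that finV finite_subset by blast
  have disj: "U \<inter> B = {}" if "B \<subseteq> V" "card B = s" "U \<union> B \<in> E" for B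
  proof -
    have "card U + card B = card (U \<union> B) + card (U \<inter> B)" using that U fin by (intro card_Un_Int)
    then have "card (U \<inter> B) = 0" using E[OF that(3)] that s by simp
    then show ?thesis using U fin by auto
  qed
  have "bij_betw ((\<union>) U) {B. B \<subseteq> V \<and> card B = s \<and> U \<union> B \<in> E} {e \<in> E. U \<subseteq> e}"
  proof (rule bij_betw_byWitness[where f' = "\<lambda>e. e - U"])
    show "\<forall>B\<in>{B. B \<subseteq> V \<and> card B = s \<and> U \<union> B \<in> E}. U \<union> B - U = B" using disj by blast
    show "\<forall>e\<in>{e \<in> E. U \<subseteq> e}. U \<union> (e - U) = e" by blast
    show "(\<union>) U ` {B. B \<subseteq> V \<and> card B = s \<and> U \<union> B \<in> E} \<subseteq> {e \<in> E. U \<subseteq> e}" by auto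
    show "(\<lambda>e. e - U) ` {e \<in> E. U \<subseteq> e} \<subseteq> {B. B \<subseteq> V \<and> card B = s \<and> U \<union> B \<in> E}"
    proof
      fix B assume "B \<in> (\<lambda>e. e - U) ` {e \<in> E. U \<subseteq> e}"
      then obtain e where e: "e \<in> E" "U \<subseteq> e" "B = e - U" by auto
      then have "card B = s" using E[OF e(1)] s fin[OF U] by (simp add: card_Diff_subset)
      moreover have "U \<union> B = e" using e by auto
      ultimately show "B \<in> {B. B \<subseteq> V \<and> card B = s \<and> U \<union> B \<in> E}" using e(1) E[OF e(1)] e(3) by auto
    qed
  qed
  then show ?thesis unfolding hdegree_def by (rule bij_betw_same_card)
qed

text \<open>Each \<open>D i\<close> receives a uniformly random \<open>s\<close>-subset, and
  \<open>hdegree E U\<close> of these complete \<open>U\<close> to an edge; a set meeting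
  \<open>U\<close> yields fewer than \<open>k\<close> vertices and never counts. Both sides of the
  bipartite graph are instances: \<open>D i = {slot i}\<close> with \<open>U\<close> a
  \<open>(k - 1)\<close>-set, and \<open>D i = frame i\<close> with \<open>U\<close> a single
  vertex.\<close>

lemma sum_permutations_position_edges:
  assumes unif: "uniform_hypergraph k V E" and U: "U \<subseteq> V" and s: "card U + s = k"
    and D: "\<And>i. i < m \<Longrightarrow> D i \<subseteq> {..<card V}" "\<And>i. i < m \<Longrightarrow> card (D i) = s" and sV: "s \<le> card V"
  shows "(\<Sum>xs\<in>permutations_of_set V. real (card {i \<in> {..<m}. U \<union> (!) xs ` D i \<in> E}))
         = fact (card V) * (m * hdegree E U / (card V choose s))"
proof -
  have finV: "finite V" using unif by (simp add: uniform_hypergraph_def)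
  let ?P = "permutations_of_set V"
  have finP: "finite ?P" by simp
  have pos: "real (card V choose s) > 0" using sV by simp
  have one: "real (card {xs \<in> ?P. U \<union> (!) xs ` D i \<in> E}) = hdegree E U * (fact (card V) / (card V choose s))"
    if i: "i < m" for i
  proof -
    let ?B = "{B. B \<subseteq> V \<and> card B = s \<and> U \<union> B \<in> E}"
    have im: "(!) xs ` D i \<subseteq> V \<and> card ((!) xs ` D i) = s" if "xs \<in> ?P" for xs
    proof -
      have l: "length xs = card V" "distinct xs" "set xs = V"
        using permutations_of_setD[OF that] length_finite_permutations_of_set[OF that] by auto
      have "inj_on ((!) xs) (D i)" using l D(1)[OF i] by (auto simp: inj_on_def nth_eq_iff_index_eq subset_iff)
      then show ?thesis using l D[OF i] by (auto simp: card_image)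
    qed
    have "{xs \<in> ?P. U \<union> (!) xs ` D i \<in> E} = (\<Union>B\<in>?B. {xs \<in> ?P. (!) xs ` D i = B})"
      using im by auto
    then have "card {xs \<in> ?P. U \<union> (!) xs ` D i \<in> E} = (\<Sum>B\<in>?B. card {xs \<in> ?P. (!) xs ` D i = B})"
      by (simp only:) (rule card_UN_disjoint, use finV in auto)
    also have "real \<dots> = (\<Sum>B\<in>?B. fact (card V) / (card V choose s))"
      unfolding of_nat_sum
    proof (rule sum.cong)
      fix B assume B: "B \<in> ?B"
      have "card {xs \<in> ?P. (!) xs ` D i = B} * (card V choose card (D i)) = fact (card V)"
        by (rule card_permutations_image_eq[OF finV D(1)[OF i]]) (use B D(2)[OF i] in auto)
      then have "real (card {xs \<in> ?P. (!) xs ` D i = B}) * real (card V choose s) = fact (card V)"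
        unfolding D(2)[OF i] by (metis of_nat_fact of_nat_mult)
      then show "real (card {xs \<in> ?P. (!) xs ` D i = B}) = fact (card V) / (card V choose s)"
        using pos by (simp add: field_simps)
    qed simp
    also have "\<dots> = hdegree E U * (fact (card V) / (card V choose s))"
      using card_complements_in_edges[OF unif U s] by simp
    finally show ?thesis .
  qed
  have "(\<Sum>xs\<in>?P. real (card {i \<in> {..<m}. U \<union> (!) xs ` D i \<in> E}))
      = (\<Sum>xs\<in>?P. \<Sum>i<m. if U \<union> (!) xs ` D i \<in> E then 1 else 0)"
    by (simp flip: sum.inter_filter)
  also have "\<dots> = (\<Sum>i<m. \<Sum>xs\<in>?P. if U \<union> (!) xs ` D i \<in> E then 1 else 0)" by (rule sum.swap)
  also have "\<dots> = (\<Sum>i<m. real (card {xs \<in> ?P. U \<union> (!) xs ` D i \<in> E}))"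
    using finP by (simp flip: sum.inter_filter)
  also have "\<dots> = (\<Sum>i<m. hdegree E U * (fact (card V) / (card V choose s)))"
    by (rule sum.cong) (use one in auto)
  finally show ?thesis by simp
qed

text \<open>A swap of two entries matters only for those \<open>i\<close> for which
  \<open>D i\<close> contains one of the two positions, at most \<open>2 * k\<close> by
  \<open>through\<close>; this is the Lipschitz constant.\<close>

lemma card_permutations_position_edges_deviation:
  fixes d :: real
  assumes unif: "uniform_hypergraph k V E" and U: "U \<subseteq> V" and s: "card U + s = k" and k: "0 < k"
    and D: "\<And>i. i < m \<Longrightarrow> D i \<subseteq> {..<card V}" "\<And>i. i < m \<Longrightarrow> card (D i) = s" and sV: "s \<le> card V" "V \<noteq> {}"
    and through: "\<And>p. card {i. i < m \<and> p \<in> D i} \<le> k" and d: "0 \<le> d"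
  shows "card {xs \<in> permutations_of_set V.
           d < \<bar>real (card {i \<in> {..<m}. U \<union> (!) xs ` D i \<in> E}) - m * hdegree E U / (card V choose s)\<bar>}
         \<le> 2 * fact (card V) * exp (- (d\<^sup>2 / (4 * (2 * real k)\<^sup>2 * card V)))"
proof (rule card_permutations_deviation)
  show "finite V" using unif by (simp add: uniform_hypergraph_def)
  show "V \<noteq> {}" by fact
  show "0 < 2 * real k" using k by simp
  show "0 \<le> d" by fact
  show "(\<Sum>xs\<in>permutations_of_set V. real (card {i \<in> {..<m}. U \<union> (!) xs ` D i \<in> E}))
         = fact (card V) * (m * hdegree E U / (card V choose s))"
    by (rule sum_permutations_position_edges[OF unif U s D sV(1)])
  fix xs a b assume "xs \<in> permutations_of_set V" "a < length xs" "b < length xs"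
  let ?ys = "xs[a := xs ! b, b := xs ! a]"
  let ?Z = "{i. i < m \<and> a \<in> D i} \<union> {i. i < m \<and> b \<in> D i}"
  have "\<bar>real (card {i \<in> {..<m}. U \<union> (!) ?ys ` D i \<in> E}) - real (card {i \<in> {..<m}. U \<union> (!) xs ` D i \<in> E})\<bar> \<le> card ?Z"
  proof (rule abs_card_filter_diff_le)
    fix i assume i: "i \<in> {..<m}" "i \<notin> ?Z"
    have "(!) ?ys ` D i = (!) xs ` D i"
    proof (rule image_cong)
      fix p assume "p \<in> D i"
      then have "p \<noteq> a" "p \<noteq> b" using i by auto
      then show "?ys ! p = xs ! p" by simp
    qed simp
    then show "U \<union> (!) ?ys ` D i \<in> E \<longleftrightarrow> U \<union> (!) xs ` D i \<in> E" by simp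
  qed auto
  also have "card ?Z \<le> k + k"
    by (rule order_trans[OF card_Un_le]) (intro add_mono through)
  finally show "\<bar>real (card {i \<in> {..<m}. U \<union> (!) ?ys ` D i \<in> E}) - real (card {i \<in> {..<m}. U \<union> (!) xs ` D i \<in> E})\<bar> \<le> 2 * real k"
    by simp
qed

context cyclic_template
begin

definition template_graph :: "'a set set \<Rightarrow> 'a list \<Rightarrow> (nat \<times> nat) set" where
  "template_graph E xs = {(i, j). i < m \<and> j < m \<and> template_edge xs i j \<in> E}"

definition balanced_templates :: "'a set \<Rightarrow> 'a set set \<Rightarrow> real \<Rightarrow> real \<Rightarrow> 'a list set" where
  "balanced_templates V E x y = {xs \<in> permutations_of_set V.
     (\<forall>i<m. x * real m \<le> card (template_graph E xs `` {i}) \<and> card (template_graph E xs `` {i}) \<le> y * real m) \<and>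
     (\<forall>j<m. x * real m \<le> card ((template_graph E xs)\<inverse> `` {j}) \<and> card ((template_graph E xs)\<inverse> `` {j}) \<le> y * real m)}"

text \<open>The entries of a frame depend on the listing, so the bad events are stated for every
  vertex and every \<open>(k - 1)\<close>-set fixed in advance. These are at most
  \<open>2 * n ^ (k - 1)\<close> events, each with two tails, whence the factor 4.\<close>

lemma card_balanced_templates:
  fixes a b \<gamma> :: real
  assumes unif: "uniform_hypergraph k V E" and k: "2 \<le> k" and card: "card V = n"
    and lo: "\<And>A. A \<subseteq> V \<Longrightarrow> card A = k - 1 \<Longrightarrow> a * n \<le> hdegree E A"
    and hi: "\<And>A. A \<subseteq> V \<Longrightarrow> card A = k - 1 \<Longrightarrow> hdegree E A \<le> b * n"
    and \<gamma>: "0 \<le> \<gamma>"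
  shows "fact n * (1 - 4 * real n ^ (k - 1) * exp (- (\<gamma>\<^sup>2 * n / (16 * real k ^ 4))))
         \<le> card (balanced_templates V E (a - \<gamma>) (b + \<gamma>))"
proof -
  have finV: "finite V" using unif by (simp add: uniform_hypergraph_def)
  have Vne: "V \<noteq> {}" using card n_pos by auto
  let ?P = "permutations_of_set V"
  let ?F = "\<lambda>U D xs. real (card {i \<in> {..<m}. U \<union> (!) xs ` D i \<in> E})"
  define \<mu> where "\<mu> U s = m * hdegree E U / (n choose s)" for U s
  define Bad where "Bad U D s = {xs \<in> ?P. \<gamma> * m < \<bar>?F U D xs - \<mu> U s\<bar>}" for U and D :: "nat \<Rightarrow> nat set" and s :: nat
  let ?\<xi> = "2 * fact n * exp (- (\<gamma>\<^sup>2 * n / (16 * real k ^ 4)))"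
  have bad: "card (Bad U D s) \<le> ?\<xi>"
    if "U \<subseteq> V" "card U + s = k" "\<And>i. i < m \<Longrightarrow> D i \<subseteq> {..<n}" "\<And>i. i < m \<Longrightarrow> card (D i) = s"
      "\<And>p. card {i. i < m \<and> p \<in> D i} \<le> k" for U D s
  proof -
    have "card (Bad U D s) \<le> 2 * fact n * exp (- ((\<gamma> * m)\<^sup>2 / (4 * (2 * real k)\<^sup>2 * n)))"
      unfolding Bad_def \<mu>_def card[symmetric]
      by (rule card_permutations_position_edges_deviation[OF unif that(1,2)])
        (use that card k_less_n k Vne \<gamma> in auto)
    also have "\<dots> \<le> ?\<xi>"
    proof -
      \<comment> \<open>Trading \<open>m\<close> for \<open>n / k\<close> turns
        \<open>(\<gamma> * m)^2 / (16 * k^2 * n)\<close> into the stated exponent.\<close>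
      have "n \<le> m * k" unfolding n_def using k_eq by simp
      then have "real n * n \<le> (real m * k) * (real m * k)"
        by (intro mult_mono) (simp_all flip: of_nat_mult)
      then have "\<gamma>\<^sup>2 * (real n * n) \<le> \<gamma>\<^sup>2 * ((real m * k) * (real m * k))" by (intro mult_left_mono) auto
      then have "\<gamma>\<^sup>2 * n / (16 * real k ^ 4) \<le> (\<gamma> * m)\<^sup>2 / (4 * (2 * real k)\<^sup>2 * n)"
        using n_pos k by (simp add: field_simps power2_eq_square power4_eq_xxxx)
      then show ?thesis by simp
    qed
    finally show ?thesis .
  qed
  have frame_bad: "card (Bad {v} frame (k - 1)) \<le> ?\<xi>" if "v \<in> V" for v
    by (rule bad) (use that k frame_subset card_frame card_frames_through in auto)
  have slot_bad: "card (Bad A (\<lambda>j. {slot j}) 1) \<le> ?\<xi>" if "A \<subseteq> V" "card A = k - 1" for A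
  proof (rule bad)
    fix p
    have "{i. i < m \<and> p \<in> {slot i}} \<subseteq> (if p mod q = q - 1 then {p div q} else {})"
      using slot_mod slot_div by auto
    then have "card {i. i < m \<and> p \<in> {slot i}} \<le> card (if p mod q = q - 1 then {p div q} else {})"
      by (rule card_mono[rotated]) auto
    also have "\<dots> \<le> k" using k by simp
    finally show "card {i. i < m \<and> p \<in> {slot i}} \<le> k" .
  qed (use that k slot_less in auto)
  let ?A = "{A. A \<subseteq> V \<and> card A = k - 1}"
  define Z where "Z = (\<Union>v\<in>V. Bad {v} frame (k - 1)) \<union> (\<Union>A\<in>?A. Bad A (\<lambda>j. {slot j}) 1)"
  have cA: "card ?A \<le> n ^ (k - 1)"
    using n_subsets[OF finV] card binomial_le_pow[of "k - 1" n] k_less_n by simp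
  have cardZ: "real (card Z) \<le> 2 * real n ^ (k - 1) * ?\<xi>"
  proof -
    have "card Z \<le> card (\<Union>v\<in>V. Bad {v} frame (k - 1)) + card (\<Union>A\<in>?A. Bad A (\<lambda>j. {slot j}) 1)"
      unfolding Z_def by (rule card_Un_le)
    also have "\<dots> \<le> (\<Sum>v\<in>V. card (Bad {v} frame (k - 1))) + (\<Sum>A\<in>?A. card (Bad A (\<lambda>j. {slot j}) 1))"
      by (intro add_mono card_UN_le) (use finV in auto)
    finally have "real (card Z) \<le> (\<Sum>v\<in>V. real (card (Bad {v} frame (k - 1)))) + (\<Sum>A\<in>?A. real (card (Bad A (\<lambda>j. {slot j}) 1)))"
      by (simp flip: of_nat_sum)
    also have "\<dots> \<le> (\<Sum>v\<in>V. ?\<xi>) + (\<Sum>A\<in>?A. ?\<xi>)"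
      by (intro add_mono sum_mono) (use frame_bad slot_bad in auto)
    also have "\<dots> = (real n + real (card ?A)) * ?\<xi>" by (simp add: card algebra_simps)
    also have "\<dots> \<le> (real n ^ (k - 1) + real n ^ (k - 1)) * ?\<xi>"
    proof (intro mult_right_mono add_mono)
      have "n ^ 1 \<le> n ^ (k - 1)" using n_pos k by (intro power_increasing) auto
      then show "real n \<le> real n ^ (k - 1)" by (simp flip: of_nat_power)
      show "real (card ?A) \<le> real n ^ (k - 1)" using cA by (simp flip: of_nat_power)
    qed simp
    finally show ?thesis by simp
  qed
  have combine: "(a - \<gamma>) * m \<le> z \<and> z \<le> (b + \<gamma>) * m"
    if "\<bar>z - z'\<bar> \<le> \<gamma> * m" "a * m \<le> z'" "z' \<le> b * m" for z z' :: real
    using that unfolding left_diff_distrib distrib_right by linarith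
  have "?P - Z \<subseteq> balanced_templates V E (a - \<gamma>) (b + \<gamma>)"
  proof
    fix xs assume xs: "xs \<in> ?P - Z"
    then have xsP: "xs \<in> ?P" by simp
    have l: "length xs = n" "distinct xs" "set xs = V"
      using permutations_of_setD[OF xsP] length_finite_permutations_of_set[OF xsP] card by auto
    have inj: "inj_on ((!) xs) {..<n}" using l by (auto simp: inj_on_def nth_eq_iff_index_eq)
    have "(a - \<gamma>) * m \<le> card (template_graph E xs `` {i}) \<and> card (template_graph E xs `` {i}) \<le> (b + \<gamma>) * m" if i: "i < m" for i
    proof -
      let ?A0 = "(!) xs ` frame i"
      have A: "?A0 \<subseteq> V" using l frame_subset[of i] by (auto simp: subset_iff)
      have cA0: "card ?A0 = k - 1"
        using card_image[OF inj_on_subset[OF inj frame_subset]] card_frame by simp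
      have "template_graph E xs `` {i} = {j \<in> {..<m}. ?A0 \<union> (!) xs ` {slot j} \<in> E}"
        using i by (auto simp: template_graph_def template_edge_def)
      moreover have "\<bar>?F ?A0 (\<lambda>j. {slot j}) xs - \<mu> ?A0 1\<bar> \<le> \<gamma> * m"
        using xs A cA0 unfolding Z_def Bad_def by fastforce
      moreover have "a * m \<le> \<mu> ?A0 1" "\<mu> ?A0 1 \<le> b * m"
        using lo[OF A cA0] hi[OF A cA0] n_pos m_ge by (auto simp: \<mu>_def field_simps)
      ultimately show ?thesis using combine by metis
    qed
    moreover have "(a - \<gamma>) * m \<le> card ((template_graph E xs)\<inverse> `` {j}) \<and> card ((template_graph E xs)\<inverse> `` {j}) \<le> (b + \<gamma>) * m" if j: "j < m" for j
    proof -
      let ?v = "xs ! slot j"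
      have v: "?v \<in> V" using l slot_less[OF j] by auto
      have "(template_graph E xs)\<inverse> `` {j} = {i \<in> {..<m}. {?v} \<union> (!) xs ` frame i \<in> E}"
        using j by (auto simp: template_graph_def template_edge_def)
      moreover have "\<bar>?F {?v} frame xs - \<mu> {?v} (k - 1)\<bar> \<le> \<gamma> * m"
        using xs v unfolding Z_def Bad_def by fastforce
      \<comment> \<open>Codegree bounds pass to the vertex degree by averaging over the
        \<open>(k - 1)\<close>-sets through the vertex, with
        \<open>(k - 1) * (n choose (k - 1)) = n * ((n - 1) choose (k - 2))\<close>.\<close>
      moreover have "a * m \<le> \<mu> {?v} (k - 1) \<and> \<mu> {?v} (k - 1) \<le> b * m"
      proof -
        let ?X = "{B. B \<subseteq> V \<and> card B = k - 1 \<and> {?v} \<subseteq> B}"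
        have cX: "card ?X = (n - 1) choose (k - 2)"
          using card_supersets_of_card[OF finV, of "{?v}" "k - 1"] v k card by (simp add: numeral_2_eq_2)
        have sum: "(\<Sum>B\<in>?X. real (hdegree E B)) = (k - 1) * real (hdegree E {?v})"
          using sum_hdegree_supersets[OF unif, of "{?v}"] v k by (simp flip: of_nat_sum)
        have "(\<Sum>B\<in>?X. a * n) \<le> (\<Sum>B\<in>?X. real (hdegree E B))"
          by (rule sum_mono) (use lo in auto)
        then have low: "a * (n * ((n - 1) choose (k - 2))) \<le> (k - 1) * real (hdegree E {?v})"
          unfolding sum using cX by (simp add: mult_ac)
        have "(\<Sum>B\<in>?X. real (hdegree E B)) \<le> (\<Sum>B\<in>?X. b * n)"
          by (rule sum_mono) (use hi in auto)
        then have high: "(k - 1) * real (hdegree E {?v}) \<le> b * (n * ((n - 1) choose (k - 2)))"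
          unfolding sum using cX by (simp add: mult_ac)
        have "(k - 1) * (n choose (k - 1)) = n * ((n - 1) choose (k - 2))"
        proof -
          have "Suc (n - 1) * ((n - 1) choose (k - 2)) = (Suc (n - 1) choose Suc (k - 2)) * Suc (k - 2)"
            by (rule Suc_times_binomial_eq)
          moreover have "Suc (n - 1) = n" "Suc (k - 2) = k - 1" using n_pos k by auto
          ultimately show ?thesis by (simp add: mult.commute)
        qed
        then have bin: "real n * ((n - 1) choose (k - 2)) = real (k - 1) * (n choose (k - 1))"
          by (metis of_nat_mult)
        have pos: "0 < real (k - 1)" "0 < real (n choose (k - 1))" using k k_less_n by auto
        have "a * (n choose (k - 1)) \<le> hdegree E {?v}"
        proof -
          have "real (k - 1) * (a * (n choose (k - 1))) \<le> real (k - 1) * hdegree E {?v}"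
            using low unfolding of_nat_mult bin by (simp only: mult_ac)
          then show ?thesis by (rule mult_left_le_imp_le) (rule pos(1))
        qed
        moreover have "hdegree E {?v} \<le> b * (n choose (k - 1))"
        proof -
          have "real (k - 1) * hdegree E {?v} \<le> real (k - 1) * (b * (n choose (k - 1)))"
            using high unfolding of_nat_mult bin by (simp only: mult_ac)
          then show ?thesis by (rule mult_left_le_imp_le) (rule pos(1))
        qed
        ultimately show ?thesis using pos(2) m_ge by (simp add: \<mu>_def field_simps)
      qed
      ultimately show ?thesis using combine by metis
    qed
    ultimately show "xs \<in> balanced_templates V E (a - \<gamma>) (b + \<gamma>)"
      using xsP by (simp add: balanced_templates_def)
  qed
  then have "card (?P - Z) \<le> card (balanced_templates V E (a - \<gamma>) (b + \<gamma>))"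
    by (rule card_mono[rotated]) (simp add: balanced_templates_def)
  moreover have "card ?P - card Z \<le> card (?P - Z)"
    by (rule diff_card_le_card_Diff) (use finV in \<open>auto simp: Z_def Bad_def\<close>)
  moreover have "card ?P = fact n" using finV card by simp
  ultimately have "fact n - real (card Z) \<le> card (balanced_templates V E (a - \<gamma>) (b + \<gamma>))"
    by (smt (verit) le_diff_conv of_nat_add of_nat_fact of_nat_mono)
  then show ?thesis using cardZ by (simp add: algebra_simps)
qed

end

section \<open>Occurrences of an edge, and the cycles of a single template\<close>

context cyclic_template
begin

lemma inj_on_template_edge:
  assumes k: "2 \<le> k" and xs: "distinct xs" "length xs = n"
  shows "inj_on (\<lambda>(i, j). template_edge xs i j) ({..<m} \<times> {..<m})"
proof (rule inj_onI)
  fix p p' assume p: "p \<in> {..<m} \<times> {..<m}" "p' \<in> {..<m} \<times> {..<m}"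
    and eq0: "(\<lambda>(i, j). template_edge xs i j) p = (\<lambda>(i, j). template_edge xs i j) p'"
  obtain i j i' j' where pp: "p = (i, j)" "p' = (i', j')" by (cases p, cases p') auto
  have lt: "i < m" "j < m" "i' < m" "j' < m" and eq: "template_edge xs i j = template_edge xs i' j'"
    using p eq0 by (auto simp: pp)
  have "j = j' \<and> frame i = frame i'" by (rule inj_template_edge[OF xs eq]) (use lt in auto)
  then show "p = p'" using inj_on_frame[OF k] lt by (auto simp: pp dest: inj_onD)
qed

text \<open>Each of the \<open>m^2\<close> index pairs places a uniformly random
  \<open>k\<close>-set, which is \<open>e\<close> with probability
  \<open>1 / (n choose k)\<close>.\<close>

lemma card_templates_through_edge:
  assumes unif: "uniform_hypergraph k V E" and card: "card V = n" and e: "e \<in> E" and k: "2 \<le> k"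
  shows "real (card {xs \<in> permutations_of_set V. \<exists>i<m. \<exists>j<m. template_edge xs i j = e}) \<le> real m ^ 2 * (fact n / (n choose k))"
proof -
  have finV: "finite V" and eV: "e \<subseteq> V" "card e = k" using unif e by (auto simp: uniform_hypergraph_def)
  let ?P = "permutations_of_set V"
  have pos: "real (n choose k) > 0" using k_less_n by simp
  have one: "real (card {xs \<in> ?P. template_edge xs i j = e}) = fact n / (n choose k)" if ij: "i < m" "j < m" for i j
  proof -
    let ?Q = "insert (slot j) (frame i)"
    have Q: "?Q \<subseteq> {..<card V}" using frame_subset slot_less ij card by auto
    have fin: "finite (frame i)" using frame_subset finite_subset by blast
    have cQ: "card ?Q = k" using card_frame slot_notin_frame fin k by simp
    have "card {xs \<in> ?P. (!) xs ` ?Q = e} * (card V choose card ?Q) = fact (card V)"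
      by (rule card_permutations_image_eq[OF finV Q]) (use eV cQ in auto)
    then have "card {xs \<in> ?P. template_edge xs i j = e} * (n choose k) = fact n"
      unfolding cQ card by (simp add: template_edge_def)
    then have "real (card {xs \<in> ?P. template_edge xs i j = e}) * real (n choose k) = fact n"
      by (metis of_nat_fact of_nat_mult)
    then show ?thesis using pos by (simp add: field_simps)
  qed
  have "{xs \<in> ?P. \<exists>i<m. \<exists>j<m. template_edge xs i j = e}
      = (\<Union>(i, j)\<in>{..<m} \<times> {..<m}. {xs \<in> ?P. template_edge xs i j = e})" by auto
  then have "card {xs \<in> ?P. \<exists>i<m. \<exists>j<m. template_edge xs i j = e}
      \<le> (\<Sum>p\<in>{..<m} \<times> {..<m}. card (case p of (i, j) \<Rightarrow> {xs \<in> ?P. template_edge xs i j = e}))"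
    by (simp only:) (rule card_UN_le, simp)
  then have "real (card {xs \<in> ?P. \<exists>i<m. \<exists>j<m. template_edge xs i j = e})
      \<le> (\<Sum>p\<in>{..<m} \<times> {..<m}. real (card (case p of (i, j) \<Rightarrow> {xs \<in> ?P. template_edge xs i j = e})))"
    by (simp flip: of_nat_sum)
  also have "\<dots> = (\<Sum>p\<in>{..<m} \<times> {..<m}. fact n / (n choose k))"
    by (rule sum.cong) (use one in auto)
  finally show ?thesis by (simp add: power2_eq_square)
qed

text \<open>\<open>dense_bipartite_edge_count\<close> wants the smaller set on the left; otherwise
  it is applied to the transposed graph, whose degrees obey the same bounds. The constant
  \<open>3 * \<gamma> / 2\<close> is half the gap between \<open>a - \<gamma>\<close> and
  \<open>a + 2 * \<gamma>\<close>, the latter adding codegree excess and concentration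
  error.\<close>

lemma balanced_template_edge_count:
  fixes a \<gamma> \<rho> \<kappa> \<eta> :: real
  assumes k: "2 \<le> k" and xs: "xs \<in> balanced_templates V E (a - \<gamma>) (a + 2 * \<gamma>)"
    and S: "S \<subseteq> {..<m}" and T: "T \<subseteq> {..<m}" and ST: "m < card S + card T"
    and \<gamma>: "0 < \<gamma>" and \<eta>: "0 \<le> \<eta>" "3 * \<gamma> / 2 \<le> \<eta> * \<kappa>" and \<rho>: "\<rho> \<le> a - \<gamma> - \<eta>" and \<kappa>: "0 \<le> \<kappa>" "\<kappa> \<le> \<rho> - 1/2"
  shows "\<rho> * m * (card S + card T - real m) \<le> card (template_graph E xs \<inter> S \<times> T)"
    and "\<kappa> * m * min (card S) (card T) \<le> card (template_graph E xs \<inter> S \<times> T)"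
proof -
  let ?G = "template_graph E xs"
  have deg: "(a - \<gamma>) * real m \<le> card (?G `` {i})" "card (?G `` {i}) \<le> (a + 2 * \<gamma>) * real m"
    "(a - \<gamma>) * real m \<le> card (?G\<inverse> `` {i})" "card (?G\<inverse> `` {i}) \<le> (a + 2 * \<gamma>) * real m" if "i < m" for i
    using xs that by (auto simp: balanced_templates_def)
  have G: "?G \<subseteq> {..<m} \<times> {..<m}" "?G\<inverse> \<subseteq> {..<m} \<times> {..<m}" by (auto simp: template_graph_def)
  have "\<rho> * m * (card S + card T - real m) \<le> card (?G \<inter> S \<times> T) \<and> \<kappa> * m * min (card S) (card T) \<le> card (?G \<inter> S \<times> T)"
  proof (cases "card S \<le> card T")
    case True
    have "\<rho> * m * (card S + card T - real m) \<le> card (?G \<inter> S \<times> T)" "\<kappa> * m * card S \<le> card (?G \<inter> S \<times> T)"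
      by (rule dense_bipartite_edge_count[of "{..<m}" "{..<m}" m ?G "a - \<gamma>" "a + 2 * \<gamma>" S T \<eta> \<kappa> \<rho>];
          use G S T ST \<gamma> \<eta> \<rho> \<kappa> deg True in auto)+
    then show ?thesis using True by (simp add: min_def)
  next
    case False
    have "card (?G\<inverse> \<inter> T \<times> S) = card (?G \<inter> S \<times> T)"
      by (rule bij_betw_same_card[of prod.swap]) (force simp: bij_betw_def inj_on_def)
    moreover have "\<rho> * m * (card T + card S - real m) \<le> card (?G\<inverse> \<inter> T \<times> S)" "\<kappa> * m * card T \<le> card (?G\<inverse> \<inter> T \<times> S)"
      by (rule dense_bipartite_edge_count[of "{..<m}" "{..<m}" m "?G\<inverse>" "a - \<gamma>" "a + 2 * \<gamma>" T S \<eta> \<kappa> \<rho>];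
          use G S T ST \<gamma> \<eta> \<rho> \<kappa> deg False in auto)+
    ultimately show ?thesis using False by (simp add: min_def add.commute)
  qed
  then show "\<rho> * m * (card S + card T - real m) \<le> card (?G \<inter> S \<times> T)"
    "\<kappa> * m * min (card S) (card T) \<le> card (?G \<inter> S \<times> T)" by auto
qed

text \<open>\<open>dense\<close> is the factor criterion with \<open>T\<close> exchanged for its
  complement; where the criterion has \<open>card S \<le> card T\<close> it is trivial, hence only
  pairs with \<open>m < card S + card T\<close>. The matchings share no index pair, and injectivity
  of \<open>template_edge\<close> on pairs makes the cycles edge-disjoint.\<close>

lemma exists_hamilton_cycles_in_template:
  assumes k: "2 \<le> k" and unif: "uniform_hypergraph k V E" and card: "card V = n"
    and xs: "xs \<in> permutations_of_set V"
    and dense: "\<And>S T. S \<subseteq> {..<m} \<Longrightarrow> T \<subseteq> {..<m} \<Longrightarrow> m < card S + card T \<Longrightarrow>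
       r * (card S + card T - m) \<le> card ((\<lambda>(i, j). template_edge xs i j) ` (template_graph E xs \<inter> S \<times> T) \<inter> H)"
  shows "\<exists>C :: nat \<Rightarrow> 'a set set. \<forall>a<r. hamilton_cycle k l V E (C a) \<and> C a \<subseteq> H \<and> card (C a) = m \<and>
           (\<forall>b<r. a \<noteq> b \<longrightarrow> C a \<inter> C b = {})"
proof -
  let ?te = "\<lambda>(i, j). template_edge xs i j"
  define G where "G = {p \<in> template_graph E xs. ?te p \<in> H}"
  have l: "length xs = n" "distinct xs" "set xs = V"
    using permutations_of_setD[OF xs] length_finite_permutations_of_set[OF xs] card by auto
  have Gsub: "G \<subseteq> {..<m} \<times> {..<m}" by (auto simp: G_def template_graph_def)
  have inj: "inj_on ?te ({..<m} \<times> {..<m})" by (rule inj_on_template_edge[OF k l(2,1)])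
  have cnt: "card (?te ` (template_graph E xs \<inter> S \<times> T) \<inter> H) = card (G \<inter> S \<times> T)" for S T
  proof -
    have "?te ` (template_graph E xs \<inter> S \<times> T) \<inter> H = ?te ` (G \<inter> S \<times> T)" by (auto simp: G_def)
    moreover have "inj_on ?te (G \<inter> S \<times> T)" by (rule inj_on_subset[OF inj]) (use Gsub in auto)
    ultimately show ?thesis by (simp add: card_image)
  qed
  have "\<exists>F\<subseteq>G. (\<forall>a\<in>{..<m}. card (F `` {a}) = r) \<and> (\<forall>b\<in>{..<m}. card (F\<inverse> `` {b}) = r)"
  proof (rule bipartite_factor)
    fix S T assume S: "S \<subseteq> {..<m}" and T: "T \<subseteq> {..<m}"
    have cT: "card ({..<m} - T) = m - card T" "card T \<le> m"
      using T card_mono[OF _ T] finite_subset[OF T] by (auto simp: card_Diff_subset)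
    show "r * card S \<le> card (G \<inter> S \<times> ({..<m} - T)) + r * card T"
    proof (cases "card S \<le> card T")
      case True
      then show ?thesis by (simp add: trans_le_add2)
    next
      case False
      have "r * (card S + card ({..<m} - T) - m) \<le> card (G \<inter> S \<times> ({..<m} - T))"
        using dense[OF S, of "{..<m} - T"] cnt False cT by auto
      moreover have "card S + card ({..<m} - T) - m = card S - card T" using cT False by simp
      moreover have "r * card S = r * (card S - card T) + r * card T" using False by (simp flip: distrib_left)
      ultimately show ?thesis by simp
    qed
  qed (use Gsub in auto)
  then obtain F where F: "F \<subseteq> G" "\<And>a. a < m \<Longrightarrow> card (F `` {a}) = r" "\<And>b. b < m \<Longrightarrow> card (F\<inverse> `` {b}) = r" by auto
  have "\<exists>M :: nat \<Rightarrow> nat \<Rightarrow> nat. (\<forall>i<r. bij_betw (M i) {..<m} {..<m} \<and> (\<forall>a\<in>{..<m}. (a, M i a) \<in> F)) \<and>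
           (\<forall>a\<in>{..<m}. inj_on (\<lambda>i. M i a) {..<r})"
    by (rule regular_bipartite_perfect_matchings) (use F Gsub in auto)
  then obtain M :: "nat \<Rightarrow> nat \<Rightarrow> nat" where
    M0: "(\<forall>i<r. bij_betw (M i) {..<m} {..<m} \<and> (\<forall>a\<in>{..<m}. (a, M i a) \<in> F)) \<and> (\<forall>a\<in>{..<m}. inj_on (\<lambda>i. M i a) {..<r})" ..
  then have M: "\<And>i. i < r \<Longrightarrow> bij_betw (M i) {..<m} {..<m}" "\<And>i a. i < r \<Longrightarrow> a < m \<Longrightarrow> (a, M i a) \<in> G"
    "\<And>a. a < m \<Longrightarrow> inj_on (\<lambda>i. M i a) {..<r}" using F(1) by auto
  have Mm: "M i a < m" if "i < r" "a < m" for i a using M(2)[OF that] Gsub by auto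
  define C where "C a = (\<lambda>i. template_edge xs i (M a i)) ` {..<m}" for a
  have edge_eq: "i = i' \<and> M a i = M b i'"
    if "template_edge xs i (M a i) = template_edge xs i' (M b i')" "i < m" "i' < m" "a < r" "b < r" for i i' a b
    using inj_onD[OF inj, of "(i, M a i)" "(i', M b i')"] that Mm by auto
  have "hamilton_cycle k l V E (C a) \<and> C a \<subseteq> H \<and> card (C a) = m \<and> (\<forall>b<r. a \<noteq> b \<longrightarrow> C a \<inter> C b = {})" if a: "a < r" for a
  proof (intro conjI allI impI)
    have inE: "template_edge xs i (M a i) \<in> E \<inter> H" if "i < m" for i
      using M(2)[OF a that] by (auto simp: G_def template_graph_def)
    show "hamilton_cycle k l V E (C a)" unfolding C_def
      by (rule hamilton_cycle_template[OF unif l(2,3,1) M(1)[OF a]]) (use inE in auto)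
    show "C a \<subseteq> H" using inE by (auto simp: C_def)
    have "inj_on (\<lambda>i. template_edge xs i (M a i)) {..<m}"
      by (rule inj_onI) (use edge_eq a in auto)
    then show "card (C a) = m" by (simp add: C_def card_image)
    fix b assume b: "b < r" "a \<noteq> b"
    show "C a \<inter> C b = {}"
    proof (rule ccontr)
      assume "C a \<inter> C b \<noteq> {}"
      then obtain i i' where ii: "i < m" "i' < m" "template_edge xs i (M a i) = template_edge xs i' (M b i')"
        by (auto simp: C_def)
      then have "M a i = M b i" using edge_eq[OF ii(3,1,2) a b(1)] by metis
      then have "a = b" using inj_onD[OF M(3)[OF ii(1)], of a b] a b by simp
      then show False using b by simp
    qed
  qed
  then show ?thesis by blast
qed

end

subsection \<open>Packing\<close>

context cyclic_template
begin

text \<open>\<open>balanced\<close> makes almost all listings admissible, at the price of a factor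
  \<open>1 + \<gamma>\<close> in probabilities. \<open>N_le\<close> keeps the expected number of
  occurrences of an edge below \<open>d\<close> with a margin, and \<open>multiplicity\<close> is
  the union bound over edges that this margin permits. \<open>split\<close> is the union bound over
  all listings and pairs of sets, and \<open>r\<close> the degree that the split then
  guarantees.\<close>

lemma exists_hamilton_cycle_packing:
  fixes a \<gamma> \<rho> \<kappa> \<eta> :: real and d N r :: nat
  assumes k: "2 \<le> k" and unif: "uniform_hypergraph k V E" and card: "card V = n"
    and lo: "\<And>A. A \<subseteq> V \<Longrightarrow> card A = k - 1 \<Longrightarrow> a * n \<le> hdegree E A"
    and hi: "\<And>A. A \<subseteq> V \<Longrightarrow> card A = k - 1 \<Longrightarrow> hdegree E A \<le> (a + \<gamma>) * n"
    and \<gamma>: "0 < \<gamma>" "\<gamma> < 1" and \<eta>: "0 \<le> \<eta>" "3 * \<gamma> / 2 \<le> \<eta> * \<kappa>"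
    and \<rho>: "\<rho> \<le> a - \<gamma> - \<eta>" and \<kappa>: "0 \<le> \<kappa>" "\<kappa> \<le> \<rho> - 1/2"
    and d: "0 < d" and N: "0 < N"
    and balanced: "(1 + \<gamma>) * (4 * real n ^ (k - 1) * exp (- (\<gamma>\<^sup>2 * n / (16 * real k ^ 4)))) \<le> \<gamma>"
    and N_le: "N * ((1 + \<gamma>) * (real m ^ 2 / (n choose k))) \<le> (1 - \<gamma>) * d"
    and multiplicity: "real n ^ k * exp (- (\<gamma>\<^sup>2 / 4 * d)) < 1"
    and split: "N * (12 * m * exp (- (\<gamma>\<^sup>2 * \<kappa> * m / (4 * d) / 2))) < 1"
    and r: "r \<le> (1 - \<gamma>) * \<rho> * m / d"
  shows "\<exists>\<C>. (\<forall>C\<in>\<C>. hamilton_cycle k l V E C) \<and> pairwise disjnt \<C> \<and> card (\<Union>\<C>) = N * r * m"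
proof -
  have finV: "finite V" and Ek: "\<And>e. e \<in> E \<Longrightarrow> e \<subseteq> V \<and> card e = k"
    using unif by (auto simp: uniform_hypergraph_def)
  have finE: "finite E" using Ek finV by (metis PowI finite_Pow_iff finite_subset subsetI)
  define \<Omega> where "\<Omega> = balanced_templates V E (a - \<gamma>) (a + 2 * \<gamma>)"
  have \<Omega>P: "\<Omega> \<subseteq> permutations_of_set V" by (auto simp: \<Omega>_def balanced_templates_def)
  have fin\<Omega>: "finite \<Omega>" by (rule finite_subset[OF \<Omega>P]) simp
  have card\<Omega>: "fact n \<le> (1 + \<gamma>) * card \<Omega>"
  proof -
    let ?z = "4 * real n ^ (k - 1) * exp (- (\<gamma>\<^sup>2 * n / (16 * real k ^ 4)))"
    have "fact n * (1 - ?z) \<le> card (balanced_templates V E (a - \<gamma>) (a + \<gamma> + \<gamma>))"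
      by (rule card_balanced_templates[OF unif k card lo hi]) (use \<gamma> in auto)
    moreover have "a + \<gamma> + \<gamma> = a + 2 * \<gamma>" by simp
    ultimately have "fact n * (1 - ?z) \<le> card \<Omega>" unfolding \<Omega>_def by metis
    then have "(1 + \<gamma>) * (fact n * (1 - ?z)) \<le> (1 + \<gamma>) * card \<Omega>"
      using \<gamma> by (intro mult_left_mono) auto
    moreover have "fact n * 1 \<le> fact n * ((1 + \<gamma>) * (1 - ?z))"
      using balanced by (intro mult_left_mono) (simp_all add: algebra_simps)
    moreover have "fact n * ((1 + \<gamma>) * (1 - ?z)) = (1 + \<gamma>) * (fact n * (1 - ?z))" by (rule mult.left_commute)
    ultimately show ?thesis by linarith
  qed
  have \<Omega>ne: "\<Omega> \<noteq> {}"
  proof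
    assume "\<Omega> = {}"
    then have "(fact n :: real) \<le> 0" using card\<Omega> by simp
    then show False using fact_gt_zero[of n, where 'a = real] by linarith
  qed
  define \<theta> where "\<theta> = (1 + \<gamma>) * (real m ^ 2 / (n choose k))"
  have \<theta>: "0 \<le> \<theta>" using \<gamma> by (simp add: \<theta>_def)
  define cov where "cov e = {xs \<in> \<Omega>. \<exists>i<m. \<exists>j<m. template_edge xs i j = e}" for e
  have "\<exists>f. (\<forall>t<N. f t \<in> \<Omega>) \<and> (\<forall>e\<in>E. card {t. t < N \<and> f t \<in> cov e} \<le> d)"
  proof (rule exists_selection_bounded_multiplicity[OF fin\<Omega> \<Omega>ne finE _ _ \<gamma> \<theta>])
    show "cov e \<subseteq> \<Omega>" for e by (auto simp: cov_def)
    show "card (cov e) \<le> \<theta> * card \<Omega>" if e: "e \<in> E" for e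
    proof -
      have "card (cov e) \<le> card {xs \<in> permutations_of_set V. \<exists>i<m. \<exists>j<m. template_edge xs i j = e}"
        by (rule card_mono) (use \<Omega>P in \<open>auto simp: cov_def\<close>)
      then have "real (card (cov e)) \<le> real m ^ 2 * (fact n / (n choose k))"
        using card_templates_through_edge[OF unif card e k] by linarith
      also have "\<dots> = (real m ^ 2 / (n choose k)) * fact n" by simp
      also have "\<dots> \<le> (real m ^ 2 / (n choose k)) * ((1 + \<gamma>) * card \<Omega>)"
        by (rule mult_left_mono[OF card\<Omega>]) simp
      finally show ?thesis by (simp add: \<theta>_def mult_ac)
    qed
    show "N * \<theta> \<le> (1 - \<gamma>) * d" using N_le by (simp add: \<theta>_def)
    have "card E \<le> card {e. e \<subseteq> V \<and> card e = k}"
      by (rule card_mono) (use Ek finV in auto)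
    also have "\<dots> \<le> n ^ k" using n_subsets[OF finV] card binomial_le_pow[of k n] k_less_n by simp
    finally have "real (card E) \<le> real n ^ k" by (simp flip: of_nat_power)
    then have "real (card E) * exp (- (\<gamma>\<^sup>2 / 4 * d)) \<le> real n ^ k * exp (- (\<gamma>\<^sup>2 / 4 * d))"
      by (rule mult_right_mono) simp
    then show "real (card E) * exp (- (\<gamma>\<^sup>2 / 4 * d)) < 1" using multiplicity by linarith
  qed
  then obtain f where f: "\<And>t. t < N \<Longrightarrow> f t \<in> \<Omega>" "\<And>e. e \<in> E \<Longrightarrow> card {t. t < N \<and> f t \<in> cov e} \<le> d" by blast
  have fP: "f t \<in> permutations_of_set V" if "t < N" for t using f(1)[OF that] \<Omega>P by blast
  define T where "T e = {t. t < N \<and> f t \<in> cov e}" for e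
  define J0 where "J0 = {(S, S'). S \<subseteq> {..<m} \<and> S' \<subseteq> {..<m} \<and> m < card S + card S'}"
  have finJ0: "finite J0"
    by (rule finite_subset[of _ "Pow {..<m} \<times> Pow {..<m}"]) (auto simp: J0_def)
  define J where "J = {..<N} \<times> J0"
  define Q where "Q = (\<lambda>(t, S, S'). (\<lambda>(i, j). template_edge (f t) i j) ` (template_graph E (f t) \<inter> S \<times> S'))"
  have cQ: "card (Q (t, S, S')) = card (template_graph E (f t) \<inter> S \<times> S')" if t: "t < N" for t S S'
  proof -
    have l: "length (f t) = n" "distinct (f t)"
      using permutations_of_setD[OF fP[OF t]] length_finite_permutations_of_set[OF fP[OF t]] card by auto
    have "inj_on (\<lambda>(i, j). template_edge (f t) i j) (template_graph E (f t) \<inter> S \<times> S')"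
      by (rule inj_on_subset[OF inj_on_template_edge[OF k l(2,1)]]) (auto simp: template_graph_def)
    then show ?thesis by (simp add: Q_def card_image)
  qed
  have count: "\<rho> * m * (card S + card S' - real m) \<le> card (Q (t, S, S'))"
    "\<kappa> * m * min (card S) (card S') \<le> card (Q (t, S, S'))"
    if t: "t < N" and SS: "(S, S') \<in> J0" for t S S'
    using balanced_template_edge_count[OF k f(1)[OF t, unfolded \<Omega>_def], of S S' \<eta> \<kappa> \<rho>] SS \<gamma>(1) \<eta> \<rho> \<kappa> cQ[OF t]
    by (auto simp: J0_def)
  \<comment> \<open>The bound \<open>\<kappa> * m * min (card S) (card S')\<close> on the size of
    \<open>Q\<close> turns the Chernoff failure into a summand of \<open>sum_exp_min_card_le\<close>
    with this constant.\<close>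
  let ?K = "\<gamma>\<^sup>2 * \<kappa> * m / (4 * d)"
  have "\<exists>H. (\<forall>s t. s \<noteq> t \<longrightarrow> H s \<inter> H t = {}) \<and> (\<forall>t. H t \<subseteq> {e \<in> E. t \<in> T e}) \<and>
           (\<forall>j\<in>J. (1 - \<gamma>) * card (Q j) / d \<le> card (Q j \<inter> H (fst j)))"
  proof (rule exists_balanced_split[OF finE _ d _ _ _ \<gamma>])
    show "finite J" using finJ0 by (simp add: J_def)
    show "finite (T e)" for e by (simp add: T_def)
    show "card (T e) \<le> d" if "e \<in> E" for e using f(2)[OF that] by (simp add: T_def)
    show "Q j \<subseteq> {e \<in> E. fst j \<in> T e}" if "j \<in> J" for j
      using that f(1) by (auto simp: J_def Q_def T_def cov_def template_graph_def) blast
    have "(\<Sum>j\<in>J. exp (- (\<gamma>\<^sup>2 / 4 * card (Q j) / d)))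
        = (\<Sum>t<N. \<Sum>p\<in>J0. exp (- (\<gamma>\<^sup>2 / 4 * card (Q (t, p)) / d)))"
      unfolding J_def by (subst sum.cartesian_product) (auto intro: sum.cong)
    also have "\<dots> \<le> (\<Sum>t<N. \<Sum>(S, S')\<in>J0. exp (- (?K * min (card S) (card S'))))"
    proof (intro sum_mono)
      fix t p assume t: "t \<in> {..<N}" and p: "p \<in> J0"
      obtain S S' where pSS: "p = (S, S')" by (cases p)
      have SS: "(S, S') \<in> J0" using p pSS by simp
      have "\<gamma>\<^sup>2 / 4 / d * (\<kappa> * m * min (card S) (card S')) \<le> \<gamma>\<^sup>2 / 4 / d * card (Q (t, S, S'))"
        using count(2)[OF _ SS] t by (intro mult_left_mono) auto
      then show "exp (- (\<gamma>\<^sup>2 / 4 * card (Q (t, p)) / d)) \<le> (case p of (S, S') \<Rightarrow> exp (- (?K * min (card S) (card S'))))"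
        by (simp add: pSS mult_ac)
    qed
    also have "\<dots> \<le> (\<Sum>t<N. 12 * m * exp (- (?K / 2)))"
    proof (rule sum_mono)
      fix t
      have K0: "0 \<le> ?K" using \<kappa> by simp
      \<comment> \<open>As \<open>N \<ge> 1\<close>, \<open>split\<close> also yields the smallness
        that \<open>sum_exp_min_card_le\<close> presupposes.\<close>
      have "1 * (12 * m * exp (- (?K / 2))) \<le> N * (12 * m * exp (- (?K / 2)))"
        using N by (intro mult_right_mono) auto
      then have "m * exp (- (?K / 2)) \<le> 1" using split by simp
      then show "(\<Sum>(S, S')\<in>J0. exp (- (?K * min (card S) (card S')))) \<le> 12 * m * exp (- (?K / 2))"
        unfolding J0_def using sum_exp_min_card_le[of "{..<m}" "{..<m}" m ?K] K0 by simp
    qed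
    also have "\<dots> = N * (12 * m * exp (- (?K / 2)))" by simp
    also have "\<dots> < 1" by (rule split)
    finally show "(\<Sum>j\<in>J. exp (- (\<gamma>\<^sup>2 / 4 * card (Q j) / d))) < 1" .
  qed
  then obtain H where H: "\<And>s t. s \<noteq> t \<Longrightarrow> H s \<inter> H t = {}" "\<And>t. H t \<subseteq> E"
    "\<And>j. j \<in> J \<Longrightarrow> (1 - \<gamma>) * card (Q j) / d \<le> card (Q j \<inter> H (fst j))" by blast
  have "\<exists>C :: nat \<Rightarrow> 'a set set. \<forall>a<r. hamilton_cycle k l V E (C a) \<and> C a \<subseteq> H t \<and> card (C a) = m \<and>
           (\<forall>b<r. a \<noteq> b \<longrightarrow> C a \<inter> C b = {})" if t: "t < N" for t
  proof (rule exists_hamilton_cycles_in_template[OF k unif card fP[OF t]])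
    fix S S' assume SS: "S \<subseteq> {..<m}" "S' \<subseteq> {..<m}" "m < card S + card S'"
    then have J0: "(S, S') \<in> J0" by (simp add: J0_def)
    then have "(t, S, S') \<in> J" using t by (simp add: J_def)
    from H(3)[OF this] have h: "(1 - \<gamma>) * card (Q (t, S, S')) / d \<le> card (Q (t, S, S') \<inter> H t)" by simp
    have "real r * (card S + card S' - real m) \<le> (1 - \<gamma>) * \<rho> * m / d * (card S + card S' - real m)"
      using r SS(3) by (intro mult_right_mono) auto
    also have "\<dots> = (1 - \<gamma>) / d * (\<rho> * m * (card S + card S' - real m))" by simp
    also have "\<dots> \<le> (1 - \<gamma>) / d * card (Q (t, S, S'))"
      using count(1)[OF t J0] \<gamma> by (intro mult_left_mono) auto
    also have "\<dots> \<le> card (Q (t, S, S') \<inter> H t)" using h by simp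
    finally have "real (r * (card S + card S' - m)) \<le> real (card (Q (t, S, S') \<inter> H t))"
      using SS(3) by (simp add: of_nat_diff)
    then have "r * (card S + card S' - m) \<le> card (Q (t, S, S') \<inter> H t)" by (rule of_nat_le_iff[THEN iffD1])
    then show "r * (card S + card S' - m)
        \<le> card ((\<lambda>(i, j). template_edge (f t) i j) ` (template_graph E (f t) \<inter> S \<times> S') \<inter> H t)"
      by (simp add: Q_def)
  qed
  then obtain C :: "nat \<Rightarrow> nat \<Rightarrow> 'a set set" where C: "\<And>t a. t < N \<Longrightarrow> a < r \<Longrightarrow>
      hamilton_cycle k l V E (C t a) \<and> C t a \<subseteq> H t \<and> card (C t a) = m \<and> (\<forall>b<r. a \<noteq> b \<longrightarrow> C t a \<inter> C t b = {})"
    by metis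
  have finC: "finite (C t a)" if "t < N" "a < r" for t a
    using C[OF that] H(2)[of t] finE by (meson finite_subset subset_trans)
  let ?I = "{..<N} \<times> {..<r}"
  have disj: "C t a \<inter> C t' a' = {}" if "(t, a) \<in> ?I" "(t', a') \<in> ?I" "(t, a) \<noteq> (t', a')" for t a t' a'
  proof (cases "t = t'")
    case True
    then show ?thesis using C[of t a] that by auto
  next
    case False
    then have "H t \<inter> H t' = {}" by (rule H(1))
    then show ?thesis using C[of t a] C[of t' a'] that by blast
  qed
  let ?\<C> = "(\<lambda>(t, a). C t a) ` ?I"
  have "\<forall>c\<in>?\<C>. hamilton_cycle k l V E c" using C by auto
  moreover have "pairwise disjnt ?\<C>"
    unfolding pairwise_def disjnt_def using disj by fastforce
  moreover have "card (\<Union>?\<C>) = N * r * m"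
  proof -
    have "card (\<Union>p\<in>?I. case p of (t, a) \<Rightarrow> C t a) = (\<Sum>p\<in>?I. card (case p of (t, a) \<Rightarrow> C t a))"
    proof (rule card_UN_disjoint)
      show "\<forall>p\<in>?I. finite (case p of (t, a) \<Rightarrow> C t a)"
        using finC by auto
      show "\<forall>p\<in>?I. \<forall>p'\<in>?I. p \<noteq> p' \<longrightarrow> (case p of (t, a) \<Rightarrow> C t a) \<inter> (case p' of (t, a) \<Rightarrow> C t a) = {}"
        using disj by fastforce
    qed simp
    also have "\<dots> = (\<Sum>p\<in>?I. m)" by (rule sum.cong) (use C in auto)
    finally show ?thesis by simp
  qed
  ultimately show ?thesis by blast
qed

end

section \<open>Asymptotics, accounting and choice of parameters\<close>

lemma eventually_power_times_exp_sqrt_less: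
  fixes B c e :: real and p :: nat
  assumes c: "0 < c" and e: "0 < e"
  shows "eventually (\<lambda>n. B * real n ^ p * exp (- (c * sqrt n)) < e) sequentially"
proof -
  have f: "filterlim (\<lambda>n. c * sqrt (real n)) at_top sequentially" using c by real_asymp
  have "((\<lambda>n. (c * sqrt (real n)) ^ (2 * p) / exp (c * sqrt (real n))) \<longlongrightarrow> 0) sequentially"
    by (rule filterlim_compose[OF tendsto_power_div_exp_0 f])
  then have "((\<lambda>n. B / c ^ (2 * p) * ((c * sqrt (real n)) ^ (2 * p) / exp (c * sqrt (real n)))) \<longlongrightarrow> B / c ^ (2 * p) * 0) sequentially"
    by (intro tendsto_mult tendsto_const)
  moreover have "B / c ^ (2 * p) * ((c * sqrt (real n)) ^ (2 * p) / exp (c * sqrt (real n))) = B * real n ^ p * exp (- (c * sqrt n))" for n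
  proof -
    have "(c * sqrt (real n)) ^ (2 * p) = c ^ (2 * p) * real n ^ p"
      unfolding power_mult_distrib by (simp add: power_mult)
    then show ?thesis using c by (simp add: exp_minus divide_inverse)
  qed
  ultimately have "((\<lambda>n. B * real n ^ p * exp (- (c * sqrt n))) \<longlongrightarrow> 0) sequentially" by simp
  then show ?thesis using e by (intro order_tendstoD(2)) auto
qed

text \<open>\<open>k * card E\<close> is the sum of all codegrees, and
  \<open>k * (n choose k) = (n - k + 1) * (n choose (k - 1))\<close> turns it into a share of all
  \<open>k\<close>-sets, up to the factor \<open>n / (n - k + 1)\<close>, which tends to 1.\<close>

lemma card_edges_le:
  fixes b :: real
  assumes unif: "uniform_hypergraph k V E" and k: "1 \<le> k" and kn: "k \<le> card V"
    and hi: "\<And>A. A \<subseteq> V \<Longrightarrow> card A = k - 1 \<Longrightarrow> hdegree E A \<le> b * card V"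
  shows "real (card V - k + 1) * card E \<le> b * card V * (card V choose k)"
proof -
  have finV: "finite V" using unif by (simp add: uniform_hypergraph_def)
  let ?n = "card V"
  let ?X = "{B. B \<subseteq> V \<and> card B = k - 1 \<and> {} \<subseteq> B}"
  have cX: "card ?X = ?n choose (k - 1)" using n_subsets[OF finV] by simp
  have "k * card E = (\<Sum>B\<in>?X. hdegree E B)"
    using sum_hdegree_supersets[OF unif k, of "{}"] by (simp add: hdegree_def)
  then have "real k * card E = (\<Sum>B\<in>?X. real (hdegree E B))"
    by (metis of_nat_mult of_nat_sum)
  also have "\<dots> \<le> (\<Sum>B\<in>?X. b * ?n)" by (rule sum_mono) (use hi in auto)
  also have "\<dots> = b * ?n * (?n choose (k - 1))" using cX by simp
  finally have *: "real k * card E \<le> b * ?n * (?n choose (k - 1))" .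
  have "k * (?n choose k) = (?n - k + 1) * (?n choose (k - 1))"
  proof -
    have "Suc (k - 1) * (?n choose Suc (k - 1)) = (?n - (k - 1)) * (?n choose (k - 1))"
      by (simp only: binomial_absorption binomial_absorb_comp)
    then show ?thesis using k kn by (simp add: Suc_diff_le)
  qed
  then have bin: "real k * (?n choose k) = real (?n - k + 1) * (?n choose (k - 1))"
    by (metis of_nat_mult)
  have "real k * (real (?n - k + 1) * card E) = real (?n - k + 1) * (real k * card E)" by simp
  also have "\<dots> \<le> real (?n - k + 1) * (b * ?n * (?n choose (k - 1)))"
    using * by (intro mult_left_mono) auto
  also have "\<dots> = b * ?n * (real (?n - k + 1) * (?n choose (k - 1)))" by simp
  also have "\<dots> = real k * (b * ?n * (?n choose k))" unfolding bin[symmetric] by simp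
  finally show ?thesis by (rule mult_left_le_imp_le) (use k in simp)
qed

text \<open>All that is asked of large \<open>n\<close> is collected in \<open>n0\<close> to
  \<open>n5\<close>: \<open>n1\<close>, \<open>n2\<close>, \<open>n3\<close> feed the three
  probabilistic bounds, while \<open>n4\<close> and \<open>n5\<close> make the rounding of
  \<open>N\<close> and \<open>r\<close> negligible.\<close>

lemma hamilton_cycle_packing_large:
  fixes \<alpha> \<gamma> \<rho> \<kappa> \<eta> \<delta> :: real and k l n :: nat
  assumes k: "2 \<le> k" and l: "2 * l < k" and dvd: "(k - l) dvd n"
    and unif: "uniform_hypergraph k V E" and card: "card V = n"
    and lo: "\<And>A. A \<subseteq> V \<Longrightarrow> card A = k - 1 \<Longrightarrow> \<alpha> * n \<le> hdegree E A"
    and hi: "\<And>A. A \<subseteq> V \<Longrightarrow> card A = k - 1 \<Longrightarrow> hdegree E A \<le> (\<alpha> + \<gamma>) * n"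
    and \<alpha>: "\<alpha> \<le> 1" and \<gamma>: "0 < \<gamma>" "\<gamma> < 1" "8 * \<gamma> + \<eta> \<le> \<delta>" and \<eta>: "0 \<le> \<eta>" "3 * \<gamma> / 2 \<le> \<eta> * \<kappa>"
    and \<rho>: "\<rho> = \<alpha> - \<gamma> - \<eta>" and \<kappa>: "0 < \<kappa>" "\<kappa> \<le> \<rho> - 1/2"
    and n0: "3 * k \<le> n" "real n \<le> (1 + \<gamma>) * real (n - k + 1)"
    and n1: "(1 + \<gamma>) * 4 * real n ^ (k - 1) * exp (- (\<gamma>\<^sup>2 / (16 * real k ^ 4) * sqrt n)) < \<gamma>"
    and n2: "1 * real n ^ k * exp (- (\<gamma>\<^sup>2 / 4 * sqrt n)) < 1"
    and n3: "24 * real n ^ (k + 2) * exp (- (\<gamma>\<^sup>2 * \<kappa> / (16 * k) * sqrt n)) < 1"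
    and n4: "1 \<le> \<gamma> * (1 - \<gamma>) / (2 * real k ^ k) * sqrt n"
    and n5: "1 \<le> \<gamma> * (1 - \<gamma>) * \<rho> / (2 * real k) * sqrt n"
  shows "\<exists>\<C>. (\<forall>C\<in>\<C>. hamilton_cycle k l V E C) \<and> pairwise disjnt \<C> \<and>
           real (card (E - \<Union>\<C>)) \<le> \<delta> * real (n choose k)"
proof -
  define q where "q = k - l"
  define m where "m = n div q"
  have q: "0 < q" "q \<le> k" using l by (auto simp: q_def)
  have nmq: "n = m * q" using dvd by (simp add: m_def q_def)
  have m3: "3 \<le> m"
  proof (rule ccontr)
    assume "\<not> 3 \<le> m"
    then have "m * q \<le> 2 * k" using q by (intro mult_le_mono) auto
    then show False using n0 nmq k by simp
  qed
  interpret cyclic_template k l m q n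
    using l m3 nmq by unfold_locales (auto simp: q_def)
  define s where "s = sqrt n"
  have n_ge: "1 \<le> real n" using n_pos by simp
  have s1: "1 \<le> s" using n_ge by (simp add: s_def)
  have ss: "s * s = n" by (simp add: s_def)
  have "s * 1 \<le> s * s" using s1 by (intro mult_left_mono) auto
  then have s: "1 \<le> s" "s * s = n" "s \<le> n" using s1 ss by simp_all
  define d where "d = nat \<lceil>s\<rceil>"
  have d: "s \<le> d" "d \<le> 2 * s" "0 < d" using s by (auto simp: d_def) linarith+
  have dpos: "0 < real d" using d by simp
  have mn: "real n \<le> real m * k" "real m \<le> n" "0 < real m"
    using nmq q m3 by (auto simp flip: of_nat_mult)
  have Cpos: "0 < real (n choose k)" using n0 by simp
  have C_le: "real (n choose k) \<le> real n ^ k" using binomial_le_pow[of k n] n0 by (simp flip: of_nat_power)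
  \<comment> \<open>An upper bound for the probability that a fixed edge occurs in a random balanced
    listing.\<close>
  define \<theta> where "\<theta> = (1 + \<gamma>) * (real m ^ 2 / (n choose k))"
  have \<theta>: "0 < \<theta>" using \<gamma> mn Cpos by (simp add: \<theta>_def)
  define N where "N = nat \<lfloor>(1 - \<gamma>) * d / \<theta>\<rfloor>"
  define r where "r = nat \<lfloor>(1 - \<gamma>) * \<rho> * m / d\<rfloor>"
  have \<rho>0: "0 < \<rho>" using \<kappa> by simp
  have N_hi: "N \<le> (1 - \<gamma>) * d / \<theta>" using \<gamma> \<theta> by (simp add: N_def)
  have r_hi: "r \<le> (1 - \<gamma>) * \<rho> * m / d" using \<gamma> \<rho>0 by (simp add: r_def)
  have d\<theta>: "s / (2 * real k ^ k) \<le> d / \<theta>"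
  proof -
    have "(real n / k) ^ k \<le> n choose k" using n0 by (intro binomial_ge_n_over_k_pow_k) simp
    moreover have "real n ^ 2 \<le> real n ^ k" using n_ge k by (intro power_increasing)
    ultimately have "real n ^ 2 / real k ^ k \<le> n choose k"
      by (smt (verit) divide_right_mono power_divide zero_le_power of_nat_0_le_iff)
    moreover have "real m ^ 2 \<le> real n ^ 2" using mn by (intro power_mono) auto
    ultimately have c1: "real m ^ 2 / real k ^ k \<le> n choose k"
      by (smt (verit) divide_right_mono zero_le_power of_nat_0_le_iff)
    have "\<theta> \<le> 2 * (real m ^ 2 / (n choose k))" unfolding \<theta>_def using \<gamma> by (intro mult_right_mono) auto
    also have "\<dots> \<le> 2 * real k ^ k"
      using c1 Cpos k by (simp add: field_simps)
    finally have "\<theta> \<le> 2 * real k ^ k" .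
    then show ?thesis using \<theta> d s by (intro frac_le) auto
  qed
  have md: "s / (2 * real k) \<le> m / d"
  proof -
    have "s * d \<le> s * (2 * s)" using d s by (intro mult_left_mono) auto
    also have "\<dots> = 2 * n" using s by simp
    also have "\<dots> \<le> m * (2 * real k)" using mn by simp
    finally show ?thesis using dpos k by (simp add: field_simps)
  qed
  \<comment> \<open>Rounding down costs at most 1, by \<open>n4\<close> at most the fraction
    \<gamma> of \<open>(1 - \<gamma>) * d / \<theta>\<close>; hence a second factor
    \<open>1 - \<gamma>\<close>. The same happens to \<open>r\<close> with
    \<open>n5\<close>.\<close>
  have N_lo: "(1 - \<gamma>)\<^sup>2 * (d / \<theta>) \<le> N"
  proof -
    have "1 \<le> \<gamma> * (1 - \<gamma>) * (s / (2 * real k ^ k))" using n4 by (simp add: s_def)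
    also have "\<dots> \<le> \<gamma> * (1 - \<gamma>) * (d / \<theta>)" using \<gamma> d\<theta> by (intro mult_left_mono) auto
    finally have 1: "1 \<le> \<gamma> * (1 - \<gamma>) * (d / \<theta>)" .
    have "(1 - \<gamma>) * d / \<theta> - 1 \<le> N" unfolding N_def by linarith
    moreover have "(1 - \<gamma>)\<^sup>2 * (d / \<theta>) = (1 - \<gamma>) * d / \<theta> - \<gamma> * (1 - \<gamma>) * (d / \<theta>)"
      by (simp add: power2_eq_square algebra_simps diff_divide_distrib add_divide_distrib)
    ultimately show ?thesis using 1 by linarith
  qed
  have r_lo: "(1 - \<gamma>)\<^sup>2 * (\<rho> * m / d) \<le> r"
  proof -
    have "1 \<le> \<gamma> * (1 - \<gamma>) * \<rho> * (s / (2 * real k))" using n5 by (simp add: s_def)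
    also have "\<dots> \<le> \<gamma> * (1 - \<gamma>) * \<rho> * (m / d)" using \<gamma> \<rho>0 md by (intro mult_left_mono) auto
    finally have 1: "1 \<le> \<gamma> * (1 - \<gamma>) * \<rho> * (m / d)" .
    have "(1 - \<gamma>) * \<rho> * m / d - 1 \<le> r" unfolding r_def by linarith
    moreover have "(1 - \<gamma>)\<^sup>2 * (\<rho> * m / d) = (1 - \<gamma>) * \<rho> * m / d - \<gamma> * (1 - \<gamma>) * \<rho> * (m / d)"
      by (simp add: power2_eq_square algebra_simps diff_divide_distrib add_divide_distrib)
    ultimately show ?thesis using 1 by linarith
  qed
  have "0 < (1 - \<gamma>)\<^sup>2 * (d / \<theta>)" using \<gamma> \<theta> dpos by simp
  then have N0: "0 < N" using N_lo by (simp flip: of_nat_0_less_iff)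
  have "\<exists>\<C>. (\<forall>C\<in>\<C>. hamilton_cycle k l V E C) \<and> pairwise disjnt \<C> \<and> card (\<Union>\<C>) = N * r * m"
  proof (rule exists_hamilton_cycle_packing[OF k unif card lo hi \<gamma>(1,2) \<eta> _ _ \<kappa>(2) d(3) N0 _ _ _ _ r_hi])
    show "\<rho> \<le> \<alpha> - \<gamma> - \<eta>" using \<rho> by simp
    show "0 \<le> \<kappa>" using \<kappa> by simp
    show "(1 + \<gamma>) * (4 * real n ^ (k - 1) * exp (- (\<gamma>\<^sup>2 * n / (16 * real k ^ 4)))) \<le> \<gamma>"
    proof -
      have "\<gamma>\<^sup>2 / (16 * real k ^ 4) * s \<le> \<gamma>\<^sup>2 / (16 * real k ^ 4) * n" using s by (intro mult_left_mono) auto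
      then have "(1 + \<gamma>) * 4 * real n ^ (k - 1) * exp (- (\<gamma>\<^sup>2 / (16 * real k ^ 4) * n))
          \<le> (1 + \<gamma>) * 4 * real n ^ (k - 1) * exp (- (\<gamma>\<^sup>2 / (16 * real k ^ 4) * s))"
        using \<gamma> by (intro mult_left_mono) auto
      then show ?thesis using n1 by (simp add: s_def algebra_simps)
    qed
    show "N * ((1 + \<gamma>) * (real m ^ 2 / (n choose k))) \<le> (1 - \<gamma>) * d"
      unfolding \<theta>_def[symmetric] using N_hi \<theta> by (simp add: pos_le_divide_eq)
    show "real n ^ k * exp (- (\<gamma>\<^sup>2 / 4 * d)) < 1"
    proof -
      have "\<gamma>\<^sup>2 / 4 * s \<le> \<gamma>\<^sup>2 / 4 * d" using d by (intro mult_left_mono) auto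
      then have "real n ^ k * exp (- (\<gamma>\<^sup>2 / 4 * d)) \<le> real n ^ k * exp (- (\<gamma>\<^sup>2 / 4 * s))"
        by (intro mult_left_mono) auto
      then show ?thesis using n2 by (simp add: s_def)
    qed
    show "N * (12 * m * exp (- (\<gamma>\<^sup>2 * \<kappa> * m / (4 * d) / 2))) < 1"
    proof -
      \<comment> \<open>Crude bounds suffice against the exponential: \<open>d \<le> 2 * n\<close>
        and \<open>1 / \<theta> \<le> n choose k \<le> n ^ k\<close>. With
        \<open>12 * m \<le> 12 * n\<close> they produce the 24 and the power \<open>k + 2\<close> of
        \<open>n3\<close>.\<close>
      have "real N \<le> 2 * real n ^ (k + 1)"
      proof -
        have "1 * (real (m ^ 2) / (n choose k)) \<le> \<theta>" unfolding \<theta>_def using \<gamma> by (intro mult_mono) auto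
        moreover have "1 \<le> real (m ^ 2)" using m3 by simp
        ultimately have \<theta>1: "1 / (n choose k) \<le> \<theta>"
          by (smt (verit) divide_right_mono of_nat_0_le_iff mult_1)
        have "real N \<le> d / \<theta>"
          using N_hi \<gamma> \<theta> dpos by (smt (verit) divide_right_mono mult_left_le_one_le)
        also have "\<dots> \<le> d / (1 / (n choose k))" using \<theta>1 \<theta> Cpos dpos
          by (intro divide_left_mono mult_pos_pos) auto
        also have "\<dots> = real d * real (n choose k)" by simp
        also have "\<dots> \<le> (2 * real n) * real n ^ k" using C_le d s by (intro mult_mono) auto
        finally show ?thesis by simp
      qed
      moreover have "12 * real m \<le> 12 * n" using mn by simp
      moreover have "exp (- (\<gamma>\<^sup>2 * \<kappa> * m / (4 * d) / 2)) \<le> exp (- (\<gamma>\<^sup>2 * \<kappa> / (16 * k) * s))"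
      proof -
        have "\<gamma>\<^sup>2 * \<kappa> / 8 * (s / (2 * real k)) \<le> \<gamma>\<^sup>2 * \<kappa> / 8 * (m / d)"
          using md \<kappa> by (intro mult_left_mono) auto
        then show ?thesis by (simp add: mult_ac)
      qed
      ultimately have "real N * (12 * m * exp (- (\<gamma>\<^sup>2 * \<kappa> * m / (4 * d) / 2)))
          \<le> (2 * real n ^ (k + 1)) * (12 * n * exp (- (\<gamma>\<^sup>2 * \<kappa> / (16 * k) * s)))"
        by (intro mult_mono) auto
      also have "\<dots> = 24 * real n ^ (k + 2) * exp (- (\<gamma>\<^sup>2 * \<kappa> / (16 * k) * s))" by simp
      also have "\<dots> < 1" using n3 by (simp add: s_def)
      finally show ?thesis .
    qed
  qed
  then obtain \<C> where \<C>: "\<And>C. C \<in> \<C> \<Longrightarrow> hamilton_cycle k l V E C" "pairwise disjnt \<C>" "card (\<Union>\<C>) = N * r * m" by blast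
  have E_hi: "card E \<le> (\<alpha> + \<gamma>) * (1 + \<gamma>) * (n choose k)"
  proof -
    have pos: "0 < real (n - k + 1)" by simp
    have ag: "0 \<le> \<alpha> + \<gamma>" using \<rho> \<rho>0 \<gamma> \<eta> by simp
    have "real (n - k + 1) * card E \<le> (\<alpha> + \<gamma>) * n * (n choose k)"
      using card_edges_le[OF unif, of "\<alpha> + \<gamma>"] k n0 card hi by simp
    also have "\<dots> \<le> (\<alpha> + \<gamma>) * ((1 + \<gamma>) * real (n - k + 1)) * (n choose k)"
      using n0(2) ag by (intro mult_right_mono mult_left_mono) auto
    also have "\<dots> = real (n - k + 1) * ((\<alpha> + \<gamma>) * (1 + \<gamma>) * (n choose k))" by simp
    finally show ?thesis by (rule mult_left_le_imp_le[OF _ pos])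
  qed
  have covered: "(1 - 5 * \<gamma>) * \<rho> * (n choose k) \<le> real (N * r * m)"
  proof -
    \<comment> \<open>\<open>N_lo\<close> and \<open>r_lo\<close> contribute
      \<open>(1 - \<gamma>)^4\<close> and \<theta> contributes \<open>1 / (1 + \<gamma>)\<close>, a
      loss of at most \<open>5 * \<gamma>\<close>.\<close>
    have "(1 - 5 * \<gamma>) * (1 + \<gamma>) \<le> (1 - \<gamma>)\<^sup>2 * (1 - \<gamma>)\<^sup>2"
    proof -
      have "(1 - \<gamma>)\<^sup>2 * (1 - \<gamma>)\<^sup>2 - (1 - 5 * \<gamma>) * (1 + \<gamma>) = \<gamma>\<^sup>2 * ((\<gamma> - 2)\<^sup>2 + 7)"
        by (simp add: power2_eq_square algebra_simps)
      moreover have "0 \<le> \<gamma>\<^sup>2 * ((\<gamma> - 2)\<^sup>2 + 7)" by simp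
      ultimately show ?thesis by linarith
    qed
    then have "(1 - 5 * \<gamma>) * (1 + \<gamma>) * (\<rho> * m * m / \<theta>) \<le> (1 - \<gamma>)\<^sup>2 * (1 - \<gamma>)\<^sup>2 * (\<rho> * m * m / \<theta>)"
      using \<rho>0 \<theta> by (intro mult_right_mono) auto
    also have "\<dots> = ((1 - \<gamma>)\<^sup>2 * (d / \<theta>)) * ((1 - \<gamma>)\<^sup>2 * (\<rho> * m / d)) * m" using dpos by simp
    also have "\<dots> \<le> real N * real r * real m"
      using N_lo r_lo \<theta> \<rho>0 by (intro mult_right_mono mult_mono) auto
    finally have 1: "(1 - 5 * \<gamma>) * (1 + \<gamma>) * (\<rho> * m * m / \<theta>) \<le> real (N * r * m)" by simp
    have "(1 + \<gamma>) * (\<rho> * m * m / \<theta>) = \<rho> * (n choose k)"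
      unfolding \<theta>_def using \<gamma> mn Cpos by (simp add: power2_eq_square)
    then have "(1 - 5 * \<gamma>) * (1 + \<gamma>) * (\<rho> * m * m / \<theta>) = (1 - 5 * \<gamma>) * \<rho> * (n choose k)"
      by (simp only: mult.assoc)
    then show ?thesis using 1 by simp
  qed
  have finE: "finite E"
    using unif unfolding uniform_hypergraph_def by (metis PowI finite_Pow_iff finite_subset subsetI)
  have sub: "\<Union>\<C> \<subseteq> E" using \<C>(1) by (auto simp: hamilton_cycle_def)
  have "real (card (E - \<Union>\<C>)) = real (card E) - real (N * r * m)"
    using sub finE \<C>(3) card_mono[OF finE sub] finite_subset[OF sub finE] by (simp add: card_Diff_subset of_nat_diff)
  also have "\<dots> \<le> (\<alpha> + \<gamma>) * (1 + \<gamma>) * (n choose k) - (1 - 5 * \<gamma>) * \<rho> * (n choose k)"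
    using E_hi covered by linarith
  also have "\<dots> = ((\<alpha> + \<gamma>) * (1 + \<gamma>) - (1 - 5 * \<gamma>) * \<rho>) * (n choose k)" by (simp add: left_diff_distrib)
  also have "\<dots> \<le> \<delta> * (n choose k)"
  proof (rule mult_right_mono)
    \<comment> \<open>As \<alpha> \<le> 1, the uncovered share is at most
      \<open>2 * \<gamma> + \<eta> + 6 * \<gamma>\<close>, the origin of
      \<open>8 * \<gamma> + \<eta> \<le> \<delta>\<close>.\<close>
    have "(\<alpha> + \<gamma>) * (1 + \<gamma>) - (1 - 5 * \<gamma>) * \<rho> = 2 * \<gamma> + \<eta> + 6 * (\<alpha> * \<gamma>) - 4 * \<gamma>\<^sup>2 - 5 * (\<gamma> * \<eta>)"
      unfolding \<rho> by (simp add: power2_eq_square algebra_simps)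
    moreover have "\<alpha> * \<gamma> \<le> 1 * \<gamma>" using \<alpha> \<gamma> by (intro mult_right_mono) auto
    moreover have "0 \<le> \<gamma>\<^sup>2" "0 \<le> \<gamma> * \<eta>" using \<gamma> \<eta> by auto
    ultimately show "(\<alpha> + \<gamma>) * (1 + \<gamma>) - (1 - 5 * \<gamma>) * \<rho> \<le> \<delta>" using \<gamma>(3) by linarith
  qed simp
  finally show ?thesis using \<C> by blast
qed

theorem theorem1p3:
  fixes k l :: nat and \<alpha> \<delta> :: real
  assumes "k \<ge> 2" and "real l < real k / 2"
    and "1/2 < \<alpha>" and "\<alpha> \<le> 1"
    and "\<delta> > 0"
  shows "\<exists>\<epsilon>>0. \<forall>\<^sub>F n in sequentially. \<forall>(V :: 'a set) E.
           (k - l) dvd n \<and> uniform_hypergraph k V E \<and> card V = n \<and>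
           real (min_hdegree (k - 1) V E) \<ge> \<alpha> * real n \<and>
           real (max_hdegree (k - 1) V E) \<le> (\<alpha> + \<epsilon>) * real n \<longrightarrow>
           (\<exists>\<C>. (\<forall>C\<in>\<C>. hamilton_cycle k l V E C) \<and>
                pairwise disjnt \<C> \<and>
                real (card (E - \<Union>\<C>)) \<le> \<delta> * real (n choose k))"
proof -
  have k: "2 \<le> k" and l: "2 * l < k" using assms(1,2) by simp_all
  \<comment> \<open>Half of the surplus \<open>\<alpha> - 1/2\<close> is kept as \<kappa>; the other
    half pays for \<gamma> and \<eta>, each at most \<open>\<kappa> / 2\<close>, so that
    \<open>\<rho> \<ge> 1/2 + \<kappa>\<close>.\<close>
  define \<kappa> where "\<kappa> = (\<alpha> - 1/2) / 2"
  have \<kappa>: "0 < \<kappa>" using assms(3) by (simp add: \<kappa>_def)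
  define \<eta> where "\<eta> = min (\<delta> / 4) (\<kappa> / 2)"
  have \<eta>: "0 < \<eta>" "\<eta> \<le> \<delta> / 4" "\<eta> \<le> \<kappa> / 2" using \<kappa> assms(5) by (auto simp: \<eta>_def)
  \<comment> \<open>\<gamma> also serves as \<epsilon>. It is chosen after \<eta> since the
    irregularity of the degrees must be small against the slack:
    \<open>3 * \<gamma> / 2 \<le> \<eta> * \<kappa>\<close>. With
    \<open>\<gamma> \<le> \<delta> / 40\<close> and \<open>\<eta> \<le> \<delta> / 4\<close> the
    final loss \<open>8 * \<gamma> + \<eta>\<close> stays below \<delta>.\<close>
  define \<gamma> where "\<gamma> = min (min (\<kappa> / 2) (1/2)) (min (\<eta> * \<kappa> / 2) (\<delta> / 40))"
  have \<gamma>: "0 < \<gamma>" "\<gamma> \<le> \<kappa> / 2" "\<gamma> \<le> 1/2" "\<gamma> \<le> \<eta> * \<kappa> / 2" "\<gamma> \<le> \<delta> / 40"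
    using \<kappa> \<eta>(1) assms(5) by (auto simp: \<gamma>_def)
  define \<rho> where "\<rho> = \<alpha> - \<gamma> - \<eta>"
  have \<rho>: "\<kappa> \<le> \<rho> - 1/2" using \<gamma>(2) \<eta>(3) by (simp add: \<rho>_def \<kappa>_def)
  have \<rho>0: "0 < \<rho>" using \<rho> \<kappa> by linarith
  have small: "8 * \<gamma> + \<eta> \<le> \<delta>" using \<gamma>(5) \<eta>(2) assms(5) by linarith
  have \<eta>\<kappa>: "3 * \<gamma> / 2 \<le> \<eta> * \<kappa>" using \<gamma>(1,4) by linarith
  have k0: "0 < real k" using k by simp
  define c1 where "c1 = \<gamma> * (1 - \<gamma>) / (2 * real k ^ k)"
  define c2 where "c2 = \<gamma> * (1 - \<gamma>) * \<rho> / (2 * real k)"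
  have c: "0 < c1" "0 < c2" using \<gamma> \<rho>0 k0 by (auto simp: c1_def c2_def)
  have big: "eventually (\<lambda>n. 1 \<le> b * sqrt (real n)) sequentially" if "0 < b" for b :: real
    using that by real_asymp
  have ratio: "eventually (\<lambda>n. real n \<le> (1 + \<gamma>) * real (n - k + 1)) sequentially"
  proof -
    have "eventually (\<lambda>n. real n \<le> (1 + \<gamma>) * (real n - real k + 1)) sequentially"
      using \<gamma>(1) by real_asymp
    moreover have "eventually (\<lambda>n. k \<le> n) sequentially" by (rule eventually_ge_at_top)
    ultimately show ?thesis by eventually_elim (simp add: of_nat_diff add.commute)
  qed
  have "eventually (\<lambda>n. 3 * k \<le> n) sequentially" by (rule eventually_ge_at_top)
  moreover note ratio
  moreover have "eventually (\<lambda>n. (1 + \<gamma>) * 4 * real n ^ (k - 1) * exp (- (\<gamma>\<^sup>2 / (16 * real k ^ 4) * sqrt n)) < \<gamma>) sequentially"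
    by (rule eventually_power_times_exp_sqrt_less) (use \<gamma>(1) k0 in auto)
  moreover have "eventually (\<lambda>n. 1 * real n ^ k * exp (- (\<gamma>\<^sup>2 / 4 * sqrt n)) < 1) sequentially"
    by (rule eventually_power_times_exp_sqrt_less) (use \<gamma>(1) in auto)
  moreover have "eventually (\<lambda>n. 24 * real n ^ (k + 2) * exp (- (\<gamma>\<^sup>2 * \<kappa> / (16 * k) * sqrt n)) < 1) sequentially"
    by (rule eventually_power_times_exp_sqrt_less) (use \<gamma>(1) \<kappa> k0 in auto)
  moreover note big[OF c(1)] big[OF c(2)]
  ultimately have "\<forall>\<^sub>F n in sequentially. \<forall>(V :: 'a set) E.
           (k - l) dvd n \<and> uniform_hypergraph k V E \<and> card V = n \<and>
           real (min_hdegree (k - 1) V E) \<ge> \<alpha> * real n \<and>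
           real (max_hdegree (k - 1) V E) \<le> (\<alpha> + \<gamma>) * real n \<longrightarrow>
           (\<exists>\<C>. (\<forall>C\<in>\<C>. hamilton_cycle k l V E C) \<and>
                pairwise disjnt \<C> \<and>
                real (card (E - \<Union>\<C>)) \<le> \<delta> * real (n choose k))"
  proof eventually_elim
    case (elim n)
    show ?case
    proof (intro allI impI)
      fix V :: "'a set" and E
      assume h: "(k - l) dvd n \<and> uniform_hypergraph k V E \<and> card V = n \<and>
           real (min_hdegree (k - 1) V E) \<ge> \<alpha> * real n \<and>
           real (max_hdegree (k - 1) V E) \<le> (\<alpha> + \<gamma>) * real n"
      have finV: "finite V" using h by (simp add: uniform_hypergraph_def)
      have deg: "\<alpha> * n \<le> hdegree E A" "hdegree E A \<le> (\<alpha> + \<gamma>) * n" if "A \<subseteq> V" "card A = k - 1" for A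
      proof -
        have "min_hdegree (k - 1) V E \<le> hdegree E A" "hdegree E A \<le> max_hdegree (k - 1) V E"
          unfolding min_hdegree_def max_hdegree_def using finV that by auto
        then show "\<alpha> * n \<le> hdegree E A" "hdegree E A \<le> (\<alpha> + \<gamma>) * n" using h by linarith+
      qed
      show "\<exists>\<C>. (\<forall>C\<in>\<C>. hamilton_cycle k l V E C) \<and> pairwise disjnt \<C> \<and>
                real (card (E - \<Union>\<C>)) \<le> \<delta> * real (n choose k)"
        by (rule hamilton_cycle_packing_large[OF k l _ _ _ deg assms(4) \<gamma>(1) _ small less_imp_le[OF \<eta>(1)] \<eta>\<kappa> \<rho>_def \<kappa> \<rho>])
          (use h \<gamma> elim in \<open>auto simp: c1_def c2_def\<close>)
    qed
  qed
  then show ?thesis using \<gamma>(1) by blast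
qed

end
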